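(* Let $f(s)=1+\sum_{n\ge1}a_n e^{-\lambda_n s}$ be a non-constant Dirichlet series as in the context, with meromorphic extension of finite order to $\mathbb{C}$ and convergence exponent $d\ge1$. Then for every $\sigma\in\mathbb{C}$, as Laplace transformable distributions on $\mathbb{R}$, $$W_\sigma(f)=\sum_{k=0}^{g-1}c_k(\sigma)\,\delta_0^{(k)}+\sum_{\mathbf{k}\in\Lambda}\langle\boldsymbol\lambda,\mathbf{k}\rangle\, b_{\mathbf{k}}\,\delta_{\langle\boldsymbol\lambda,\mathbf{k}\rangle}.$$
   Context: Dirichlet series: $a_n\in\mathbb{C}$, $0<\lambda_1<\lambda_2<\cdots$, either finitely many terms or $\lambda_n\to+\infty$, and the series converges absolutely in some half-plane $\Re s\ge\bar\sigma$. $f$ extends meromorphically to $\mathbb{C}$ with finite order; its zeros and poles then lie in a left half-plane. $\Lambda$ is the set of sequences $\mathbf{k}=(k_n)_{n\ge1}$ of non-negative integers, all but finitely many zero, with $\|\mathbf{k}\|=\sum k_n\ge1$; $\langle\boldsymbol\lambda,\mathbf{k}\rangle=\sum_n\lambda_nk_n$. The coefficients $b_{\mathbf{k}}$ are defined by $-\log f(s)=\sum_{\mathbf{k}\in\Lambda}b_{\mathbf{k}}e^{-\langle\boldsymbol\lambda,\mathbf{k}\rangle s}$ for $\Re s$ large (principal branch), explicitly $b_{\mathbf{k}}=\frac{(-1)^{\|\mathbf{k}\|}}{\|\mathbf{k}\|}\frac{\|\mathbf{k}\|!}{\prod_jk_j!}\prod_ja_j^{k_j}$. For $\rho\in\mathbb{C}$,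 $n_\rho$ is the multiplicity of $\rho$ as zero of $f$ (negative for poles, $0$ otherwise); $d$ is the least integer with $\sum_{\rho\ne0}|n_\rho||\rho|^{-d}<\infty$. Laplace transformable distribution: support in $]-M,\infty[$ for some $M$, and $e^{-ct}W\in\mathcal{S}'$ for some $c\in\mathbb{R}$. Newton–Cramer distribution: $K_{d,\sigma}(t)=\big(n_\sigma\tfrac{t^d}{d!}+\sum_{\rho\ne\sigma}\tfrac{n_\rho}{(\rho-\sigma)^d}e^{(\rho-\sigma)t}\big)\mathbf{1}_{\mathbb{R}_+}(t)$, $W_\sigma(f)=e^{\sigma t}\frac{D^d}{Dt^d}\big((K_{d,\sigma}(t)-K_{d,\sigma}(0))\mathbf{1}_{\mathbb{R}_+}\big)$ (distributional derivative). Discrepancy polynomial: with $m=d-1$, $E_m(z)=(1-z)\exp(z+\dots+z^m/m)$, Hadamard factorization $f(s)=(s-\sigma)^{n_\sigma}e^{Q_{f,\sigma}(s)}\prod_{\rho\ne\sigma}E_m(\frac{s-\sigma}{\rho-\sigma})^{n_\rho}$; genus $g=\max(\deg Q_{f,\sigma},m)$; $-Q_{f,\sigma}'(s)=c_0(\sigma)+c_1(\sigma)s+\dots+c_{g-1}(\sigma)s^{g-1}$. *)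

theory Defs
  imports "HOL-Complex_Analysis.Complex_Analysis"
begin

section \<open>Distributions on the real line\<close>

definition nderiv :: "nat \<Rightarrow> (real \<Rightarrow> complex) \<Rightarrow> real \<Rightarrow> complex" where
  "nderiv j = (\<lambda>\<phi> t. vector_derivative \<phi> (at t)) ^^ j"

definition smooth :: "(real \<Rightarrow> complex) \<Rightarrow> bool" where
  "smooth \<phi> \<longleftrightarrow> (\<forall>j t. nderiv j \<phi> differentiable (at t))"

definition fun_supp :: "(real \<Rightarrow> complex) \<Rightarrow> real set" where
  "fun_supp \<phi> = closure {t. \<phi> t \<noteq> 0}"

definition test_funs :: "(real \<Rightarrow> complex) set" where
  "test_funs = {\<phi>. smooth \<phi> \<and> compact (fun_supp \<phi>)}"

definition schwartz_funs :: "(real \<Rightarrow> complex) set" where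
  "schwartz_funs =
     {\<phi>. smooth \<phi> \<and> (\<forall>i j. bounded (range (\<lambda>t. of_real t ^ i * nderiv j \<phi> t)))}"

text \<open>A functional is a HOL function on all of \<^typ>\<open>real \<Rightarrow> complex\<close>; only its values on
  test functions (or Schwartz functions) matter, so equality of distributions is
  \<open>dist_eq\<close> below and not HOL equality.\<close>

type_synonym functional = "(real \<Rightarrow> complex) \<Rightarrow> complex"

definition linear_functional_on :: "(real \<Rightarrow> complex) set \<Rightarrow> functional \<Rightarrow> bool" where
  "linear_functional_on D U \<longleftrightarrow>
     (\<forall>\<phi>\<in>D. \<forall>\<psi>\<in>D. U (\<lambda>t. \<phi> t + \<psi> t) = U \<phi> + U \<psi>) \<and>
     (\<forall>\<phi>\<in>D. \<forall>c. U (\<lambda>t. c * \<phi> t) = c * U \<phi>)"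

text \<open>Continuity is expressed by the usual seminorm estimates. The suprema are over bounded
  sets for the functions concerned.\<close>

definition is_distribution :: "functional \<Rightarrow> bool" where
  "is_distribution U \<longleftrightarrow> linear_functional_on test_funs U \<and>
     (\<forall>K. compact K \<longrightarrow> (\<exists>C N. \<forall>\<phi>\<in>test_funs. fun_supp \<phi> \<subseteq> K \<longrightarrow>
        norm (U \<phi>) \<le> C * (\<Sum>j\<le>N. SUP t. norm (nderiv j \<phi> t))))"

definition dist_eq :: "functional \<Rightarrow> functional \<Rightarrow> bool" where
  "dist_eq U V \<longleftrightarrow> (\<forall>\<phi>\<in>test_funs. U \<phi> = V \<phi>)"

definition dist_supp :: "functional \<Rightarrow> real set" where
  "dist_supp U = {t. \<forall>S. open S \<longrightarrow> t \<in> S \<longrightarrow> (\<exists>\<phi>\<in>test_funs. fun_supp \<phi> \<subseteq> S \<and> U \<phi> \<noteq> 0)}"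

definition is_tempered :: "functional \<Rightarrow> bool" where
  "is_tempered U \<longleftrightarrow>
     (\<exists>T. linear_functional_on schwartz_funs T \<and>
        (\<exists>C N. \<forall>\<phi>\<in>schwartz_funs.
           norm (T \<phi>) \<le> C * (\<Sum>i\<le>N. \<Sum>j\<le>N. SUP t. norm (of_real t ^ i * nderiv j \<phi> t))) \<and>
        dist_eq T U)"

definition dist_mult :: "(real \<Rightarrow> complex) \<Rightarrow> functional \<Rightarrow> functional" where
  "dist_mult h U = (\<lambda>\<phi>. U (\<lambda>t. h t * \<phi> t))"

definition dist_deriv :: "functional \<Rightarrow> functional" where
  "dist_deriv U = (\<lambda>\<phi>. - U (nderiv 1 \<phi>))"

definition dist_of_fun :: "(real \<Rightarrow> complex) \<Rightarrow> functional" where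
  "dist_of_fun h = (\<lambda>\<phi>. \<integral>t. h t * \<phi> t \<partial>lborel)"

definition dirac :: "real \<Rightarrow> functional" where
  "dirac x = (\<lambda>\<phi>. \<phi> x)"

definition laplace_transformable :: "functional \<Rightarrow> bool" where
  "laplace_transformable U \<longleftrightarrow> is_distribution U \<and>
     (\<exists>M. dist_supp U \<subseteq> {-M<..}) \<and>
     (\<exists>c::real. is_tempered (dist_mult (\<lambda>t. of_real (exp (- c * t))) U))"


section \<open>Divisor and Newton--Cramer distribution of a meromorphic function\<close>

text \<open>\<open>g\<close> has finite order iff \<open>ln (ln M(r)) / ln r\<close> is bounded above for large \<open>r\<close>, where
  \<open>M(r)\<close> is the maximum of \<open>|g|\<close> on \<open>|z| = r\<close>. A meromorphic function has finite order iff it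
  is the quotient of two entire functions of finite order.\<close>

definition entire_finite_order :: "(complex \<Rightarrow> complex) \<Rightarrow> bool" where
  "entire_finite_order g \<longleftrightarrow> g holomorphic_on UNIV \<and>
     (\<exists>A R. \<forall>z. norm z \<ge> R \<longrightarrow> norm (g z) \<le> exp (norm z powr A))"

definition meromorphic_finite_order :: "(complex \<Rightarrow> complex) \<Rightarrow> bool" where
  "meromorphic_finite_order f \<longleftrightarrow> f nicely_meromorphic_on UNIV \<and>
     (\<exists>g h. entire_finite_order g \<and> entire_finite_order h \<and> (\<exists>z. h z \<noteq> 0) \<and>
        (\<forall>z. h z \<noteq> 0 \<longrightarrow> f z = g z / h z))"

text \<open>The multiplicity \<open>n\<^sub>\<rho>\<close> is \<^term>\<open>zorder f \<rho>\<close>, which vanishes when \<open>\<rho>\<close> is neither a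
  zero nor a pole. Sums and products over \<open>\<rho> \<noteq> \<sigma>\<close> therefore range over \<open>- {\<sigma>}\<close>.

  The least exponent is sought among the natural numbers. With infinitely many zeros and poles
  no exponent \<open>\<le> 0\<close> is summable, so this is the least integer; with finitely many it is \<open>0\<close>.\<close>

definition conv_exponent :: "(complex \<Rightarrow> complex) \<Rightarrow> nat" where
  "conv_exponent f =
     (LEAST d. (\<lambda>\<rho>. \<bar>of_int (zorder f \<rho>)\<bar> / norm \<rho> ^ d) summable_on - {0})"

definition newton_cramer_kernel :: "(complex \<Rightarrow> complex) \<Rightarrow> nat \<Rightarrow> complex \<Rightarrow> real \<Rightarrow> complex" where
  "newton_cramer_kernel f d \<sigma> t =
     (of_int (zorder f \<sigma>) * of_real t ^ d / fact d +
      (\<Sum>\<^sub>\<infinity>\<rho>\<in>- {\<sigma>}. of_int (zorder f \<rho>) / (\<rho> - \<sigma>) ^ d * exp ((\<rho> - \<sigma>) * of_real t)))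
     * indicator {0..} t"

definition newton_cramer :: "(complex \<Rightarrow> complex) \<Rightarrow> complex \<Rightarrow> functional" where
  "newton_cramer f \<sigma> =
     (let d = conv_exponent f; K = newton_cramer_kernel f d \<sigma> in
      dist_mult (\<lambda>t. exp (\<sigma> * of_real t))
        ((dist_deriv ^^ d) (dist_of_fun (\<lambda>t. (K t - K 0) * indicator {0..} t))))"


section \<open>Hadamard factorization and discrepancy polynomial\<close>

text \<open>The infinite product is the unordered one: the limit of the finite partial products along
  \<^term>\<open>finite_subsets_at_top\<close>, in analogy with \<^const>\<open>has_sum\<close>.\<close>

definition hadamard_factorization ::
    "(complex \<Rightarrow> complex) \<Rightarrow> nat \<Rightarrow> complex \<Rightarrow> complex poly \<Rightarrow> bool" where
  "hadamard_factorization f m \<sigma> Q \<longleftrightarrow>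
     (\<forall>s. \<not> is_pole f s \<longrightarrow>
        (\<exists>P. ((\<lambda>A. \<Prod>\<rho>\<in>A. weierstrass_factor m ((s - \<sigma>) / (\<rho> - \<sigma>)) powi zorder f \<rho>)
                 \<longlongrightarrow> P) (finite_subsets_at_top (- {\<sigma>})) \<and>
             f s = (s - \<sigma>) powi zorder f \<sigma> * exp (poly Q s) * P))"

text \<open>The polynomial is unique up to an additive constant in \<open>2 \<pi> \<i> \<int>\<close>, which affects neither
  its derivative nor its degree.\<close>

definition hadamard_poly :: "(complex \<Rightarrow> complex) \<Rightarrow> complex \<Rightarrow> complex poly" where
  "hadamard_poly f \<sigma> = (SOME Q. hadamard_factorization f (conv_exponent f - 1) \<sigma> Q)"

definition genus :: "(complex \<Rightarrow> complex) \<Rightarrow> complex \<Rightarrow> nat" where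
  "genus f \<sigma> = max (degree (hadamard_poly f \<sigma>)) (conv_exponent f - 1)"

definition discrepancy_coeff :: "(complex \<Rightarrow> complex) \<Rightarrow> complex \<Rightarrow> nat \<Rightarrow> complex" where
  "discrepancy_coeff f \<sigma> k = coeff (- pderiv (hadamard_poly f \<sigma>)) k"


section \<open>Frequencies and coefficients of the logarithm of a Dirichlet series\<close>

text \<open>\<open>I\<close> is the set of indices \<open>n\<close> of the terms \<open>a\<^sub>n exp (- \<lambda>\<^sub>n s)\<close>; a sequence indexed by \<open>I\<close>
  is extended by zero to all of \<^typ>\<open>nat\<close>.\<close>

definition seq_weight :: "(nat \<Rightarrow> nat) \<Rightarrow> nat" where
  "seq_weight k = (\<Sum>n | k n \<noteq> 0. k n)"

definition index_seqs :: "nat set \<Rightarrow> (nat \<Rightarrow> nat) set" where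
  "index_seqs I = {k. {n. k n \<noteq> 0} \<subseteq> I \<and> finite {n. k n \<noteq> 0} \<and> seq_weight k \<ge> 1}"

definition frequency :: "(nat \<Rightarrow> real) \<Rightarrow> (nat \<Rightarrow> nat) \<Rightarrow> real" where
  "frequency l k = (\<Sum>n | k n \<noteq> 0. l n * real (k n))"

text \<open>The expansion
    \<open>- Ln (1 + x) = (\<Sum>m\<ge>1. (- 1) ^ m / m * x ^ m)\<close>  with  \<open>x = (\<Sum>n\<in>I. a\<^sub>n exp (- \<lambda>\<^sub>n s))\<close>
  and the multinomial theorem give
    \<open>- Ln (f s) = (\<Sum>k\<in>index_seqs I. log_coeff a k * exp (- frequency \<lambda> k * s))\<close>
  for large \<open>Re s\<close>. When the frequencies are linearly dependent over the rationals this identity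
  alone does not determine the coefficients, the formula below does.\<close>

definition log_coeff :: "(nat \<Rightarrow> complex) \<Rightarrow> (nat \<Rightarrow> nat) \<Rightarrow> complex" where
  "log_coeff a k =
     (- 1) ^ seq_weight k / of_nat (seq_weight k)
     * (fact (seq_weight k) / (\<Prod>j | k j \<noteq> 0. fact (k j)))
     * (\<Prod>j | k j \<noteq> 0. a j ^ k j)"

end

theory Submission
  imports Defs
begin

text \<open>Applied to \<open>exp (- y t)\<close> with \<open>y\<close> large, both sides of the claimed identity give
  \<open>f'(\<sigma> + y) / f(\<sigma> + y)\<close> minus the polynomial \<open>Q'\<close>. For the left side this is the
  logarithmic derivative of the Hadamard factorization, whose canonical product contributes
  \<open>y\<^sup>d\<close> times the Laplace transform of the kernel; for the right side it is the series of \<open>f'/f\<close>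
  obtained by expanding \<open>log f\<close>. Both sides, shifted by \<open>exp (\<sigma> t)\<close>, are continuous for finitely many seminorms
  \<open>sup\<^sub>t\<^sub>\<ge>\<^sub>0 exp (c t) |D\<^sup>j \<phi>(t)|\<close>, and for these seminorms every test function is a limit of linear
  combinations of exponentials, by Weierstrass' theorem in the variable \<open>exp (- t)\<close>.

  The Hadamard factorization itself follows from Landau's estimate: if \<open>f = g / h\<close> with \<open>g\<close>, \<open>h\<close> entire of
  finite order, then for large \<open>q\<close> the \<open>q\<close>-th derivative of \<open>f'/f\<close> equals that of
  \<open>\<Sum>\<^sub>\<rho> n\<^sub>\<rho> / (s - \<rho>)\<close>, so the logarithmic derivatives of \<open>f\<close> and of the canonical product
  differ by a polynomial. Only the existence of a factorization is used, not its uniqueness.\<close>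


section \<open>Logarithmic derivatives of functions of finite order\<close>

text \<open>The subtraction of \<open>K 0\<close> produces the drop from d to the genus m = d - 1 of
  the factors. With w = \<rho> - \<sigma>, the Laplace transform of exp(w t) - 1 is 1/(y - w) - 1/y
  = w / (y (y - w)); multiplied by y^d and n / w^d it becomes n y^m / (w^m (y - w)), the logarithmic
  derivative of the n-th power of E_m((s - \<sigma>) / w) at s = \<sigma> + y. Landau's estimate is
  available only for large q, whereas the kernel uses the least admissible exponent. The gap is
  harmless because q \<ge> m derivatives erase every trace of m, and what they erase is a
  polynomial. Exponentials are not test functions, and the two sides are compared only at real y
  beyond some bound. Density replaces an inversion theorem: H and all frequencies live on t \<ge> 0,
  so approximation is required on the half-line only, and one weight exp(c t) both dominates the
  growth of H and makes the sum of Dirac masses absolutely convergent. The polynomials match because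
  D^k \<delta>_0 applied to exp(-(\<sigma> + y) t) is (\<sigma> + y)^k and Q is a polynomial in
  s.\<close>

lemma Borel_Caratheodory_0:
  assumes holG: "G holomorphic_on ball 0 R" and "0 < M"
    and less: "\<And>z. norm z < R \<Longrightarrow> Re (G z) < M + Re (G 0)"
    and z: "norm z \<le> R / 2" and "0 < R"
  shows "norm (G z - G 0) \<le> 2 * M"
proof -
  define u where "u w = G (of_real R * w) - G 0" for w
  have in_ball: "of_real R * w \<in> ball 0 R" if "norm w < 1" for w :: complex
    using that \<open>0 < R\<close> by (simp add: norm_mult)
  have Reu: "Re (u w) < M" if "norm w < 1" for w
    using less[of "of_real R * w"] in_ball[OF that] by (simp add: u_def)
  have holu: "u holomorphic_on ball 0 1"
    unfolding u_def using in_ball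
    by (intro holomorphic_intros holomorphic_on_compose_gen[OF _ holG, unfolded o_def]) auto
  \<comment> \<open>The map u / (2 M - u) sends the half-plane Re u < M into the unit disc and fixes
    0, so Schwarz applies; on |w| \<le> 1/2 it yields |u| \<le> M + |u| / 2.\<close>
  define v where "v w = u w / (of_real (2 * M) - u w)" for w
  have less': "norm (u w) < norm (of_real (2 * M) - u w)" if "norm w < 1" for w
  proof -
    have "(norm (u w))\<^sup>2 < (norm (of_real (2 * M) - u w))\<^sup>2"
      using Reu[OF that] \<open>0 < M\<close> unfolding cmod_power2 by (simp add: power2_eq_square algebra_simps)
    then show ?thesis by (rule power_less_imp_less_base) simp
  qed
  have nz: "of_real (2 * M) - u w \<noteq> 0" if "norm w < 1" for w
    using less'[OF that] by auto
  have Sch: "norm (v w) \<le> norm w" if "norm w < 1" for w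
  proof (rule Schwarz_Lemma(1)[OF _ _ _ that])
    show "v holomorphic_on ball 0 1"
      unfolding v_def using nz by (intro holomorphic_intros holu) auto
    show "norm (v w) < 1" if "norm w < 1" for w
      using less'[OF that] nz[OF that] by (simp add: v_def norm_divide divide_less_eq)
    show "v 0 = 0" by (simp add: v_def u_def)
  qed
  define w where "w = z / of_real R"
  have w: "norm w \<le> 1 / 2" "z = of_real R * w"
    using z \<open>0 < R\<close> by (auto simp: w_def norm_divide field_simps)
  have "norm (v w) \<le> 1 / 2" using Sch[of w] w by simp
  then have "norm (u w) \<le> 1 / 2 * norm (of_real (2 * M) - u w)"
    using nz[of w] w by (simp add: v_def norm_divide field_simps)
  also have "\<dots> \<le> 1 / 2 * (2 * M + norm (u w))"
    using norm_triangle_ineq4[of "of_real (2 * M)" "u w"] \<open>0 < M\<close> by simp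
  finally show ?thesis using w(2) by (simp add: u_def)
qed

text \<open>Cauchy's estimate on the disc of radius R / 4 about z, which stays in the half disc
  controlled by Borel--Caratheodory. The bound 2 M is relaxed to 3 M to land in an open ball.
  Centring that ball at \<open>G 0\<close> costs nothing because k > 0.\<close>

lemma higher_deriv_bound_Re:
  assumes holG: "G holomorphic_on ball 0 R" and "0 < M"
    and less: "\<And>z. norm z < R \<Longrightarrow> Re (G z) < M + Re (G 0)"
    and z: "norm z \<le> R / 4" and "0 < R" and "0 < k"
  shows "norm ((deriv ^^ k) G z) \<le> fact k * (3 * M) / (R / 4) ^ k"
proof (rule Cauchy_higher_deriv_bound)
  have sub: "norm w \<le> R / 2" if "w \<in> cball z (R / 4)" for w
    using that z norm_triangle_ineq2[of w z] by (simp add: dist_norm norm_minus_commute)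
  then have sub': "cball z (R / 4) \<subseteq> ball 0 R" using \<open>0 < R\<close> by force
  then show "G holomorphic_on ball z (R / 4)"
    by (intro holomorphic_on_subset[OF holG]) auto
  show "continuous_on (cball z (R / 4)) G"
    using sub' holG holomorphic_on_imp_continuous_on holomorphic_on_subset by blast
  show "G w \<in> ball (G 0) (3 * M)" if "w \<in> ball z (R / 4)" for w
    using Borel_Caratheodory_0[OF holG \<open>0 < M\<close> less sub \<open>0 < R\<close>, of w] that \<open>0 < M\<close>
    by (auto simp: dist_norm norm_minus_commute)
qed (use assms in auto)

section \<open>Zeros of an entire function and Landau's estimate\<close>

lemma zorder_entire:
  assumes hol: "g holomorphic_on UNIV" and "g w0 \<noteq> 0"
  shows "g z = 0 \<Longrightarrow> zorder g z > 0" "g z \<noteq> 0 \<Longrightarrow> zorder g z = 0"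
  using zorder_exist_zero[OF hol open_UNIV connected_UNIV UNIV_I bexI[of _ w0], of z] \<open>g w0 \<noteq> 0\<close>
  by auto

text \<open>Zeros outside the closed disc of radius R remain in F, so F is guaranteed zero-free only
  on that disc; the radius R' gives room to estimate F on a circle well outside it. The point w0
  excludes the zero function, whose zeros are not isolated.\<close>

lemma entire_factor_zeros:
  assumes hol: "g holomorphic_on UNIV" and "g w0 \<noteq> 0" and "0 < R" "R < R'"
  obtains F where "F holomorphic_on ball 0 R'" "finite {\<rho>. g \<rho> = 0 \<and> norm \<rho> \<le> R}"
    "\<And>z. norm z \<le> R \<Longrightarrow> F z \<noteq> 0"
    "\<And>z. norm z < R' \<Longrightarrow> g z = F z * (\<Prod>\<rho>\<in>{\<rho>. g \<rho> = 0 \<and> norm \<rho> \<le> R}. (z - \<rho>) ^ nat (zorder g \<rho>))"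
proof -
  have nonconst: "finite {\<rho>\<in>cball 0 r. g \<rho> = 0}" for r
  proof (cases "g constant_on UNIV")
    case True
    then have "g \<rho> \<noteq> 0" for \<rho> using \<open>g w0 \<noteq> 0\<close> by (auto simp: constant_on_def)
    then show ?thesis by auto
  next
    case False
    then show ?thesis by (intro holomorphic_compact_finite_zeros[OF hol]) auto
  qed
  define Z where "Z = {\<rho>\<in>ball 0 R'. g \<rho> = 0}"
  define Y where "Y = {\<rho>. g \<rho> = 0 \<and> norm \<rho> \<le> R}"
  have finY: "finite Y" using nonconst[of R] by (simp add: Y_def conj_commute)
  have finZ: "finite Z" by (rule finite_subset[OF _ nonconst[of R']]) (auto simp: Z_def)
  have YZ: "Y \<subseteq> Z" using \<open>R < R'\<close> by (auto simp: Y_def Z_def)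
  define n where "n \<rho> = nat (zorder g \<rho>)" for \<rho>
  define p where "p z = (\<Prod>\<rho>\<in>Z. (z - \<rho>) ^ n \<rho>)" for z
  have zg: "if g z = 0 then zorder g z > 0 else zorder g z = 0" for z
    using zorder_entire[OF hol \<open>g w0 \<noteq> 0\<close>, of z] by auto
  have pz: "p z = 0 \<longleftrightarrow> z \<in> Z" for z
    using finZ zg by (force simp: p_def n_def Z_def)
  obtain h where h: "h holomorphic_on ball 0 R'" "\<And>z. z \<in> ball 0 R' \<Longrightarrow> h z \<noteq> 0"
     "\<And>z. z \<in> ball 0 R' \<Longrightarrow> g z = h z * p z"
  proof (rule holomorphic_zorder_factorization[of g "ball 0 R'" p])
    show "g holomorphic_on ball 0 R'" using hol holomorphic_on_subset by blast
    show "p holomorphic_on ball 0 R'" unfolding p_def by (intro holomorphic_intros)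
    fix z assume z: "z \<in> ball (0::complex) R'"
    show "p z = 0 \<longleftrightarrow> g z = 0" using z by (auto simp: pz Z_def)
    show "zorder p z = zorder g z"
    proof (cases "z \<in> Z")
      case True
      show ?thesis
      proof (rule zorder_eqI[of UNIV _ "\<lambda>w. \<Prod>\<rho>\<in>Z - {z}. (w - \<rho>) ^ n \<rho>"])
        show "(\<lambda>w. \<Prod>\<rho>\<in>Z - {z}. (w - \<rho>) ^ n \<rho>) holomorphic_on UNIV"
          by (intro holomorphic_intros)
        show "(\<Prod>\<rho>\<in>Z - {z}. (z - \<rho>) ^ n \<rho>) \<noteq> 0"
          using finZ by auto
        fix w assume "w \<noteq> z"
        show "p w = (\<Prod>\<rho>\<in>Z - {z}. (w - \<rho>) ^ n \<rho>) * (w - z) powi zorder g z"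
          using True zg[of z] unfolding p_def prod.remove[OF finZ True] by (simp add: n_def Z_def power_int_def)
      qed auto
    next
      case False
      have "zorder p z = 0"
      proof (rule zorder_eq_0I)
        show "p analytic_on {z}" unfolding p_def by (intro analytic_intros)
      qed (use False pz in auto)
      then show ?thesis using zg[of z] False z by (auto simp: Z_def)
    qed
  qed auto
  \<comment> \<open>All zeros in the larger disc are divided out to obtain a zero-free h; those of
    modulus above R are multiplied back.\<close>
  define F where "F z = h z * (\<Prod>\<rho>\<in>Z - Y. (z - \<rho>) ^ n \<rho>)" for z
  show ?thesis
  proof (rule that[of F])
    show "F holomorphic_on ball 0 R'" unfolding F_def by (intro holomorphic_intros h)
    show "finite {\<rho>. g \<rho> = 0 \<and> norm \<rho> \<le> R}" using finY by (simp add: Y_def)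
    show "F z \<noteq> 0" if "norm z \<le> R" for z
      using that finZ \<open>R < R'\<close> h(2)[of z] by (auto simp: F_def Y_def Z_def)
    fix z :: complex assume "norm z < R'"
    then have "g z = h z * p z" by (intro h) simp
    also have "p z = (\<Prod>\<rho>\<in>Z - Y. (z - \<rho>) ^ n \<rho>) * (\<Prod>\<rho>\<in>Y. (z - \<rho>) ^ n \<rho>)"
      unfolding p_def by (rule prod.subset_diff[OF YZ finZ])
    finally show "g z = F z * (\<Prod>\<rho>\<in>{\<rho>. g \<rho> = 0 \<and> norm \<rho> \<le> R}. (z - \<rho>) ^ nat (zorder g \<rho>))"
      by (simp add: F_def n_def Y_def mult_ac)
  qed
qed


text \<open>The rule for logarithmic derivatives in product form, free of any division by the
  factors.\<close>

lemma has_field_derivative_prod_log: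
  assumes "finite Z"
    and "\<And>\<rho>. \<rho> \<in> Z \<Longrightarrow> (f \<rho> has_field_derivative f \<rho> w * l \<rho>) (at w)"
  shows "((\<lambda>w. \<Prod>\<rho>\<in>Z. f \<rho> w) has_field_derivative (\<Prod>\<rho>\<in>Z. f \<rho> w) * (\<Sum>\<rho>\<in>Z. l \<rho>)) (at w)"
  using assms
proof (induction Z)
  case (insert \<rho> Z)
  have "((\<lambda>w. f \<rho> w * (\<Prod>\<rho>\<in>Z. f \<rho> w)) has_field_derivative
      f \<rho> w * l \<rho> * (\<Prod>\<rho>\<in>Z. f \<rho> w) + (\<Prod>\<rho>\<in>Z. f \<rho> w) * (\<Sum>\<rho>\<in>Z. l \<rho>) * f \<rho> w) (at w)"
    using insert by (intro DERIV_mult) auto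
  then show ?case using insert by (simp add: algebra_simps)
qed simp

lemma has_field_derivative_divide_power:
  fixes a w :: complex
  assumes "w - \<rho> \<noteq> 0"
  shows "((\<lambda>w. a / (w - \<rho>) ^ Suc q) has_field_derivative - (a * of_nat (Suc q)) / (w - \<rho>) ^ Suc (Suc q)) (at w)"
proof -
  have d1: "((\<lambda>w. w - \<rho>) has_field_derivative 1) (at w)"
    by (auto intro!: derivative_eq_intros)
  have d2: "((\<lambda>w. (w - \<rho>) ^ Suc q) has_field_derivative of_nat (Suc q) * (w - \<rho>) ^ q) (at w)"
    by (rule DERIV_cong[OF DERIV_power[OF d1]]) simp
  have alg: "(0 * u - a * (n * y)) / (u * u) = - (a * n) / (x * (x * y))" if "u = x * y" "x \<noteq> 0" "y \<noteq> 0" for x y u n :: complex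
    using that by (simp add: field_simps)
  show ?thesis
    unfolding power_Suc[of _ "Suc q"] power_Suc[of _ q]
    by (rule DERIV_cong[OF DERIV_divide[OF DERIV_const d2[unfolded power_Suc[of _ q]]]], use assms in simp,
        rule alg[OF refl]) (use assms in auto)
qed

lemma higher_deriv_partial_fractions:
  fixes c :: "complex \<Rightarrow> complex"
  assumes "finite Z" "w \<notin> Z"
  shows "(deriv ^^ q) (\<lambda>w. \<Sum>\<rho>\<in>Z. c \<rho> / (w - \<rho>)) w =
    (\<Sum>\<rho>\<in>Z. c \<rho> * ((-1) ^ q * fact q) / (w - \<rho>) ^ Suc q)"
  using assms(2)
proof (induction q arbitrary: w)
  case (Suc q)
  have opn: "open (- Z)" using \<open>finite Z\<close> by (simp add: finite_imp_closed open_Compl)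
  have "deriv ((deriv ^^ q) (\<lambda>w. \<Sum>\<rho>\<in>Z. c \<rho> / (w - \<rho>))) w =
      deriv (\<lambda>w. \<Sum>\<rho>\<in>Z. c \<rho> * ((-1) ^ q * fact q) / (w - \<rho>) ^ Suc q) w"
    by (rule deriv_cong_ev)
       (use Suc opn in \<open>auto simp del: power_Suc intro!: eventually_mono[OF eventually_nhds_in_open[OF opn]]\<close>)
  also have "\<dots> = (\<Sum>\<rho>\<in>Z. c \<rho> * ((-1) ^ Suc q * fact (Suc q)) / (w - \<rho>) ^ Suc (Suc q))"
  proof (rule DERIV_imp_deriv, rule DERIV_sum)
    fix \<rho> assume "\<rho> \<in> Z"
    then have nz: "w - \<rho> \<noteq> 0" using Suc by auto
    from has_field_derivative_divide_power[OF this, of "c \<rho> * ((-1) ^ q * fact q)" q]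
    show "((\<lambda>w. c \<rho> * ((-1) ^ q * fact q) / (w - \<rho>) ^ Suc q) has_field_derivative
        c \<rho> * ((-1) ^ Suc q * fact (Suc q)) / (w - \<rho>) ^ Suc (Suc q)) (at w)"
      by (rule DERIV_cong) (simp del: power_Suc add: power_Suc[of "-1" q] mult_ac)
  qed
  finally show ?case by simp
qed simp

text \<open>Divide \<open>g\<close> by the product of the factors \<open>1 - z / \<rho>\<close> over the zeros in the disc of radius \<open>R\<close>. On
  the circle of radius \<open>3 R\<close> each factor has modulus at least \<open>2\<close>, which bounds the number of zeros
  and makes Borel--Caratheodory applicable to a logarithm of the quotient.\<close>

lemma Landau_log_derivative:
  fixes g :: "complex \<Rightarrow> complex" and R M :: real
  defines "Z \<equiv> {\<rho>. g \<rho> = 0 \<and> norm \<rho> \<le> R}" and "B \<equiv> M - ln (norm (g 0))"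
  assumes hol: "g holomorphic_on UNIV" and g0: "g 0 \<noteq> 0" and R: "0 < R"
    and bound: "\<And>z. norm z \<le> 3 * R \<Longrightarrow> norm (g z) \<le> exp M"
  shows "finite Z" "(\<Sum>\<rho>\<in>Z. real_of_int (zorder g \<rho>)) * ln 2 \<le> B"
    "norm z \<le> R / 4 \<Longrightarrow> g z \<noteq> 0 \<Longrightarrow>
     norm ((deriv ^^ q) (\<lambda>z. deriv g z / g z) z -
       (\<Sum>\<rho>\<in>Z. of_int (zorder g \<rho>) * ((-1) ^ q * fact q) / (z - \<rho>) ^ Suc q))
     \<le> fact (Suc q) * (3 * (B + 1)) / (R / 4) ^ Suc q"
proof -
  obtain F where F: "F holomorphic_on ball 0 (4 * R)" "finite Z"
    "\<And>z. norm z \<le> R \<Longrightarrow> F z \<noteq> 0"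
    "\<And>z. norm z < 4 * R \<Longrightarrow> g z = F z * (\<Prod>\<rho>\<in>Z. (z - \<rho>) ^ nat (zorder g \<rho>))"
    using entire_factor_zeros[OF hol g0 R, of "4 * R"] R unfolding Z_def by auto
  then show "finite Z" by simp
  define n where "n \<rho> = nat (zorder g \<rho>)" for \<rho>
  have n: "real (n \<rho>) = zorder g \<rho>" "(of_nat (n \<rho>) :: complex) = of_int (zorder g \<rho>)" if "\<rho> \<in> Z" for \<rho>
    using that zorder_entire(1)[OF hol g0, of \<rho>] by (auto simp: n_def Z_def)
  have Z0: "0 \<notin> Z" using g0 by (simp add: Z_def)
  \<comment> \<open>Replacing z - \<rho> by 1 - z / \<rho> normalizes the product to 1 at the
    origin, hence \<open>F1 0 = g 0\<close>, and the count of zeros compares the maximum of |g| with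
    |g(0)|.\<close>
  define F1 where "F1 z = F z * (\<Prod>\<rho>\<in>Z. (- \<rho>) ^ n \<rho>)" for z
  have holF1: "F1 holomorphic_on ball 0 (4 * R)" unfolding F1_def by (intro holomorphic_intros F)
  have F1nz: "F1 z \<noteq> 0" if "norm z \<le> R" for z
    using F(2,3) that Z0 by (auto simp: F1_def)
  have gF1: "g z = F1 z * (\<Prod>\<rho>\<in>Z. (1 - z / \<rho>) ^ n \<rho>)" if "norm z < 4 * R" for z
  proof -
    have "(\<Prod>\<rho>\<in>Z. (z - \<rho>) ^ n \<rho>) = (\<Prod>\<rho>\<in>Z. (- \<rho>) ^ n \<rho> * (1 - z / \<rho>) ^ n \<rho>)"
    proof (intro prod.cong refl)
      fix \<rho> assume "\<rho> \<in> Z"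
      then have "\<rho> \<noteq> 0" using Z0 by auto
      then have "z - \<rho> = (- \<rho>) * (1 - z / \<rho>)" by (simp add: field_simps)
      then show "(z - \<rho>) ^ n \<rho> = (- \<rho>) ^ n \<rho> * (1 - z / \<rho>) ^ n \<rho>" by (metis power_mult_distrib)
    qed
    then show ?thesis using F(4)[OF that] by (simp add: F1_def n_def prod.distrib mult_ac)
  qed
  define N where "N = (\<Sum>\<rho>\<in>Z. n \<rho>)"
  have F1bound: "norm (F1 z) \<le> exp M / 2 ^ N" if "norm z \<le> 3 * R" for z
  proof (rule maximum_modulus_frontier[of F1 "cball 0 (3 * R)"])
    have "cball (0::complex) (3 * R) \<subseteq> ball 0 (4 * R)" using R by auto
    then show "continuous_on (closure (cball 0 (3 * R))) F1"
      using holF1 holomorphic_on_imp_continuous_on holomorphic_on_subset by (metis closed_cball closure_closed)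
    show "F1 holomorphic_on interior (cball 0 (3 * R))"
      using holF1 R by (auto intro: holomorphic_on_subset)
    show "norm (F1 w) \<le> exp M / 2 ^ N" if "w \<in> frontier (cball 0 (3 * R))" for w
    proof -
      have w: "norm w = 3 * R" using that R by (simp add: frontier_cball)
      have "2 ^ N = (\<Prod>\<rho>\<in>Z. 2 ^ n \<rho> :: real)" by (simp add: N_def power_sum)
      also have "\<dots> \<le> (\<Prod>\<rho>\<in>Z. norm (1 - w / \<rho>) ^ n \<rho>)"
      proof (intro prod_mono conjI power_mono)
        fix \<rho> assume \<rho>: "\<rho> \<in> Z"
        then have "norm \<rho> > 0" "norm \<rho> \<le> R" using Z0 by (auto simp: Z_def)
        then have "3 \<le> norm (w / \<rho>)" using w by (simp add: norm_divide field_simps)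
        then show "2 \<le> norm (1 - w / \<rho>)" using norm_triangle_ineq2[of "w / \<rho>" 1]
          by (simp add: norm_minus_commute)
      qed auto
      finally have "norm (F1 w) * 2 ^ N \<le> norm (g w)"
        using gF1[of w] w R by (simp add: norm_mult prod_norm[symmetric] norm_power mult_left_mono)
      also have "\<dots> \<le> exp M" using bound w by simp
      finally show ?thesis by (simp add: field_simps)
    qed
  qed (use that R in auto)
  have F10: "F1 0 = g 0" using gF1[of 0] R by simp
  have "norm (g 0) * 2 ^ N \<le> exp M" using F1bound[of 0] F10 R by (simp add: field_simps)
  then have "ln (norm (g 0) * 2 ^ N) \<le> M"
    using g0 ln_le_cancel_iff[of "norm (g 0) * 2 ^ N" "exp M"] by simp
  then have NB: "real N * ln 2 \<le> B" using g0 by (simp add: ln_mult ln_realpow B_def)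
  then show "(\<Sum>\<rho>\<in>Z. real_of_int (zorder g \<rho>)) * ln 2 \<le> B" using n by (simp add: N_def)
  have B0: "0 \<le> B" using NB by (smt (verit) ln_gt_zero mult_nonneg_nonneg of_nat_0_le_iff)
  have "F1 holomorphic_on ball 0 R" using holF1 R by (auto intro: holomorphic_on_subset)
  then obtain G where G: "G holomorphic_on ball 0 R" "\<And>z. z \<in> ball 0 R \<Longrightarrow> F1 z = exp (G z)"
    using contractible_imp_holomorphic_log[of F1 "ball 0 R"] F1nz
    by (metis convex_imp_contractible convex_ball less_imp_le mem_ball_0)
  \<comment> \<open>The additional 1 makes the bound strict and its constant positive even if B = 0,
    as Borel--Caratheodory requires.\<close>
  have ReG: "Re (G z) < (B + 1) + Re (G 0)" if "norm z < R" for z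
  proof -
    have "exp (Re (G z)) \<le> exp M / 2 ^ N" using F1bound[of z] G(2)[of z] that R by (simp add: norm_exp_eq_Re)
    also have "\<dots> \<le> exp M" by (simp add: divide_le_eq_1 field_simps)
    finally have "Re (G z) \<le> M" by simp
    moreover have "norm (g 0) = exp (Re (G 0))" using G(2)[of 0] R F10 by (simp add: norm_exp_eq_Re)
    ultimately show ?thesis by (simp add: B_def)
  qed
  assume z: "norm z \<le> R / 4" and gz: "g z \<noteq> 0"
  define S where "S = ball 0 R - Z"
  have S: "open S" "z \<in> S" using \<open>finite Z\<close> z R gz by (auto simp: S_def finite_imp_closed open_Diff Z_def)
  \<comment> \<open>Away from the zeros the logarithmic derivative splits into G' and partial
    fractions, so the quantity to be bounded is exactly the derivative of order q + 1 of G.\<close>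
  have ld: "deriv g w / g w = deriv G w + (\<Sum>\<rho>\<in>Z. of_nat (n \<rho>) / (w - \<rho>))" if "w \<in> S" for w
  proof -
    have w: "norm w < R" "w \<notin> Z" using that by (auto simp: S_def)
    then have gw: "g w \<noteq> 0" by (auto simp: Z_def)
    have "((\<lambda>w. exp (G w) * (\<Prod>\<rho>\<in>Z. (1 - w / \<rho>) ^ n \<rho>)) has_field_derivative
        exp (G w) * deriv G w * (\<Prod>\<rho>\<in>Z. (1 - w / \<rho>) ^ n \<rho>) +
        (\<Prod>\<rho>\<in>Z. (1 - w / \<rho>) ^ n \<rho>) * (\<Sum>\<rho>\<in>Z. of_nat (n \<rho>) / (w - \<rho>)) * exp (G w)) (at w)"
    proof (rule DERIV_mult)
      show "((\<lambda>w. exp (G w)) has_field_derivative exp (G w) * deriv G w) (at w)"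
        using G(1) w by (intro DERIV_fun_exp holomorphic_derivI[OF G(1)]) auto
      show "((\<lambda>w. \<Prod>\<rho>\<in>Z. (1 - w / \<rho>) ^ n \<rho>) has_field_derivative
         (\<Prod>\<rho>\<in>Z. (1 - w / \<rho>) ^ n \<rho>) * (\<Sum>\<rho>\<in>Z. of_nat (n \<rho>) / (w - \<rho>))) (at w)"
      proof (rule has_field_derivative_prod_log[OF \<open>finite Z\<close>])
        fix \<rho> assume "\<rho> \<in> Z"
        then have nz: "\<rho> \<noteq> 0" "w \<noteq> \<rho>" using Z0 w by auto
        have "((\<lambda>w. (1 - w / \<rho>) ^ n \<rho>) has_field_derivative of_nat (n \<rho>) * (1 - w / \<rho>) ^ (n \<rho> - 1) * (- 1 / \<rho>)) (at w)"
          using nz by (auto intro!: derivative_eq_intros)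
        moreover have "of_nat (n \<rho>) * (1 - w / \<rho>) ^ (n \<rho> - 1) * (- 1 / \<rho>) = (1 - w / \<rho>) ^ n \<rho> * (of_nat (n \<rho>) / (w - \<rho>))"
          using nz by (cases "n \<rho>") (auto simp: field_simps)
        ultimately show "((\<lambda>w. (1 - w / \<rho>) ^ n \<rho>) has_field_derivative (1 - w / \<rho>) ^ n \<rho> * (of_nat (n \<rho>) / (w - \<rho>))) (at w)"
          by simp
      qed
    qed
    also have "exp (G w) * deriv G w * (\<Prod>\<rho>\<in>Z. (1 - w / \<rho>) ^ n \<rho>) +
        (\<Prod>\<rho>\<in>Z. (1 - w / \<rho>) ^ n \<rho>) * (\<Sum>\<rho>\<in>Z. of_nat (n \<rho>) / (w - \<rho>)) * exp (G w) =
        g w * (deriv G w + (\<Sum>\<rho>\<in>Z. of_nat (n \<rho>) / (w - \<rho>)))"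
      using gF1[of w] G(2)[of w] w R by (simp add: algebra_simps)
    finally have "(g has_field_derivative g w * (deriv G w + (\<Sum>\<rho>\<in>Z. of_nat (n \<rho>) / (w - \<rho>)))) (at w)"
      by (rule DERIV_cong_ev[THEN iffD1, rotated 3, OF _ refl _ refl])
         (use w R gF1 G(2) in \<open>auto intro!: eventually_mono[OF eventually_nhds_in_open[of "ball 0 R" w]]\<close>)
    then show ?thesis using gw by (simp add: DERIV_imp_deriv)
  qed
  have "G holomorphic_on S" by (rule holomorphic_on_subset[OF G(1)]) (auto simp: S_def)
  then have holS1: "deriv G holomorphic_on S" by (rule holomorphic_deriv[OF _ S(1)])
  have holS2: "(\<lambda>w. \<Sum>\<rho>\<in>Z. of_nat (n \<rho>) / (w - \<rho>)) holomorphic_on S"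
    by (intro holomorphic_on_sum holomorphic_on_divide holomorphic_on_diff holomorphic_on_const holomorphic_on_ident)
       (auto simp: S_def)
  note holS = holS1 holS2
  have "(deriv ^^ q) (\<lambda>z. deriv g z / g z) z =
      (deriv ^^ q) (\<lambda>w. deriv G w + (\<Sum>\<rho>\<in>Z. of_nat (n \<rho>) / (w - \<rho>))) z"
    by (rule higher_deriv_cong_ev[OF eventually_mono[OF eventually_nhds_in_open[OF S]] refl]) (rule ld)
  also have "\<dots> = (deriv ^^ Suc q) G z + (\<Sum>\<rho>\<in>Z. of_nat (n \<rho>) * ((-1) ^ q * fact q) / (z - \<rho>) ^ Suc q)"
    using S higher_deriv_partial_fractions[OF \<open>finite Z\<close>, of z q "\<lambda>\<rho>. of_nat (n \<rho>)"]
    by (subst higher_deriv_add[OF holS]) (auto simp: funpow_Suc_right S_def simp del: funpow.simps power_Suc)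
  finally have "(deriv ^^ q) (\<lambda>z. deriv g z / g z) z -
       (\<Sum>\<rho>\<in>Z. of_int (zorder g \<rho>) * ((-1) ^ q * fact q) / (z - \<rho>) ^ Suc q) = (deriv ^^ Suc q) G z"
    using n by simp
  then show "norm ((deriv ^^ q) (\<lambda>z. deriv g z / g z) z -
       (\<Sum>\<rho>\<in>Z. of_int (zorder g \<rho>) * ((-1) ^ q * fact q) / (z - \<rho>) ^ Suc q))
     \<le> fact (Suc q) * (3 * (B + 1)) / (R / 4) ^ Suc q"
    using higher_deriv_bound_Re[OF G(1) _ ReG z R, of "Suc q"] B0 by simp
qed

text \<open>Beyond |\<rho>| = 2 |z| + 1 the distance is at least a fixed fraction of 1 + |\<rho>|;
  below, 1 + |\<rho>| is bounded and the separation e suffices. The constant is explicit because it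
  decreases in |z|, which later makes it uniform for z in a ball.\<close>

lemma norm_diff_ge_of_separated:
  fixes z \<rho> :: complex
  assumes "0 < e" "e \<le> norm (z - \<rho>)"
  shows "min (1 / 4) (e / (2 * norm z + 2)) * (1 + norm \<rho>) \<le> norm (z - \<rho>)"
proof (cases "norm \<rho> \<le> 2 * norm z + 1")
  case True
  have "min (1 / 4) (e / (2 * norm z + 2)) * (1 + norm \<rho>) \<le> e / (2 * norm z + 2) * (2 * norm z + 2)"
    using True \<open>0 < e\<close> by (intro mult_mono) auto
  also have "\<dots> = e" using norm_ge_zero[of z] by (metis add_nonneg_pos mult_nonneg_nonneg nonzero_eq_divide_eq order_less_irrefl times_divide_eq_left zero_le_numeral zero_less_numeral)
  finally show ?thesis using assms by simp
next
  case False
  have "min (1 / 4) (e / (2 * norm z + 2)) * (1 + norm \<rho>) \<le> 1 / 4 * (1 + norm \<rho>)"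
    by (intro mult_right_mono min.cobounded1) auto
  also have "\<dots> \<le> norm \<rho> - norm z" using False by (simp add: field_simps) (use norm_ge_zero[of z] in linarith)
  finally show ?thesis using norm_triangle_ineq2[of \<rho> z] by (simp add: norm_minus_commute)
qed

text \<open>Landau's error on the disc of radius R is O(R^N / R^(q+1)) and vanishes as R grows, so
  partial sums over discs converge to the derivative. Summability comes from the count O(R^N) of
  zeros: an annulus of width 1 at radius j contributes O((j+1)^(N-q)), and q \<ge> N + 2 makes this
  summable over j.\<close>

lemma Hadamard_log_derivative_0:
  fixes g :: "complex \<Rightarrow> complex"
  assumes hol: "g holomorphic_on UNIV" and g0: "g 0 \<noteq> 0" and "0 \<le> C"
    and growth: "\<And>z. norm (g z) \<le> exp (C * (1 + norm z) ^ N)"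
    and q: "N + 2 \<le> q"
  shows "(\<lambda>\<rho>. real_of_int (zorder g \<rho>) / (1 + norm \<rho>) ^ q) summable_on UNIV"
    and "g z \<noteq> 0 \<Longrightarrow> ((\<lambda>\<rho>. of_int (zorder g \<rho>) * ((-1) ^ q * fact q) / (z - \<rho>) ^ Suc q) has_sum
          (deriv ^^ q) (\<lambda>z. deriv g z / g z) z) UNIV"
proof -
  define Z where "Z R = {\<rho>. g \<rho> = 0 \<and> norm \<rho> \<le> R}" for R
  define L where "L = \<bar>ln (norm (g 0))\<bar>"
  define M where "M R = C * (1 + 3 * R) ^ N" for R :: real
  have growth': "norm (g z) \<le> exp (M R)" if "norm z \<le> 3 * R" "0 < R" for z R
  proof -
    have "norm (g z) \<le> exp (C * (1 + norm z) ^ N)" by (rule growth)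
    also have "\<dots> \<le> exp (M R)"
      unfolding M_def using that \<open>0 \<le> C\<close> by (auto intro!: mult_left_mono power_mono)
    finally show ?thesis .
  qed
  note Landau = Landau_log_derivative[OF hol g0 _ growth', folded Z_def]
  have finZ: "finite (Z R)" for R
  proof (cases "R > 0")
    case True
    then show ?thesis using Landau(1)[of R R] by simp
  next
    case False
    then have "Z R = {}" using g0 by (auto simp: Z_def not_less) (metis norm_le_zero_iff order_trans)
    then show ?thesis by simp
  qed
  have zo: "if g \<rho> = 0 then zorder g \<rho> > 0 else zorder g \<rho> = 0" for \<rho>
    using zorder_entire[OF hol g0] by auto
  then have zo0: "zorder g \<rho> \<ge> 0" for \<rho> by (smt (verit))
  have zo1: "g \<rho> = 0" if "zorder g \<rho> \<noteq> 0" for \<rho> using zo[of \<rho>] that by (auto split: if_splits)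
  define K where "K = (C * 3 ^ N + L) / ln 2"
  have MK: "M R - ln (norm (g 0)) \<le> (C * 3 ^ N + L) * (1 + R) ^ N" if "R > 0" for R
  proof -
    have "(1 + 3 * R) ^ N \<le> 3 ^ N * (1 + R) ^ N"
      unfolding power_mult_distrib[symmetric] using that by (intro power_mono) auto
    then have "M R \<le> C * (3 ^ N * (1 + R) ^ N)"
      unfolding M_def using \<open>0 \<le> C\<close> by (intro mult_left_mono)
    moreover have "- ln (norm (g 0)) \<le> L * 1" by (simp add: L_def)
    moreover have "L * 1 \<le> L * (1 + R) ^ N" using that by (intro mult_left_mono) (auto simp: L_def)
    ultimately show ?thesis by (simp add: algebra_simps)
  qed
  have count: "(\<Sum>\<rho>\<in>Z R. real_of_int (zorder g \<rho>)) \<le> K * (1 + R) ^ N" if "R > 0" for R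
  proof -
    have "(\<Sum>\<rho>\<in>Z R. real_of_int (zorder g \<rho>)) * ln 2 \<le> (C * 3 ^ N + L) * (1 + R) ^ N"
      using Landau(2)[of R R] that MK[OF that] by simp
    then show ?thesis by (simp add: K_def field_simps)
  qed
  have K0: "0 \<le> K" using \<open>0 \<le> C\<close> by (simp add: K_def L_def)
  define c where "c j = K * 2 ^ N * inverse (real (Suc j) ^ 2)" for j
  have sumc: "summable c"
    unfolding c_def using inverse_power_summable[of 2, where 'a = real]
    by (intro summable_mult) (subst summable_Suc_iff, simp)
  have gen: "K * (2 * x) ^ N / x ^ (N + 2) = K * 2 ^ N * inverse (x\<^sup>2)" if "x > 0" for x :: real
    using that unfolding power_mult_distrib power_add by (simp add: divide_simps)
  have c0: "0 \<le> c j" for j using K0 by (simp add: c_def)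
  define a where "a \<rho> = real_of_int (zorder g \<rho>) / (1 + norm \<rho>) ^ q" for \<rho>
  have a0: "0 \<le> a \<rho>" for \<rho> using zo0 by (simp add: a_def)
  have bound: "sum a B \<le> suminf c" if "finite B" for B
  proof -
    \<comment> \<open>Points are grouped by the integer part of their modulus; a finite set meets
      finitely many groups, and group j is bounded by \<open>c j\<close>.\<close>
    define T where "T = (\<lambda>\<rho>. nat \<lfloor>norm \<rho>\<rfloor>) ` B"
    have "finite T" using that by (simp add: T_def)
    have "sum a B = (\<Sum>j\<in>T. sum a {\<rho>\<in>B. nat \<lfloor>norm \<rho>\<rfloor> = j})"
      by (rule sum.group[symmetric]) (use that in \<open>auto simp: T_def\<close>)
    also have "\<dots> \<le> (\<Sum>j\<in>T. c j)"
    proof (rule sum_mono)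
      fix j
      let ?B = "{\<rho>\<in>B. nat \<lfloor>norm \<rho>\<rfloor> = j}"
      have nb: "real j \<le> norm \<rho>" "norm \<rho> \<le> real j + 1" if "\<rho> \<in> ?B" for \<rho>
        using that norm_ge_zero[of \<rho>] by (auto simp: le_floor_iff)
      have "sum a ?B \<le> (\<Sum>\<rho>\<in>?B. real_of_int (zorder g \<rho>) / (1 + real j) ^ q)"
        unfolding a_def using nb zo0
        by (intro sum_mono divide_left_mono power_mono mult_pos_pos zero_less_power) (auto simp: add_pos_nonneg)
      also have "\<dots> = (\<Sum>\<rho>\<in>?B. real_of_int (zorder g \<rho>)) / (1 + real j) ^ q"
        by (simp add: sum_divide_distrib)
      also have "(\<Sum>\<rho>\<in>?B. real_of_int (zorder g \<rho>)) \<le> (\<Sum>\<rho>\<in>Z (real j + 1). real_of_int (zorder g \<rho>))"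
      proof -
        have "(\<Sum>\<rho>\<in>?B. real_of_int (zorder g \<rho>)) = (\<Sum>\<rho>\<in>{\<rho>\<in>?B. g \<rho> = 0}. real_of_int (zorder g \<rho>))"
          by (rule sum.mono_neutral_right) (use zo1 that in auto)
        also have "\<dots> \<le> (\<Sum>\<rho>\<in>Z (real j + 1). real_of_int (zorder g \<rho>))"
          by (rule sum_mono2[OF finZ]) (use nb zo0 in \<open>auto simp: Z_def\<close>)
        finally show ?thesis .
      qed
      also have "\<dots> \<le> K * (1 + (real j + 1)) ^ N" by (rule count) simp
      also have "\<dots> \<le> K * (2 * (1 + real j)) ^ N" using K0 by (intro mult_left_mono power_mono) auto
      also have "K * (2 * (1 + real j)) ^ N / (1 + real j) ^ q \<le> K * (2 * (1 + real j)) ^ N / (1 + real j) ^ (N + 2)"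
        using q K0 by (intro divide_left_mono power_increasing) auto
      also have "\<dots> = c j"
        using gen[of "1 + real j"] by (simp add: c_def)
      finally show "sum a ?B \<le> c j" by (simp add: divide_right_mono)
    qed
    also have "\<dots> \<le> suminf c" by (rule sum_le_suminf[OF sumc \<open>finite T\<close>]) (use c0 in auto)
    finally show ?thesis .
  qed
  have summ: "a summable_on UNIV"
    by (rule nonneg_bdd_above_summable_on) (use a0 bound in \<open>auto intro!: bdd_aboveI\<close>)
  then show "(\<lambda>\<rho>. real_of_int (zorder g \<rho>) / (1 + norm \<rho>) ^ q) summable_on UNIV"
    by (simp add: a_def[abs_def])

  assume gz: "g z \<noteq> 0"
  define b where "b \<rho> = of_int (zorder g \<rho>) * ((-1) ^ q * fact q) / (z - \<rho>) ^ Suc q" for \<rho>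
  obtain e where e: "e > 0" "\<And>\<rho>. g \<rho> = 0 \<Longrightarrow> e \<le> norm (z - \<rho>)"
  proof -
    have "open {w. g w \<noteq> 0}"
      by (rule open_Collect_neq) (auto intro!: holomorphic_on_imp_continuous_on hol)
    then obtain e where "e > 0" "ball z e \<subseteq> {w. g w \<noteq> 0}" using gz openE by blast
    then have "e > 0" "\<And>w. dist z w < e \<Longrightarrow> g w \<noteq> 0" by (auto simp: subset_iff)
    then show ?thesis using that by (force simp: dist_norm)
  qed
  define \<delta> where "\<delta> = min (1 / 4) (e / (2 * norm z + 2))"
  have "\<delta> > 0" using e(1) by (auto simp: \<delta>_def add_nonneg_pos)
  have nb: "norm (b \<rho>) \<le> fact q / \<delta> ^ Suc q * a \<rho>" for \<rho>
  proof (cases "g \<rho> = 0")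
    case True
    have "\<delta> * (1 + norm \<rho>) \<le> norm (z - \<rho>)"
      unfolding \<delta>_def by (rule norm_diff_ge_of_separated[OF e(1) e(2)[OF True]])
    then have "(\<delta> * (1 + norm \<rho>)) ^ Suc q \<le> norm (z - \<rho>) ^ Suc q"
      using \<open>\<delta> > 0\<close> by (intro power_mono) auto
    moreover have "\<delta> ^ Suc q * (1 + norm \<rho>) ^ q \<le> (\<delta> * (1 + norm \<rho>)) ^ Suc q"
      unfolding power_mult_distrib using \<open>\<delta> > 0\<close> by (intro mult_left_mono power_increasing) auto
    ultimately have le: "\<delta> ^ Suc q * (1 + norm \<rho>) ^ q \<le> norm (z - \<rho>) ^ Suc q" by linarith
    have "norm (b \<rho>) = real_of_int (zorder g \<rho>) * fact q / norm (z - \<rho>) ^ Suc q"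
      using zo0[of \<rho>] by (simp add: b_def norm_mult norm_divide norm_power del: power_Suc)
    also have "\<dots> \<le> real_of_int (zorder g \<rho>) * fact q / (\<delta> ^ Suc q * (1 + norm \<rho>) ^ q)"
      using \<open>\<delta> > 0\<close> zo0[of \<rho>] le by (intro divide_left_mono) (auto intro!: mult_pos_pos zero_less_power simp: add_pos_nonneg less_le_trans[OF _ le] simp del: power_Suc)
    finally show ?thesis by (simp add: a_def mult_ac)
  next
    case False
    then show ?thesis using zo[of \<rho>] by (simp add: a_def b_def)
  qed
  have "(\<lambda>\<rho>. fact q / \<delta> ^ Suc q * a \<rho>) summable_on UNIV"
    by (intro summable_on_cmult_right summ)
  then have "(\<lambda>\<rho>. norm (b \<rho>)) summable_on UNIV"
    by (rule Infinite_Sum.abs_summable_on_comparison_test') (rule nb)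
  then have "b summable_on UNIV" by (rule abs_summable_summable)
  then have hs: "(b has_sum infsum b UNIV) UNIV" by simp
  then have hs': "(b has_sum infsum b UNIV) {\<rho>. g \<rho> = 0}"
    by (rule has_sum_cong_neutral[THEN iffD1, rotated -1]) (use zo in \<open>auto simp: b_def\<close>)
  \<comment> \<open>Landau controls discs only. Unordered summability is already known and every
    finite set of zeros lies in some disc, so the limit along discs is the unordered sum.\<close>
  have "filterlim Z (finite_subsets_at_top {\<rho>. g \<rho> = 0}) at_top"
    unfolding filterlim_finite_subsets_at_top
  proof safe
    fix X assume X: "finite X" "X \<subseteq> {\<rho>. g \<rho> = 0}"
    show "\<forall>\<^sub>F R in at_top. finite (Z R) \<and> X \<subseteq> Z R \<and> Z R \<subseteq> {\<rho>. g \<rho> = 0}"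
      using eventually_ge_at_top[of "Max (insert 0 (norm ` X))"]
    proof eventually_elim
      case (elim R)
      then have "\<forall>\<rho>\<in>X. norm \<rho> \<le> R" using X by simp
      then show ?case using X finZ by (auto simp: Z_def)
    qed
  qed
  then have lim1: "((\<lambda>R. sum b (Z R)) \<longlongrightarrow> infsum b UNIV) at_top"
    using hs' unfolding has_sum_def by (rule filterlim_compose[rotated])
  let ?D = "(deriv ^^ q) (\<lambda>z. deriv g z / g z) z"
  define E where "E = fact (Suc q) * (3 * (C * 4 ^ N + L + 1)) * 4 ^ Suc q"
  have "((\<lambda>R. ?D - sum b (Z R)) \<longlongrightarrow> 0) at_top"
  proof (rule Lim_null_comparison)
    show "((\<lambda>R. E / R) \<longlongrightarrow> 0) at_top"
      by (intro tendsto_divide_0[OF tendsto_const] filterlim_at_top_imp_at_infinity filterlim_ident)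
    show "\<forall>\<^sub>F R in at_top. norm (?D - sum b (Z R)) \<le> E / R"
      using eventually_ge_at_top[of "max 1 (4 * norm z)"]
    proof eventually_elim
      case (elim R)
      then have R: "1 \<le> R" "norm z \<le> R / 4" by auto
      have RN: "1 \<le> R ^ N" using R by simp
      have "norm (?D - sum b (Z R)) \<le> fact (Suc q) * (3 * (M R - ln (norm (g 0)) + 1)) / (R / 4) ^ Suc q"
        unfolding b_def by (rule Landau(3)) (use R gz in auto)
      also have "\<dots> \<le> fact (Suc q) * (3 * ((C * 4 ^ N + L + 1) * R ^ N)) / (R / 4) ^ Suc q"
      proof (intro divide_right_mono mult_left_mono)
        have "(1 + 3 * R) ^ N \<le> (4 * R) ^ N" using R by (intro power_mono) auto
        then have "M R \<le> C * (4 ^ N * R ^ N)"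
          unfolding M_def using \<open>0 \<le> C\<close> unfolding power_mult_distrib[symmetric] by (intro mult_left_mono)
        moreover have "- ln (norm (g 0)) \<le> L * 1" "L * 1 \<le> L * R ^ N"
          using mult_left_mono[OF RN, of L] by (auto simp: L_def)
        ultimately show "M R - ln (norm (g 0)) + 1 \<le> (C * 4 ^ N + L + 1) * R ^ N"
          using RN by (simp add: algebra_simps)
      qed (use R in auto)
      also have "\<dots> = E * R ^ N / R ^ Suc q" by (simp add: E_def power_divide)
      also have "\<dots> \<le> E * R ^ q / R ^ Suc q"
        using R q \<open>0 \<le> C\<close> by (intro divide_right_mono mult_left_mono power_increasing) (auto simp: E_def L_def)
      also have "\<dots> = E / R" using R by simp
      finally show ?case .
    qed
  qed
  then have "((\<lambda>R. sum b (Z R)) \<longlongrightarrow> ?D) at_top"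
    using tendsto_diff[OF tendsto_const, of _ 0 at_top ?D] by fastforce
  then have "?D = infsum b UNIV" using lim1 tendsto_unique trivial_limit_at_top_linorder by blast
  then show "((\<lambda>\<rho>. of_int (zorder g \<rho>) * ((-1) ^ q * fact q) / (z - \<rho>) ^ Suc q) has_sum ?D) UNIV"
    using hs by (simp add: b_def[abs_def])
qed

text \<open>An integer power valid for all z suits estimates on discs about the origin; the values
  on a compact disc are absorbed through x \<le> exp x.\<close>

lemma entire_finite_order_growth:
  assumes "entire_finite_order g"
  obtains C N where "0 \<le> C" "\<And>z. norm (g z) \<le> exp (C * (1 + norm z) ^ N)"
proof -
  from assms obtain A R where hol: "g holomorphic_on UNIV"
    and R: "\<And>z. norm z \<ge> R \<Longrightarrow> norm (g z) \<le> exp (norm z powr A)"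
    unfolding entire_finite_order_def by blast
  define N where "N = nat \<lceil>max A 0\<rceil>"
  define R1 where "R1 = max R 1"
  have "compact (g ` cball 0 R1)"
    by (intro compact_continuous_image holomorphic_on_imp_continuous_on holomorphic_on_subset[OF hol]) auto
  then obtain B where B: "\<And>z. norm z \<le> R1 \<Longrightarrow> norm (g z) \<le> B"
    by (fastforce dest!: compact_imp_bounded simp: bounded_iff)
  define C where "C = max 1 B"
  have "norm (g z) \<le> exp (C * (1 + norm z) ^ N)" for z
  proof (cases "norm z \<le> R1")
    case True
    have "norm (g z) \<le> C * 1" using B[OF True] by (simp add: C_def)
    also have "\<dots> \<le> C * (1 + norm z) ^ N" by (intro mult_left_mono one_le_power) (auto simp: C_def)
    also have "\<dots> \<le> exp (C * (1 + norm z) ^ N)" by (metis add.commute add_increasing2 exp_ge_add_one_self order_trans zero_le_one order_refl)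
    finally show ?thesis .
  next
    case False
    then have z: "norm z \<ge> R" "norm z \<ge> 1" by (auto simp: R1_def)
    have "A \<le> real N" by (simp add: N_def) linarith
    then have "norm z powr A \<le> norm z powr real N" using z by (intro powr_mono) auto
    also have "\<dots> = norm z ^ N" using z by (subst powr_realpow) auto
    also have "\<dots> \<le> (1 + norm z) ^ N" by (intro power_mono) auto
    also have "\<dots> \<le> C * (1 + norm z) ^ N" using mult_right_mono[of 1 C "(1 + norm z) ^ N"] by (simp add: C_def)
    finally have "exp (norm z powr A) \<le> exp (C * (1 + norm z) ^ N)" by simp
    then show ?thesis using R[OF z(1)] by linarith
  qed
  then show ?thesis by (intro that[of C N]) (auto simp: C_def)
qed

section \<open>Change of centre and quotients of entire functions\<close>

lemma one_plus_norm_add_le: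
  fixes w z :: complex
  shows "1 + norm (w + z) \<le> (1 + norm w) * (1 + norm z)"
proof -
  have "0 \<le> norm w * norm z" by simp
  moreover have "norm (w + z) \<le> norm w + norm z" by (rule norm_triangle_ineq)
  moreover have "(1 + norm w) * (1 + norm z) = 1 + norm w + norm z + norm w * norm z" by (simp add: algebra_simps)
  ultimately show ?thesis by linarith
qed

text \<open>Landau's estimate needs a nonzero value at the origin, so the origin is moved to w0. The
  growth bound and the weights 1 + |\<rho>| change by constant factors only, because 1 + |z| is
  submultiplicative under addition; the exponent N survives the translation.\<close>

lemma Hadamard_log_derivative:
  assumes "entire_finite_order g" and "g w0 \<noteq> 0"
  obtains q0 where "\<And>q. q0 \<le> q \<Longrightarrow> (\<lambda>\<rho>. real_of_int (zorder g \<rho>) / (1 + norm \<rho>) ^ q) summable_on UNIV"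
    "\<And>q z. q0 \<le> q \<Longrightarrow> g z \<noteq> 0 \<Longrightarrow>
      ((\<lambda>\<rho>. of_int (zorder g \<rho>) * ((-1) ^ q * fact q) / (z - \<rho>) ^ Suc q) has_sum
          (deriv ^^ q) (\<lambda>z. deriv g z / g z) z) UNIV"
proof -
  from entire_finite_order_growth[OF assms(1)] obtain C N
    where CN: "0 \<le> C" "\<And>z. norm (g z) \<le> exp (C * (1 + norm z) ^ N)" by blast
  have hol: "g holomorphic_on UNIV" using assms(1) by (simp add: entire_finite_order_def)
  define G where "G z = g (w0 + z)" for z
  have G: "G holomorphic_on UNIV" "G 0 \<noteq> 0"
    using holomorphic_on_compose_gen[OF holomorphic_on_add[OF holomorphic_on_const holomorphic_on_ident] hol, of w0 UNIV] assms(2)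
    by (auto simp: G_def[abs_def] o_def)
  define C' where "C' = C * (1 + norm w0) ^ N"
  have C': "0 \<le> C'" using CN by (simp add: C'_def)
  have growth: "norm (G z) \<le> exp (C' * (1 + norm z) ^ N)" for z
  proof -
    have "norm (G z) \<le> exp (C * (1 + norm (w0 + z)) ^ N)" using CN by (simp add: G_def)
    also have "\<dots> \<le> exp (C * ((1 + norm w0) * (1 + norm z)) ^ N)"
      using CN(1) one_plus_norm_add_le[of w0 z] by (auto intro!: mult_left_mono power_mono)
    finally show ?thesis by (simp add: C'_def power_mult_distrib mult_ac)
  qed
  have zo: "zorder G \<rho> = zorder g (w0 + \<rho>)" for \<rho>
    by (subst (1 2) zorder_shift) (simp add: G_def[abs_def] add_ac)
  have zo0: "zorder g \<rho> \<ge> 0" for \<rho> using zorder_entire[OF hol assms(2), of \<rho>] by (cases "g \<rho> = 0") auto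
  have bij: "bij_betw (\<lambda>\<rho>. \<rho> - w0) UNIV UNIV" by (rule bij_betwI[of _ _ _ "\<lambda>\<rho>. \<rho> + w0"]) auto
  have dG: "deriv G z = deriv g (w0 + z)" for z
    using deriv_shift_0[of g "w0 + z"] deriv_shift_0[of G z] by (simp add: G_def[abs_def] o_def add_ac)
  show ?thesis
  proof (rule that[of "N + 2"])
    fix q assume q: "N + 2 \<le> q"
    from Hadamard_log_derivative_0(1)[OF G C' growth q]
    have "(\<lambda>\<rho>. real_of_int (zorder g (w0 + \<rho>)) / (1 + norm \<rho>) ^ q) summable_on UNIV"
      by (simp add: zo)
    then have "(\<lambda>\<rho>. real_of_int (zorder g (w0 + (\<rho> - w0))) / (1 + norm (\<rho> - w0)) ^ q) summable_on UNIV"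
      by (rule summable_on_reindex_bij_betw[OF bij, THEN iffD2])
    then have "(\<lambda>\<rho>. (1 + norm w0) ^ q * (real_of_int (zorder g \<rho>) / (1 + norm (\<rho> - w0)) ^ q)) summable_on UNIV"
      by (intro summable_on_cmult_right) simp
    then show "(\<lambda>\<rho>. real_of_int (zorder g \<rho>) / (1 + norm \<rho>) ^ q) summable_on UNIV"
    proof (rule summable_on_comparison_test)
      fix \<rho> :: complex
      have "1 + norm (\<rho> - w0) \<le> (1 + norm w0) * (1 + norm \<rho>)"
        using one_plus_norm_add_le[of "- w0" \<rho>] by simp
      then have "(1 + norm (\<rho> - w0)) ^ q \<le> (1 + norm w0) ^ q * (1 + norm \<rho>) ^ q"
        unfolding power_mult_distrib[symmetric] by (intro power_mono) auto
      moreover have pos: "(1 + norm (\<rho> - w0)) ^ q > 0" "(1 + norm \<rho>) ^ q > 0"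
        by (auto intro!: zero_less_power add_pos_nonneg)
      ultimately have "1 / (1 + norm \<rho>) ^ q \<le> (1 + norm w0) ^ q / (1 + norm (\<rho> - w0)) ^ q"
        by (simp add: divide_simps)
      from mult_left_mono[OF this, of "real_of_int (zorder g \<rho>)"] zo0[of \<rho>]
      show "real_of_int (zorder g \<rho>) / (1 + norm \<rho>) ^ q \<le> (1 + norm w0) ^ q * (real_of_int (zorder g \<rho>) / (1 + norm (\<rho> - w0)) ^ q)"
        by (simp add: mult_ac)
    qed (use zo0 in \<open>auto intro!: divide_nonneg_nonneg zero_le_power add_nonneg_nonneg\<close>)
  next
    fix q z assume q: "N + 2 \<le> q" and gz: "g z \<noteq> 0"
    have "G (z - w0) \<noteq> 0" using gz by (simp add: G_def)
    from Hadamard_log_derivative_0(2)[OF G C' growth q this]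
    have "((\<lambda>\<rho>. of_int (zorder g (w0 + \<rho>)) * ((-1) ^ q * fact q) / (z - (w0 + \<rho>)) ^ Suc q) has_sum
          (deriv ^^ q) (\<lambda>z. deriv G z / G z) (z - w0)) UNIV"
      by (simp add: zo diff_diff_eq)
    then have "((\<lambda>\<rho>. of_int (zorder g (w0 + (\<rho> - w0))) * ((-1) ^ q * fact q) / (z - (w0 + (\<rho> - w0))) ^ Suc q) has_sum
          (deriv ^^ q) (\<lambda>z. deriv G z / G z) (z - w0)) UNIV"
      by (rule has_sum_reindex_bij_betw[OF bij, THEN iffD2])
    moreover have "(deriv ^^ q) (\<lambda>z. deriv G z / G z) (z - w0) = (deriv ^^ q) (\<lambda>z. deriv g z / g z) z"
      by (subst (1 2) higher_deriv_shift_0) (simp add: dG o_def, simp add: G_def)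
    ultimately show "((\<lambda>\<rho>. of_int (zorder g \<rho>) * ((-1) ^ q * fact q) / (z - \<rho>) ^ Suc q) has_sum
          (deriv ^^ q) (\<lambda>z. deriv g z / g z) z) UNIV" by simp
  qed
qed

lemma eventually_entire_nonzero:
  assumes "g holomorphic_on UNIV" and "g w0 \<noteq> 0"
  shows "eventually (\<lambda>z. g z \<noteq> 0) (at z)"
proof -
  have "g analytic_on {z}" using assms(1) analytic_on_holomorphic by blast
  then show ?thesis
    using non_zero_neighbour_alt[of g UNIV z w0] assms by auto
qed

lemma has_sum_diff:
  fixes a b :: "'a \<Rightarrow> 'b :: real_normed_vector"
  assumes "(a has_sum x) A" "(b has_sum y) A"
  shows "((\<lambda>i. a i - b i) has_sum (x - y)) A"
  using has_sum_add[OF assms(1), of "\<lambda>i. - b i" "- y"] assms(2) by (simp add: has_sum_uminus)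

text \<open>Numerator and denominator may share zeros; X collects the zeros of both, and the orders
  subtract. Countability of X keeps its complement connected, on which f and the canonical product
  are later compared.\<close>

lemma meromorphic_log_derivative:
  assumes "meromorphic_finite_order f" and nc: "\<not> f constant_on UNIV"
  obtains X q0 where "closed X" "countable X" "\<And>z. z \<notin> X \<Longrightarrow> f analytic_on {z} \<and> f z \<noteq> 0"
    "\<And>q. q0 \<le> q \<Longrightarrow> (\<lambda>\<rho>. \<bar>real_of_int (zorder f \<rho>)\<bar> / (1 + norm \<rho>) ^ q) summable_on UNIV"
    "\<And>q z. q0 \<le> q \<Longrightarrow> z \<notin> X \<Longrightarrow>
      ((\<lambda>\<rho>. of_int (zorder f \<rho>) * ((-1) ^ q * fact q) / (z - \<rho>) ^ Suc q) has_sum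
          (deriv ^^ q) (\<lambda>z. deriv f z / f z) z) UNIV"
proof -
  from assms(1) obtain g h w1 where f: "f nicely_meromorphic_on UNIV" and gh: "entire_finite_order g" "entire_finite_order h"
    and w1: "h w1 \<noteq> 0" and fgh: "\<And>z. h z \<noteq> 0 \<Longrightarrow> f z = g z / h z"
    unfolding meromorphic_finite_order_def by blast
  have hol: "g holomorphic_on UNIV" "h holomorphic_on UNIV" using gh by (auto simp: entire_finite_order_def)
  note hev = eventually_entire_nonzero[OF hol(2) w1]
  \<comment> \<open>If g vanished identically, f would vanish off the zeros of h; a nicely
    meromorphic function takes its limit as value, or 0 at a pole, so f would be constant.\<close>
  obtain w0 where w0: "g w0 \<noteq> 0"
  proof (rule ccontr)
    assume "\<not> thesis"
    then have g0: "g z = 0" for z using that by blast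
    have "f z = 0" for z
    proof -
      have "eventually (\<lambda>z. f z = 0) (at z)"
        using hev[of z] by eventually_elim (simp add: fgh g0)
      then have "f \<midarrow>z\<rightarrow> 0" by (rule tendsto_eventually)
      moreover have "is_pole f z \<and> f z = 0 \<or> f \<midarrow>z\<rightarrow> f z" using f by (auto simp: nicely_meromorphic_on_def)
      ultimately show ?thesis using LIM_unique by blast
    qed
    then show False using nc by (auto simp: constant_on_def)
  qed
  note gev = eventually_entire_nonzero[OF hol(1) w0]
  obtain qg where qg: "\<And>q. qg \<le> q \<Longrightarrow> (\<lambda>\<rho>. real_of_int (zorder g \<rho>) / (1 + norm \<rho>) ^ q) summable_on UNIV"
    "\<And>q z. qg \<le> q \<Longrightarrow> g z \<noteq> 0 \<Longrightarrow>
      ((\<lambda>\<rho>. of_int (zorder g \<rho>) * ((-1) ^ q * fact q) / (z - \<rho>) ^ Suc q) has_sum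
          (deriv ^^ q) (\<lambda>z. deriv g z / g z) z) UNIV"
    using Hadamard_log_derivative[OF gh(1) w0] by blast
  obtain qh where qh: "\<And>q. qh \<le> q \<Longrightarrow> (\<lambda>\<rho>. real_of_int (zorder h \<rho>) / (1 + norm \<rho>) ^ q) summable_on UNIV"
    "\<And>q z. qh \<le> q \<Longrightarrow> h z \<noteq> 0 \<Longrightarrow>
      ((\<lambda>\<rho>. of_int (zorder h \<rho>) * ((-1) ^ q * fact q) / (z - \<rho>) ^ Suc q) has_sum
          (deriv ^^ q) (\<lambda>z. deriv h z / h z) z) UNIV"
    using Hadamard_log_derivative[OF gh(2) w1] by blast
  have zg0: "zorder g \<rho> \<ge> 0" and zh0: "zorder h \<rho> \<ge> 0" for \<rho>
    using zorder_entire[OF hol(1) w0, of \<rho>] zorder_entire[OF hol(2) w1, of \<rho>]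
    by (cases "g \<rho> = 0"; cases "h \<rho> = 0"; simp)+
  have zo: "zorder f \<rho> = zorder g \<rho> - zorder h \<rho>" for \<rho>
  proof -
    have "zorder f \<rho> = zorder (\<lambda>z. g z / h z) \<rho>"
      by (rule zorder_cong[OF _ refl]) (use hev[of \<rho>] fgh in \<open>auto elim!: eventually_mono\<close>)
    also have "\<dots> = zorder g \<rho> - zorder h \<rho>"
      using hol gev hev
      by (intro zorder_divide eventually_frequently analytic_on_imp_meromorphic_on) (auto simp: analytic_on_holomorphic)
    finally show ?thesis .
  qed
  define X where "X = {z. g z = 0} \<union> {z. h z = 0}"
  have cont: "continuous_on UNIV g" "continuous_on UNIV h" using hol holomorphic_on_imp_continuous_on by auto
  have clX: "closed X" unfolding X_def
    by (intro closed_Un closed_Collect_eq cont continuous_on_const)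
  \<comment> \<open>A zero has positive order, hence indexes a nonzero term of a summable family,
    and such a family has countably many nonzero terms.\<close>
  have countX: "countable X"
  proof -
    have "countable {\<rho>\<in>UNIV. real_of_int (zorder g \<rho>) / (1 + norm \<rho>) ^ qg \<noteq> 0}"
      by (rule summable_countable_real[OF qg(1)[OF order_refl]])
    moreover have "countable {\<rho>\<in>UNIV. real_of_int (zorder h \<rho>) / (1 + norm \<rho>) ^ qh \<noteq> 0}"
      by (rule summable_countable_real[OF qh(1)[OF order_refl]])
    moreover have "1 + norm \<rho> \<noteq> 0" for \<rho> :: complex using norm_ge_zero[of \<rho>] by linarith
    ultimately have "countable ({\<rho>. zorder g \<rho> \<noteq> 0} \<union> {\<rho>. zorder h \<rho> \<noteq> 0})"
      by (intro countable_Un) simp_all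
    then show ?thesis
      by (rule countable_subset[rotated])
         (use zorder_entire(1)[OF hol(1) w0] zorder_entire(1)[OF hol(2) w1] in \<open>force simp: X_def\<close>)
  qed
  have holX: "g holomorphic_on - X" "h holomorphic_on - X" using hol holomorphic_on_subset by blast+
  have "(\<lambda>z. g z / h z) holomorphic_on - X"
    by (intro holomorphic_intros holX) (auto simp: X_def)
  then have fX: "f holomorphic_on - X"
    by (rule holomorphic_transform) (auto simp: X_def fgh)
  have opX: "open (- X)" using clX by auto
  have ld: "deriv f z / f z = deriv g z / g z - deriv h z / h z" if "z \<in> - X" for z
  proof -
    have nz: "g z \<noteq> 0" "h z \<noteq> 0" using that by (auto simp: X_def)
    have "deriv f z = deriv (\<lambda>z. g z / h z) z"
      by (rule deriv_cong_ev[OF eventually_mono[OF eventually_nhds_in_open[OF opX that]] refl]) (auto simp: X_def fgh)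
    also have "\<dots> = (deriv g z * h z - g z * deriv h z) / h z ^ 2"
      using nz hol by (intro deriv_divide holomorphic_on_imp_differentiable_at[of _ UNIV]) auto
    finally show ?thesis using nz by (simp add: fgh field_simps power2_eq_square)
  qed
  show ?thesis
  proof (rule that[OF clX countX, of "max qg qh"])
    fix z assume "z \<notin> X"
    then show "f analytic_on {z} \<and> f z \<noteq> 0"
      using fX opX analytic_at[of f z] by (auto simp: X_def fgh)
  next
    fix q assume q: "max qg qh \<le> q"
    have "(\<lambda>\<rho>. real_of_int (zorder g \<rho>) / (1 + norm \<rho>) ^ q + real_of_int (zorder h \<rho>) / (1 + norm \<rho>) ^ q) summable_on UNIV"
      using q by (intro summable_on_add qg qh) auto
    then show "(\<lambda>\<rho>. \<bar>real_of_int (zorder f \<rho>)\<bar> / (1 + norm \<rho>) ^ q) summable_on UNIV"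
    proof (rule summable_on_comparison_test)
      fix \<rho> :: complex
      have "\<bar>real_of_int (zorder f \<rho>)\<bar> \<le> real_of_int (zorder g \<rho>) + real_of_int (zorder h \<rho>)"
        using zg0[of \<rho>] zh0[of \<rho>] by (simp add: zo)
      then show "\<bar>real_of_int (zorder f \<rho>)\<bar> / (1 + norm \<rho>) ^ q \<le>
          real_of_int (zorder g \<rho>) / (1 + norm \<rho>) ^ q + real_of_int (zorder h \<rho>) / (1 + norm \<rho>) ^ q"
        unfolding add_divide_distrib[symmetric] by (intro divide_right_mono) (auto intro!: zero_le_power add_nonneg_nonneg)
    qed (auto intro!: divide_nonneg_nonneg zero_le_power add_nonneg_nonneg)
  next
    fix q z assume q: "max qg qh \<le> q" and z: "z \<notin> X"
    have "((\<lambda>\<rho>. of_int (zorder g \<rho>) * ((-1) ^ q * fact q) / (z - \<rho>) ^ Suc q -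
            of_int (zorder h \<rho>) * ((-1) ^ q * fact q) / (z - \<rho>) ^ Suc q) has_sum
          (deriv ^^ q) (\<lambda>z. deriv g z / g z) z - (deriv ^^ q) (\<lambda>z. deriv h z / h z) z) UNIV"
      by (intro has_sum_diff qg qh) (use q z in \<open>auto simp: X_def\<close>)
    moreover have "(deriv ^^ q) (\<lambda>z. deriv g z / g z) z - (deriv ^^ q) (\<lambda>z. deriv h z / h z) z =
        (deriv ^^ q) (\<lambda>z. deriv g z / g z - deriv h z / h z) z"
      using z opX
      by (intro higher_deriv_diff[symmetric, of _ "- X"] holomorphic_on_divide holomorphic_deriv holX) (auto simp: X_def)
    moreover have "\<dots> = (deriv ^^ q) (\<lambda>z. deriv f z / f z) z"
      by (rule higher_deriv_cong_ev[OF eventually_mono[OF eventually_nhds_in_open[OF opX]] refl]) (use z ld in auto)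
    ultimately show "((\<lambda>\<rho>. of_int (zorder f \<rho>) * ((-1) ^ q * fact q) / (z - \<rho>) ^ Suc q) has_sum
          (deriv ^^ q) (\<lambda>z. deriv f z / f z) z) UNIV"
      by (simp add: zo diff_divide_distrib left_diff_distrib)
  qed
qed


section \<open>Canonical products\<close>

text \<open>The logarithm of \<open>weierstrass_factor m\<close> that vanishes at 0, holomorphic in
  the unit disc since 1 - z has positive real part there. The polynomial cancels the Taylor terms of
  Ln (1 - z) up to degree m.\<close>

definition hlog :: "nat \<Rightarrow> complex \<Rightarrow> complex" where
  "hlog m z = Ln (1 - z) + (\<Sum>k=1..m. z ^ k / of_nat k)"

lemma sum_power_div_derivative:
  fixes z :: complex
  assumes "z \<noteq> 1"
  shows "((\<lambda>z. \<Sum>k=1..m. z ^ k / of_nat k) has_field_derivative (1 - z ^ m) / (1 - z)) (at z)"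
proof -
  have "((\<lambda>z. \<Sum>k=1..m. z ^ k / of_nat k) has_field_derivative (\<Sum>k=1..m. z ^ (k - 1))) (at z)"
    by (auto intro!: derivative_eq_intros sum.cong)
  also have "(\<Sum>k=1..m. z ^ (k - 1)) = (\<Sum>k<m. z ^ k)"
    by (rule sum.reindex_bij_witness[of _ Suc "\<lambda>k. k - 1"]) auto
  also have "\<dots> = (1 - z ^ m) / (1 - z)"
    using assms by (simp add: sum_gp_strict)
  finally show ?thesis .
qed

lemma weierstrass_factor_derivative:
  assumes "z \<noteq> 1"
  shows "(weierstrass_factor m has_field_derivative weierstrass_factor m z * (- (z ^ m) / (1 - z))) (at z)"
  unfolding weierstrass_factor_def
  by (rule derivative_eq_intros sum_power_div_derivative assms refl)+ (use assms in \<open>simp add: field_simps\<close>)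

lemma exp_hlog: "z \<noteq> 1 \<Longrightarrow> exp (hlog m z) = weierstrass_factor m z"
  by (simp add: hlog_def weierstrass_factor_def exp_add)

lemma hlog_derivative:
  assumes "norm z < 1"
  shows "(hlog m has_field_derivative - (z ^ m) / (1 - z)) (at z)"
proof -
  have "Re z < 1" using assms complex_Re_le_cmod[of z] by linarith
  then have "1 - z \<notin> \<real>\<^sub>\<le>\<^sub>0" "z \<noteq> 1" by (auto simp: complex_nonpos_Reals_iff)
  then have "((\<lambda>z. Ln (1 - z)) has_field_derivative - 1 / (1 - z)) (at z)"
    by (auto intro!: derivative_eq_intros simp: inverse_eq_divide)
  from DERIV_add[OF this sum_power_div_derivative[OF \<open>z \<noteq> 1\<close>, of m]]
  show ?thesis
    unfolding hlog_def by (rule DERIV_cong) (simp add: diff_divide_distrib)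
qed

text \<open>A mean value estimate instead of power series: the derivative -(z^m) / (1 - z) is at
  most 2 |z|^m in modulus on the disc of radius |z| \<le> 1/2, and
  \<open>hlog m 0 = 0\<close>.\<close>

lemma norm_hlog_le:
  assumes "norm z \<le> 1 / 2"
  shows "norm (hlog m z) \<le> 2 * norm z ^ Suc m"
proof -
  have "norm (hlog m z - hlog m 0) \<le> (2 * norm z ^ m) * norm (z - 0)"
  proof (rule field_differentiable_bound[of "cball 0 (norm z)"])
    fix w assume w: "w \<in> cball (0::complex) (norm z)"
    then have "norm w < 1" using assms by auto
    then show "(hlog m has_field_derivative - (w ^ m) / (1 - w)) (at w within cball 0 (norm z))"
      using hlog_derivative DERIV_subset by blast
    have "norm (1 - w) \<ge> 1 / 2" using w assms norm_triangle_ineq2[of 1 w] by auto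
    then have "norm w ^ m / norm (1 - w) \<le> norm z ^ m / (1 / 2)"
      using w by (intro frac_le power_mono) auto
    then show "norm (- (w ^ m) / (1 - w)) \<le> 2 * norm z ^ m"
      by (simp add: norm_divide norm_power)
  qed auto
  moreover have "hlog m 0 = 0" by (simp add: hlog_def power_0_left)
  ultimately show ?thesis by (simp add: mult_ac)
qed

text \<open>The logarithmic derivative of \<open>E\<^sub>m((s - \<sigma>) / (\<rho> - \<sigma>))\<close> with respect to \<open>s\<close>.\<close>

definition hkernel :: "nat \<Rightarrow> complex \<Rightarrow> complex \<Rightarrow> complex \<Rightarrow> complex" where
  "hkernel m \<sigma> \<rho> s = (s - \<sigma>) ^ m / ((\<rho> - \<sigma>) ^ m * (s - \<rho>))"

lemma hkernel_altdef:
  assumes "\<rho> \<noteq> \<sigma>" "s \<noteq> \<rho>"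
  shows "- (((s - \<sigma>) / (\<rho> - \<sigma>)) ^ m) / (1 - (s - \<sigma>) / (\<rho> - \<sigma>)) * (1 / (\<rho> - \<sigma>)) = hkernel m \<sigma> \<rho> s"
proof -
  let ?z = "(s - \<sigma>) / (\<rho> - \<sigma>)"
  have "(1 - ?z) * (\<rho> - \<sigma>) = - (s - \<rho>)" using assms by (simp add: field_simps)
  then have "- (?z ^ m) / (1 - ?z) * (1 / (\<rho> - \<sigma>)) = - (?z ^ m) / (- (s - \<rho>))" by simp
  also have "\<dots> = ?z ^ m / (s - \<rho>)" using minus_divide_divide by blast
  finally show ?thesis using assms by (simp add: hkernel_def power_divide)
qed

lemma finite_of_summable_ge:
  fixes f :: "'a \<Rightarrow> real"
  assumes summ: "f summable_on A" and nonneg: "\<And>x. x \<in> A \<Longrightarrow> 0 \<le> f x" and "0 < c"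
  shows "finite {x\<in>A. c \<le> f x}"
proof (rule finite_if_finite_subsets_card_bdd[of _ "nat \<lceil>infsum f A / c\<rceil>", THEN conjunct1])
  fix F assume F: "F \<subseteq> {x\<in>A. c \<le> f x}" "finite F"
  have "real (card F) * c = (\<Sum>x\<in>F. c)" by simp
  also have "\<dots> \<le> sum f F" using F by (intro sum_mono) auto
  also have "\<dots> \<le> infsum f A"
    by (rule finite_sum_le_infsum[OF summ F(2)]) (use F nonneg in auto)
  finally have "real (card F) \<le> infsum f A / c" using \<open>0 < c\<close> by (simp add: field_simps)
  then show "card F \<le> nat \<lceil>infsum f A / c\<rceil>" by linarith
qed

text \<open>An abstract integer divisor n. Sums and products run over \<open>- {\<sigma>}\<close>,
  so the multiplicity at \<sigma> is unconstrained and the regular points are those with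
  \<open>n s = 0\<close> or \<open>s = \<sigma>\<close>.\<close>

locale canonical_product =
  fixes n :: "complex \<Rightarrow> int" and m :: nat and \<sigma> :: complex
  assumes summ: "(\<lambda>\<rho>. \<bar>real_of_int (n \<rho>)\<bar> / norm (\<rho> - \<sigma>) ^ Suc m) summable_on - {\<sigma>}"
begin

abbreviation "factor \<rho> s \<equiv> weierstrass_factor m ((s - \<sigma>) / (\<rho> - \<sigma>)) powi n \<rho>"

abbreviation "lfactor \<rho> s \<equiv> of_int (n \<rho>) * hkernel m \<sigma> \<rho> s"

text \<open>Multiplicities are integers, so each nonzero term with |\<rho> - \<sigma>| \<le> r is at
  least 1 / r^(m+1), and a convergent sum has only finitely many such terms.\<close>

lemma finite_support_bounded: "finite {\<rho>. \<rho> \<noteq> \<sigma> \<and> n \<rho> \<noteq> 0 \<and> norm (\<rho> - \<sigma>) \<le> R}"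
proof -
  define r where "r = max R 1"
  have r: "0 < r" by (simp add: r_def)
  let ?f = "\<lambda>\<rho>. \<bar>real_of_int (n \<rho>)\<bar> / norm (\<rho> - \<sigma>) ^ Suc m"
  have "finite {\<rho>\<in>- {\<sigma>}. 1 / r ^ Suc m \<le> ?f \<rho>}"
    by (rule finite_of_summable_ge[OF summ]) (use r in auto)
  then show ?thesis
  proof (rule finite_subset[rotated], intro subsetI CollectI conjI)
    fix \<rho> assume "\<rho> \<in> {\<rho>. \<rho> \<noteq> \<sigma> \<and> n \<rho> \<noteq> 0 \<and> norm (\<rho> - \<sigma>) \<le> R}"
    then have \<rho>: "\<rho> \<noteq> \<sigma>" "n \<rho> \<noteq> 0" "norm (\<rho> - \<sigma>) \<le> r" by (auto simp: r_def)
    show "\<rho> \<in> - {\<sigma>}" using \<rho> by simp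
    have "1 \<le> \<bar>real_of_int (n \<rho>)\<bar>" "norm (\<rho> - \<sigma>) ^ Suc m \<le> r ^ Suc m" "norm (\<rho> - \<sigma>) ^ Suc m > 0"
      using \<rho> by (auto intro!: power_mono zero_less_power simp del: power_Suc)
    then show "1 / r ^ Suc m \<le> ?f \<rho>" by (intro frac_le) auto
  qed
qed

lemma factor_derivative:
  assumes "\<rho> \<noteq> \<sigma>" "s \<noteq> \<rho>"
  shows "factor \<rho> s \<noteq> 0" "(factor \<rho> has_field_derivative factor \<rho> s * lfactor \<rho> s) (at s)"
proof -
  let ?z = "(s - \<sigma>) / (\<rho> - \<sigma>)"
  have z: "?z \<noteq> 1" using assms by (simp add: field_simps)
  then have nz: "weierstrass_factor m ?z \<noteq> 0" by simp
  then show "factor \<rho> s \<noteq> 0" by (intro power_int_not_zero disjI1)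
  have "((\<lambda>s. weierstrass_factor m ((s - \<sigma>) / (\<rho> - \<sigma>))) has_field_derivative
      weierstrass_factor m ?z * (- (?z ^ m) / (1 - ?z)) * (1 / (\<rho> - \<sigma>))) (at s)"
    by (rule DERIV_chain2[where f = "weierstrass_factor m" and g = "\<lambda>s. (s - \<sigma>) / (\<rho> - \<sigma>)" and x = s, OF weierstrass_factor_derivative[OF z, of m]]) (use assms in \<open>auto intro!: derivative_eq_intros\<close>)
  moreover have "- (?z ^ m) / (1 - ?z) * (1 / (\<rho> - \<sigma>)) = hkernel m \<sigma> \<rho> s"
    by (rule hkernel_altdef[OF assms])
  ultimately have d: "((\<lambda>s. weierstrass_factor m ((s - \<sigma>) / (\<rho> - \<sigma>))) has_field_derivative
      weierstrass_factor m ?z * hkernel m \<sigma> \<rho> s) (at s)" by (simp only: mult.assoc)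
  have "(factor \<rho> has_field_derivative of_int (n \<rho>) * weierstrass_factor m ?z powi (n \<rho> - 1) * (weierstrass_factor m ?z * hkernel m \<sigma> \<rho> s)) (at s)"
    by (rule DERIV_power_int[OF d disjI2[OF nz]])
  moreover have "x powi (k - 1) * x = x powi k" if "x \<noteq> 0" for x :: complex and k
    using that by (simp add: power_int_diff)
  note p = this[OF nz, of "n \<rho>"]
  have "i * a * (w * h) = (a * w) * (i * h)" for i a w h :: complex by (simp add: algebra_simps)
  note q = this[of "of_int (n \<rho>)" "weierstrass_factor m ?z powi (n \<rho> - 1)" "weierstrass_factor m ?z" "hkernel m \<sigma> \<rho> s", unfolded p]
  ultimately show "(factor \<rho> has_field_derivative factor \<rho> s * lfactor \<rho> s) (at s)"
    by (simp only: q)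
qed

text \<open>Near a regular point only finitely many \<rho> can come close, so the rest of the
  divisor keeps a positive distance; then |s - \<rho>| is comparable to |\<rho> - \<sigma>| and each
  term is dominated by the summable family of the locale, uniformly in s.\<close>

lemma lfactor_locally_bounded:
  assumes "n s0 = 0 \<or> s0 = \<sigma>"
  obtains r K where "r > 0" "\<And>s. s \<in> ball s0 r \<Longrightarrow> n s = 0 \<or> s = \<sigma>"
    "\<And>s \<rho>. s \<in> ball s0 r \<Longrightarrow> \<rho> \<noteq> \<sigma> \<Longrightarrow>
       norm (lfactor \<rho> s) \<le> K * (\<bar>real_of_int (n \<rho>)\<bar> / norm (\<rho> - \<sigma>) ^ Suc m)"
proof -
  define Y where "Y = {\<rho>. \<rho> \<noteq> \<sigma> \<and> n \<rho> \<noteq> 0 \<and> norm (\<rho> - \<sigma>) \<le> norm (s0 - \<sigma>) + 1}"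
  have "finite Y" unfolding Y_def by (rule finite_support_bounded)
  then obtain e where e: "e > 0" "\<And>\<rho>. \<rho> \<in> Y \<Longrightarrow> \<rho> \<noteq> s0 \<Longrightarrow> e \<le> dist s0 \<rho>"
    using finite_set_avoid[of Y s0] by auto
  have s0Y: "s0 \<notin> Y" using assms by (auto simp: Y_def)
  \<comment> \<open>Points of the divisor stay at distance 2 r from s0, hence at distance r from
    every point of the ball of radius r.\<close>
  define r where "r = min e 1 / 2"
  have r: "r > 0" "2 * r \<le> e" "2 * r \<le> 1" using e by (auto simp: r_def)
  have sep: "2 * r \<le> norm (s0 - \<rho>)" if "\<rho> \<noteq> \<sigma>" "n \<rho> \<noteq> 0" for \<rho>
  proof (cases "\<rho> \<in> Y")
    case True
    then show ?thesis using e(2)[OF True] s0Y r by (cases "\<rho> = s0") (auto simp: dist_norm)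
  next
    case False
    then have "norm (\<rho> - \<sigma>) > norm (s0 - \<sigma>) + 1" using that by (simp add: Y_def)
    moreover have "norm (\<rho> - \<sigma>) \<le> norm (s0 - \<rho>) + norm (s0 - \<sigma>)"
      using norm_triangle_ineq[of "\<rho> - s0" "s0 - \<sigma>"] by (simp add: norm_minus_commute)
    ultimately show ?thesis using r by linarith
  qed
  have sep': "r \<le> norm (s - \<rho>)" if "\<rho> \<noteq> \<sigma>" "n \<rho> \<noteq> 0" "s \<in> ball s0 r" for \<rho> s
    using sep[OF that(1,2)] that(3) norm_triangle_ineq[of "s0 - s" "s - \<rho>"] by (simp add: dist_norm)
  define b where "b = norm (s0 - \<sigma>) + r"
  \<comment> \<open>b bounds |s - \<sigma>| on the whole ball, so the constant of
    \<open>norm_diff_ge_of_separated\<close> with b in place of |s - \<sigma>| serves all s at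
    once.\<close>
  define c where "c = min (1 / 4) (r / (2 * b + 2))"
  have b: "b > 0" using r by (simp add: b_def add_nonneg_pos)
  then have c: "c > 0" using r by (simp add: c_def)
  show ?thesis
  proof (rule that[OF r(1), of "b ^ m / c"])
    fix s assume s: "s \<in> ball s0 r"
    show "n s = 0 \<or> s = \<sigma>" using sep'[OF _ _ s, of s] r by auto
    fix \<rho> assume \<rho>: "\<rho> \<noteq> \<sigma>"
    show "norm (lfactor \<rho> s) \<le> b ^ m / c * (\<bar>real_of_int (n \<rho>)\<bar> / norm (\<rho> - \<sigma>) ^ Suc m)"
    proof (cases "n \<rho> = 0")
      case False
      have sb: "norm (s - \<sigma>) \<le> b"
        using s norm_triangle_ineq[of "s - s0" "s0 - \<sigma>"] by (simp add: b_def dist_norm norm_minus_commute)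
      have "r \<le> norm ((s - \<sigma>) - (\<rho> - \<sigma>))" using sep'[OF \<rho> False s] by simp
      from norm_diff_ge_of_separated[OF r(1) this]
      have 1: "min (1 / 4) (r / (2 * norm (s - \<sigma>) + 2)) * (1 + norm (\<rho> - \<sigma>)) \<le> norm (s - \<rho>)" by simp
      have "c \<le> min (1 / 4) (r / (2 * norm (s - \<sigma>) + 2))"
        unfolding c_def using sb r b by (intro min.mono divide_left_mono) (auto intro!: mult_pos_pos add_nonneg_pos)
      then have "c * norm (\<rho> - \<sigma>) \<le> min (1 / 4) (r / (2 * norm (s - \<sigma>) + 2)) * (1 + norm (\<rho> - \<sigma>))"
        using c by (intro mult_mono) auto
      with 1 have 2: "c * norm (\<rho> - \<sigma>) \<le> norm (s - \<rho>)" by linarith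
      have pos: "norm (\<rho> - \<sigma>) > 0" using \<rho> by simp
      have "norm (hkernel m \<sigma> \<rho> s) = norm (s - \<sigma>) ^ m / (norm (\<rho> - \<sigma>) ^ m * norm (s - \<rho>))"
        by (simp add: hkernel_def norm_divide norm_mult norm_power)
      also have "\<dots> \<le> b ^ m / (norm (\<rho> - \<sigma>) ^ m * (c * norm (\<rho> - \<sigma>)))"
        using 2 pos c sb by (intro frac_le power_mono mult_left_mono mult_pos_pos zero_less_power zero_le_power) (use b in auto)
      also have "\<dots> = b ^ m / c * (1 / norm (\<rho> - \<sigma>) ^ Suc m)" by (simp add: mult_ac)
      finally show ?thesis
        using mult_left_mono[of "norm (hkernel m \<sigma> \<rho> s)" "b ^ m / c * (1 / norm (\<rho> - \<sigma>) ^ Suc m)" "\<bar>real_of_int (n \<rho>)\<bar>"]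
        by (simp add: norm_mult mult_ac)
    qed simp
  qed
qed

lemma lfactor_summable:
  assumes "n s = 0 \<or> s = \<sigma>"
  shows "(\<lambda>\<rho>. norm (lfactor \<rho> s)) summable_on - {\<sigma>}"
proof -
  obtain r K where rK: "r > 0" "\<And>s'. s' \<in> ball s r \<Longrightarrow> n s' = 0 \<or> s' = \<sigma>"
    "\<And>s' \<rho>. s' \<in> ball s r \<Longrightarrow> \<rho> \<noteq> \<sigma> \<Longrightarrow>
       norm (lfactor \<rho> s') \<le> K * (\<bar>real_of_int (n \<rho>)\<bar> / norm (\<rho> - \<sigma>) ^ Suc m)"
    using lfactor_locally_bounded[OF assms] by metis
  show ?thesis
    by (rule Infinite_Sum.abs_summable_on_comparison_test'[OF summable_on_cmult_right[OF summ, of K]])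
       (rule rK(3); use rK(1) in simp)
qed

lemma lfactor_uniform_limit:
  assumes "n s0 = 0 \<or> s0 = \<sigma>"
  obtains r where "r > 0" "\<And>s. s \<in> ball s0 r \<Longrightarrow> n s = 0 \<or> s = \<sigma>"
   "uniform_limit (ball s0 r) (\<lambda>A s. \<Sum>\<rho>\<in>A. lfactor \<rho> s) (\<lambda>s. \<Sum>\<^sub>\<infinity>\<rho>\<in>- {\<sigma>}. lfactor \<rho> s) (finite_subsets_at_top (- {\<sigma>}))"
proof -
  obtain r K where rK: "r > 0" "\<And>s. s \<in> ball s0 r \<Longrightarrow> n s = 0 \<or> s = \<sigma>"
    "\<And>s \<rho>. s \<in> ball s0 r \<Longrightarrow> \<rho> \<noteq> \<sigma> \<Longrightarrow>
       norm (lfactor \<rho> s) \<le> K * (\<bar>real_of_int (n \<rho>)\<bar> / norm (\<rho> - \<sigma>) ^ Suc m)"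
    using lfactor_locally_bounded[OF assms] by metis
  show ?thesis
    by (rule that[OF rK(1,2)], assumption, rule Weierstrass_m_test_general[OF _ summable_on_cmult_right[OF summ, of K]])
       (rule rK(3); simp)
qed


text \<open>On the ball of radius R only the finitely many \<rho> in A0 can spoil a factor. For the
  others the argument of E_m has modulus at most 1/2, their logarithms are \<open>hlog\<close>, and
  these are summable uniformly by |z|^(m+1). Convergence holds even at zeros and poles: there the
  factor is 0 to a nonzero integer power, which is 0.\<close>

lemma partial_products_converge:
  assumes "R > 0"
  defines "A0 \<equiv> {\<rho>. \<rho> \<noteq> \<sigma> \<and> n \<rho> \<noteq> 0 \<and> norm (\<rho> - \<sigma>) \<le> 2 * R}"
  obtains L where "L holomorphic_on ball \<sigma> R"
    "\<And>s. s \<in> ball \<sigma> R \<Longrightarrow> ((\<lambda>A. \<Prod>\<rho>\<in>A. factor \<rho> s) \<longlongrightarrow> (\<Prod>\<rho>\<in>A0. factor \<rho> s) * exp (L s)) (finite_subsets_at_top (- {\<sigma>}))"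
    "\<And>s. s \<in> ball \<sigma> R \<Longrightarrow> n s = 0 \<or> s = \<sigma> \<Longrightarrow> (L has_field_derivative (\<Sum>\<^sub>\<infinity>\<rho>\<in>- {\<sigma>} - A0. lfactor \<rho> s)) (at s)"
proof -
  have finA0: "finite A0" unfolding A0_def by (rule finite_support_bounded)
  have A0s: "A0 \<subseteq> - {\<sigma>}" by (auto simp: A0_def)
  define F where "F \<rho> s = of_int (n \<rho>) * hlog m ((s - \<sigma>) / (\<rho> - \<sigma>))" for \<rho> s
  let ?B = "- {\<sigma>} - A0"
  define L where "L s = (\<Sum>\<^sub>\<infinity>\<rho>\<in>?B. F \<rho> s)" for s
  let ?M = "\<lambda>\<rho>. 2 * R ^ Suc m * (\<bar>real_of_int (n \<rho>)\<bar> / norm (\<rho> - \<sigma>) ^ Suc m)"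
  have half: "norm ((s - \<sigma>) / (\<rho> - \<sigma>)) \<le> 1 / 2" if "\<rho> \<in> ?B" "n \<rho> \<noteq> 0" "s \<in> cball \<sigma> R" for \<rho> s
  proof -
    have "norm (\<rho> - \<sigma>) > 2 * R" using that by (auto simp: A0_def)
    moreover have "norm (s - \<sigma>) \<le> R" using that by (simp add: dist_norm norm_minus_commute)
    ultimately have "norm (s - \<sigma>) * 2 \<le> norm (\<rho> - \<sigma>)" "norm (\<rho> - \<sigma>) > 0" using \<open>R > 0\<close> by linarith+
    then show ?thesis by (simp add: norm_divide field_simps)
  qed
  have bound: "norm (F \<rho> s) \<le> ?M \<rho>" if "\<rho> \<in> ?B" "s \<in> cball \<sigma> R" for \<rho> s
  proof (cases "n \<rho> = 0")
    case False
    have "norm (s - \<sigma>) \<le> R" using that by (simp add: dist_norm norm_minus_commute)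
    then have le: "norm (s - \<sigma>) ^ Suc m \<le> R ^ Suc m" by (intro power_mono) auto
    have "norm (hlog m ((s - \<sigma>) / (\<rho> - \<sigma>))) \<le> 2 * norm ((s - \<sigma>) / (\<rho> - \<sigma>)) ^ Suc m"
      by (rule norm_hlog_le[OF half[OF that(1) False that(2)]])
    also have "\<dots> = 2 * (norm (s - \<sigma>) ^ Suc m / norm (\<rho> - \<sigma>) ^ Suc m)"
      by (simp only: norm_divide power_divide)
    also have "\<dots> \<le> 2 * (R ^ Suc m / norm (\<rho> - \<sigma>) ^ Suc m)"
      by (intro mult_left_mono divide_right_mono le) auto
    finally have "norm (F \<rho> s) \<le> \<bar>real_of_int (n \<rho>)\<bar> * (2 * (R ^ Suc m / norm (\<rho> - \<sigma>) ^ Suc m))"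
      unfolding F_def norm_mult by (intro mult_mono) auto
    then show ?thesis by (simp only: mult_ac times_divide_eq_right times_divide_eq_left)
  qed (simp add: F_def)
  have summ': "?M summable_on ?B"
    by (intro summable_on_cmult_right summable_on_subset[OF summ]) auto
  have ul: "uniform_limit (cball \<sigma> R) (\<lambda>A s. \<Sum>\<rho>\<in>A. F \<rho> s) L (finite_subsets_at_top ?B)"
    unfolding L_def by (rule Weierstrass_m_test_general[OF bound summ'])
  have dF: "(F \<rho> has_field_derivative lfactor \<rho> s) (at s)" if "\<rho> \<in> ?B" "s \<in> cball \<sigma> R" for \<rho> s
  proof (cases "n \<rho> = 0")
    case False
    let ?z = "(s - \<sigma>) / (\<rho> - \<sigma>)"
    have h: "norm ?z \<le> 1 / 2" by (rule half[OF that(1) False that(2)])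
    then have z: "norm ?z < 1" by linarith
    have nz: "\<rho> \<noteq> \<sigma>" "s \<noteq> \<rho>" using that z by auto
    have "((\<lambda>s. hlog m ((s - \<sigma>) / (\<rho> - \<sigma>))) has_field_derivative (- (?z ^ m) / (1 - ?z)) * (1 / (\<rho> - \<sigma>))) (at s)"
      by (rule DERIV_chain2[where f = "hlog m" and g = "\<lambda>s. (s - \<sigma>) / (\<rho> - \<sigma>)" and x = s, OF hlog_derivative[OF z, of m]])
         (use nz in \<open>auto intro!: derivative_eq_intros\<close>)
    moreover have "- (?z ^ m) / (1 - ?z) * (1 / (\<rho> - \<sigma>)) = hkernel m \<sigma> \<rho> s"
      by (rule hkernel_altdef[OF nz])
    ultimately have "((\<lambda>s. hlog m ((s - \<sigma>) / (\<rho> - \<sigma>))) has_field_derivative hkernel m \<sigma> \<rho> s) (at s)" by (simp only:)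
    then show ?thesis unfolding F_def by (rule DERIV_cmult)
  qed (simp add: F_def[abs_def])
  have contF: "continuous_on (cball \<sigma> R) (F \<rho>)" and holF: "F \<rho> holomorphic_on ball \<sigma> R" if "\<rho> \<in> ?B" for \<rho>
  proof -
    show "continuous_on (cball \<sigma> R) (F \<rho>)"
      using dF[OF that] by (meson DERIV_isCont continuous_at_imp_continuous_on)
    show "F \<rho> holomorphic_on ball \<sigma> R"
      unfolding holomorphic_on_open[OF open_ball] using dF[OF that] by (meson ball_subset_cball subsetD)
  qed
  have ev: "eventually (\<lambda>A. continuous_on (cball \<sigma> R) (\<lambda>s. \<Sum>\<rho>\<in>A. F \<rho> s) \<and> (\<lambda>s. \<Sum>\<rho>\<in>A. F \<rho> s) holomorphic_on ball \<sigma> R)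
     (finite_subsets_at_top ?B)"
    by (rule eventually_finite_subsets_at_top_weakI) (use contF holF in \<open>blast intro: continuous_on_sum holomorphic_on_sum\<close>)
  have holL: "L holomorphic_on ball \<sigma> R"
    by (rule holomorphic_uniform_limit[OF ev ul]) auto
  show ?thesis
  proof (rule that[OF holL])
    fix s assume s: "s \<in> ball \<sigma> R"
    then have s': "s \<in> cball \<sigma> R" by auto
    have "((\<lambda>\<rho>. F \<rho> s) has_sum L s) ?B"
      unfolding has_sum_def by (rule tendsto_uniform_limitI[OF ul s'])
    \<comment> \<open>Setting the terms in A0 to zero moves the sum to \<open>- {\<sigma>}\<close>,
      the index set whose finite subsets direct the partial products.\<close>
    then have "((\<lambda>\<rho>. if \<rho> \<in> A0 then 0 else F \<rho> s) has_sum L s) (- {\<sigma>})"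
      by (rule has_sum_cong_neutral[THEN iffD1, rotated -1]) (use A0s in auto)
    then have lim: "((\<lambda>A. (\<Prod>\<rho>\<in>A0. factor \<rho> s) * exp (\<Sum>\<rho>\<in>A. if \<rho> \<in> A0 then 0 else F \<rho> s)) \<longlongrightarrow>
        (\<Prod>\<rho>\<in>A0. factor \<rho> s) * exp (L s)) (finite_subsets_at_top (- {\<sigma>}))"
      unfolding has_sum_def by (intro tendsto_intros)
    show "((\<lambda>A. \<Prod>\<rho>\<in>A. factor \<rho> s) \<longlongrightarrow> (\<Prod>\<rho>\<in>A0. factor \<rho> s) * exp (L s)) (finite_subsets_at_top (- {\<sigma>}))"
    proof (rule Lim_transform_eventually[OF lim])
      have fe: "factor \<rho> s = exp (F \<rho> s)" if "\<rho> \<in> ?B" for \<rho>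
      proof (cases "n \<rho> = 0")
        case False
        have "norm ((s - \<sigma>) / (\<rho> - \<sigma>)) \<le> 1 / 2" by (rule half[OF that False s'])
        then have "(s - \<sigma>) / (\<rho> - \<sigma>) \<noteq> 1" by auto
        then show ?thesis by (simp only: F_def exp_power_int[symmetric] exp_hlog not_False_eq_True)
      qed (simp add: F_def)
      show "eventually (\<lambda>A. (\<Prod>\<rho>\<in>A0. factor \<rho> s) * exp (\<Sum>\<rho>\<in>A. if \<rho> \<in> A0 then 0 else F \<rho> s) = (\<Prod>\<rho>\<in>A. factor \<rho> s))
        (finite_subsets_at_top (- {\<sigma>}))"
        unfolding eventually_finite_subsets_at_top
      proof (intro exI[of _ A0] conjI allI impI finA0 A0s)
        fix A assume A: "finite A \<and> A0 \<subseteq> A \<and> A \<subseteq> - {\<sigma>}"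
        have "(\<Sum>\<rho>\<in>A. if \<rho> \<in> A0 then 0 else F \<rho> s) = (\<Sum>\<rho>\<in>A - A0. F \<rho> s)"
          using A by (intro sum.mono_neutral_cong_right) auto
        then have "exp (\<Sum>\<rho>\<in>A. if \<rho> \<in> A0 then 0 else F \<rho> s) = (\<Prod>\<rho>\<in>A - A0. exp (F \<rho> s))"
          using A by (simp add: exp_sum)
        also have "\<dots> = (\<Prod>\<rho>\<in>A - A0. factor \<rho> s)"
          by (rule prod.cong[OF refl], rule fe[symmetric]) (use A in auto)
        finally show "(\<Prod>\<rho>\<in>A0. factor \<rho> s) * exp (\<Sum>\<rho>\<in>A. if \<rho> \<in> A0 then 0 else F \<rho> s) = (\<Prod>\<rho>\<in>A. factor \<rho> s)"
          using A by (simp only: prod.subset_diff[of A0 A "\<lambda>\<rho>. factor \<rho> s"] mult.commute)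
      qed
    qed
    assume ns: "n s = 0 \<or> s = \<sigma>"
    \<comment> \<open>Locally uniform convergence of holomorphic functions allows termwise
      differentiation.\<close>
    have "uniform_limit (ball \<sigma> R) (\<lambda>A s. \<Sum>\<rho>\<in>A. F \<rho> s) L (finite_subsets_at_top ?B)"
      by (rule uniform_limit_on_subset[OF ul]) auto
    then have lim: "((\<lambda>A. (deriv ^^ 1) (\<lambda>s. \<Sum>\<rho>\<in>A. F \<rho> s) s) \<longlongrightarrow> (deriv ^^ 1) L s) (finite_subsets_at_top ?B)"
      by (rule higher_deriv_complex_uniform_limit) (use ev s in \<open>auto elim: eventually_mono\<close>)
    have "((\<lambda>A. \<Sum>\<rho>\<in>A. lfactor \<rho> s) \<longlongrightarrow> (deriv ^^ 1) L s) (finite_subsets_at_top ?B)"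
    proof (rule Lim_transform_eventually[OF lim], rule eventually_finite_subsets_at_top_weakI)
      fix A assume "finite A" "A \<subseteq> ?B"
      then have "((\<lambda>s. \<Sum>\<rho>\<in>A. F \<rho> s) has_field_derivative (\<Sum>\<rho>\<in>A. lfactor \<rho> s)) (at s)"
        using dF s' by (intro DERIV_sum) blast
      then have "deriv (\<lambda>s. \<Sum>\<rho>\<in>A. F \<rho> s) s = (\<Sum>\<rho>\<in>A. lfactor \<rho> s)"
        by (rule DERIV_imp_deriv)
      then show "(deriv ^^ 1) (\<lambda>s. \<Sum>\<rho>\<in>A. F \<rho> s) s = (\<Sum>\<rho>\<in>A. lfactor \<rho> s)"
        by (simp only: One_nat_def funpow.simps o_apply id_apply)
    qed
    then have "((\<lambda>\<rho>. lfactor \<rho> s) has_sum deriv L s) ?B" by (simp add: has_sum_def)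
    then have "deriv L s = (\<Sum>\<^sub>\<infinity>\<rho>\<in>?B. lfactor \<rho> s)" by (simp add: infsumI)
    then show "(L has_field_derivative (\<Sum>\<^sub>\<infinity>\<rho>\<in>?B. lfactor \<rho> s)) (at s)"
      using holomorphic_derivI[OF holL open_ball s] by simp
  qed
qed

text \<open>Every s lies in some ball about \<sigma>, and uniqueness of limits makes P independent
  of the radius. The logarithmic derivative is assembled from the finite product over A0 and from
  L.\<close>

theorem canonical_product_exists:
  obtains P where "\<And>s. ((\<lambda>A. \<Prod>\<rho>\<in>A. factor \<rho> s) \<longlongrightarrow> P s) (finite_subsets_at_top (- {\<sigma>}))"
    "\<And>s. n s = 0 \<or> s = \<sigma> \<Longrightarrow> P s \<noteq> 0"
    "\<And>s. n s = 0 \<or> s = \<sigma> \<Longrightarrow> (P has_field_derivative P s * (\<Sum>\<^sub>\<infinity>\<rho>\<in>- {\<sigma>}. lfactor \<rho> s)) (at s)"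
proof -
  have "\<exists>p. ((\<lambda>A. \<Prod>\<rho>\<in>A. factor \<rho> s) \<longlongrightarrow> p) (finite_subsets_at_top (- {\<sigma>}))" for s
  proof -
    have R: "norm (s - \<sigma>) + 1 > 0" by (simp add: add_nonneg_pos)
    have s: "s \<in> ball \<sigma> (norm (s - \<sigma>) + 1)" by (simp add: dist_norm norm_minus_commute)
    show ?thesis
      by (rule partial_products_converge[OF R]) (use s in blast)
  qed
  then obtain P where P: "\<And>s. ((\<lambda>A. \<Prod>\<rho>\<in>A. factor \<rho> s) \<longlongrightarrow> P s) (finite_subsets_at_top (- {\<sigma>}))"
    by metis
  have "P s \<noteq> 0 \<and> (P has_field_derivative P s * (\<Sum>\<^sub>\<infinity>\<rho>\<in>- {\<sigma>}. lfactor \<rho> s)) (at s)" if ns: "n s = 0 \<or> s = \<sigma>" for s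
  proof -
    define R where "R = norm (s - \<sigma>) + 1"
    have R: "R > 0" by (simp add: R_def add_nonneg_pos)
    have s: "s \<in> ball \<sigma> R" by (simp add: R_def dist_norm norm_minus_commute)
    define A0 where "A0 = {\<rho>. \<rho> \<noteq> \<sigma> \<and> n \<rho> \<noteq> 0 \<and> norm (\<rho> - \<sigma>) \<le> 2 * R}"
    have finA0: "finite A0" unfolding A0_def by (rule finite_support_bounded)
    have A0s: "A0 \<subseteq> - {\<sigma>}" by (auto simp: A0_def)
    obtain L where L: "L holomorphic_on ball \<sigma> R"
      "\<And>s. s \<in> ball \<sigma> R \<Longrightarrow> ((\<lambda>A. \<Prod>\<rho>\<in>A. factor \<rho> s) \<longlongrightarrow> (\<Prod>\<rho>\<in>A0. factor \<rho> s) * exp (L s)) (finite_subsets_at_top (- {\<sigma>}))"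
      "\<And>s. s \<in> ball \<sigma> R \<Longrightarrow> n s = 0 \<or> s = \<sigma> \<Longrightarrow> (L has_field_derivative (\<Sum>\<^sub>\<infinity>\<rho>\<in>- {\<sigma>} - A0. lfactor \<rho> s)) (at s)"
      using partial_products_converge[OF R, folded A0_def] by blast
    have PL: "P w = (\<Prod>\<rho>\<in>A0. factor \<rho> w) * exp (L w)" if "w \<in> ball \<sigma> R" for w
      using tendsto_unique[OF _ P L(2)[OF that]] by simp
    have nz: "\<rho> \<noteq> \<sigma>" "s \<noteq> \<rho>" if "\<rho> \<in> A0" for \<rho> using that ns by (auto simp: A0_def)
    have pnz: "(\<Prod>\<rho>\<in>A0. factor \<rho> s) \<noteq> 0"
      using finA0 factor_derivative(1)[OF nz] by (simp only: prod_zero_iff) blast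
    have "((\<lambda>w. (\<Prod>\<rho>\<in>A0. factor \<rho> w) * exp (L w)) has_field_derivative
       (\<Prod>\<rho>\<in>A0. factor \<rho> s) * (\<Sum>\<rho>\<in>A0. lfactor \<rho> s) * exp (L s) +
       exp (L s) * (\<Sum>\<^sub>\<infinity>\<rho>\<in>- {\<sigma>} - A0. lfactor \<rho> s) * (\<Prod>\<rho>\<in>A0. factor \<rho> s)) (at s)"
      by (intro DERIV_mult has_field_derivative_prod_log[OF finA0] factor_derivative(2)[OF nz] DERIV_fun_exp L(3)[OF s ns])
    then have "(P has_field_derivative
       (\<Prod>\<rho>\<in>A0. factor \<rho> s) * (\<Sum>\<rho>\<in>A0. lfactor \<rho> s) * exp (L s) +
       exp (L s) * (\<Sum>\<^sub>\<infinity>\<rho>\<in>- {\<sigma>} - A0. lfactor \<rho> s) * (\<Prod>\<rho>\<in>A0. factor \<rho> s)) (at s)"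
      by (rule has_field_derivative_transform_within_open[OF _ open_ball s]) (simp only: PL)
    moreover have "x * a * e + e * b * x = x * e * (a + b)" for x a e b :: complex by (simp add: algebra_simps)
    note this[of "\<Prod>\<rho>\<in>A0. factor \<rho> s" _ "exp (L s)", folded PL[OF s]]
    moreover have "(\<Sum>\<rho>\<in>A0. lfactor \<rho> s) + (\<Sum>\<^sub>\<infinity>\<rho>\<in>- {\<sigma>} - A0. lfactor \<rho> s) = (\<Sum>\<^sub>\<infinity>\<rho>\<in>- {\<sigma>}. lfactor \<rho> s)"
    proof -
      have "(\<lambda>\<rho>. lfactor \<rho> s) summable_on - {\<sigma>}" using lfactor_summable[OF ns] by (rule abs_summable_summable)
      then have "(\<Sum>\<^sub>\<infinity>\<rho>\<in>A0 \<union> (- {\<sigma>} - A0). lfactor \<rho> s) = infsum (\<lambda>\<rho>. lfactor \<rho> s) A0 + (\<Sum>\<^sub>\<infinity>\<rho>\<in>- {\<sigma>} - A0. lfactor \<rho> s)"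
        by (intro infsum_Un_disjoint) (use finA0 in \<open>auto intro: summable_on_subset\<close>)
      moreover have "A0 \<union> (- {\<sigma>} - A0) = - {\<sigma>}" using A0s by auto
      ultimately show ?thesis using finA0 by simp
    qed
    ultimately show ?thesis using pnz PL[OF s] by simp
  qed
  then show ?thesis using P that by blast
qed

end


section \<open>Hadamard factorization\<close>

lemma pderiv_surj: "\<exists>q :: complex poly. pderiv q = p"
proof
  show "pderiv (\<Sum>i\<le>degree p. monom (coeff p i / of_nat (Suc i)) (Suc i)) = p"
    using higher_pderiv_sum[of 1 "\<lambda>i. monom (coeff p i / of_nat (Suc i)) (Suc i)" "{..degree p}"]
    by (simp add: pderiv_monom poly_as_sum_of_monoms del: of_nat_Suc)
qed

lemma higher_deriv_zero_imp_poly: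
  assumes "D holomorphic_on S" "open S" "connected S" "\<And>z. z \<in> S \<Longrightarrow> (deriv ^^ q) D z = 0"
  shows "\<exists>p. \<forall>z\<in>S. D z = poly p z"
  using assms(1,4)
proof (induction q arbitrary: D)
  case 0
  then show ?case by (intro exI[of _ 0]) simp
next
  case (Suc q)
  have "deriv D holomorphic_on S" using Suc.prems(1) assms(2) by (rule holomorphic_deriv)
  moreover have "(deriv ^^ q) (deriv D) z = 0" if "z \<in> S" for z
    using Suc.prems(2)[OF that] by (simp add: funpow_Suc_right del: funpow.simps)
  ultimately obtain p where p: "\<And>z. z \<in> S \<Longrightarrow> deriv D z = poly p z" using Suc.IH by blast
  obtain p1 where p1: "pderiv p1 = p" using pderiv_surj by blast
  have d: "((\<lambda>z. D z - poly p1 z) has_field_derivative 0) (at z)" if "z \<in> S" for z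
    by (rule DERIV_cong[OF DERIV_diff[OF holomorphic_derivI[OF Suc.prems(1) assms(2) that] poly_DERIV]])
       (simp add: p p1 that)
  obtain c where "\<And>z. z \<in> S \<Longrightarrow> D z - poly p1 z = c"
    by (rule DERIV_zero_connected_constant[OF assms(3,2) finite.emptyI, of "\<lambda>z. D z - poly p1 z"])
       (use d in \<open>auto intro!: DERIV_continuous_on DERIV_subset[OF d]\<close>)
  then show ?case by (intro exI[of _ "p1 + [:c:]"]) (auto simp: algebra_simps)
qed

lemma higher_deriv_sum:
  assumes "finite A" "open S" "z \<in> S" "\<And>i. i \<in> A \<Longrightarrow> f i holomorphic_on S"
  shows "(deriv ^^ q) (\<lambda>z. \<Sum>i\<in>A. f i z) z = (\<Sum>i\<in>A. (deriv ^^ q) (f i) z)"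
  using assms(1,4)
proof (induction A)
  case (insert i A)
  have "(deriv ^^ q) (\<lambda>z. f i z + (\<Sum>i\<in>A. f i z)) z = (deriv ^^ q) (f i) z + (deriv ^^ q) (\<lambda>z. \<Sum>i\<in>A. f i z) z"
    using insert.prems assms(2,3) by (intro higher_deriv_add holomorphic_on_sum) auto
  then show ?case using insert by simp
qed simp

lemma hkernel_holomorphic: "\<rho> \<notin> S \<Longrightarrow> hkernel m \<sigma> \<rho> holomorphic_on S"
  if "\<rho> \<noteq> \<sigma>"
  unfolding hkernel_def[abs_def] using that
  by (intro holomorphic_on_divide holomorphic_on_mult holomorphic_on_power holomorphic_on_diff
      holomorphic_on_const holomorphic_on_ident) auto

text \<open>\<open>hkernel m \<sigma> \<rho>\<close> differs from 1 / (s - \<rho>) by a polynomial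
  of degree below m, which q \<ge> m derivatives kill. Each induction step adds the monomial (s -
  \<sigma>)^m / (\<rho> - \<sigma>)^(m+1).\<close>

lemma higher_deriv_hkernel:
  assumes "\<rho> \<noteq> \<sigma>" "m \<le> q" "s \<noteq> \<rho>"
  shows "(deriv ^^ q) (hkernel m \<sigma> \<rho>) s = (-1) ^ q * fact q / (s - \<rho>) ^ Suc q"
  using assms(2)
proof (induction m)
  case 0
  have "(deriv ^^ q) (\<lambda>w. \<Sum>\<rho>\<in>{\<rho>}. 1 / (w - \<rho>)) s = (\<Sum>\<rho>\<in>{\<rho>}. 1 * ((-1) ^ q * fact q) / (s - \<rho>) ^ Suc q)"
    by (rule higher_deriv_partial_fractions) (use assms in auto)
  then show ?case by (simp add: hkernel_def[abs_def])
next
  case (Suc m)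
  have op: "open (- {\<rho>})" "s \<in> - {\<rho>}" using assms by auto
  have "hkernel (Suc m) \<sigma> \<rho> w = hkernel m \<sigma> \<rho> w + 1 / (\<rho> - \<sigma>) ^ Suc m * (w - \<sigma>) ^ m" if "w \<in> - {\<rho>}" for w
  proof -
    have nz: "w - \<rho> \<noteq> 0" "\<rho> - \<sigma> \<noteq> 0" using that assms by auto
    have "x * y / (a * b * r) = y / (b * r) + 1 / (a * b) * y" if "x = r + a" "a \<noteq> 0" "b \<noteq> 0" "r \<noteq> 0" for x y a b r :: complex
      using that by (simp add: field_simps)
    from this[of "w - \<sigma>" "w - \<rho>" "\<rho> - \<sigma>" "(\<rho> - \<sigma>) ^ m" "(w - \<sigma>) ^ m"] nz
    show ?thesis by (simp add: hkernel_def)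
  qed
  then have "(deriv ^^ q) (hkernel (Suc m) \<sigma> \<rho>) s = (deriv ^^ q) (\<lambda>w. hkernel m \<sigma> \<rho> w + 1 / (\<rho> - \<sigma>) ^ Suc m * (w - \<sigma>) ^ m) s"
    by (intro higher_deriv_cong_ev[OF eventually_mono[OF eventually_nhds_in_open[OF op]] refl])
  also have "\<dots> = (deriv ^^ q) (hkernel m \<sigma> \<rho>) s + (deriv ^^ q) (\<lambda>w. 1 / (\<rho> - \<sigma>) ^ Suc m * (w - \<sigma>) ^ m) s"
    by (rule higher_deriv_add[OF hkernel_holomorphic[OF assms(1)] _ op])
       (simp, intro holomorphic_on_mult holomorphic_on_power holomorphic_on_diff holomorphic_on_const holomorphic_on_ident)
  also have "(deriv ^^ q) (\<lambda>w. 1 / (\<rho> - \<sigma>) ^ Suc m * (w - \<sigma>) ^ m) s = 1 / (\<rho> - \<sigma>) ^ Suc m * (deriv ^^ q) (\<lambda>w. (w - \<sigma>) ^ m) s"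
    by (rule higher_deriv_cmult[of _ UNIV])
       (intro holomorphic_on_power holomorphic_on_diff holomorphic_on_const holomorphic_on_ident, simp_all)
  also have "(deriv ^^ q) (\<lambda>w. (w - \<sigma>) ^ m) s = 0"
    using Suc.prems by (subst higher_deriv_power) (simp add: pochhammer_0_left)
  finally show ?case using Suc by simp
qed

text \<open>The weights 1 + |\<rho>| and |\<rho> - \<sigma>| are comparable once the divisor keeps a
  positive distance from \<sigma>, apart from \<sigma> itself. That distance exists because integer
  multiplicities prevent accumulation.\<close>

lemma summable_on_center:
  fixes n :: "complex \<Rightarrow> int"
  assumes summ: "(\<lambda>\<rho>. \<bar>real_of_int (n \<rho>)\<bar> / (1 + norm \<rho>) ^ q) summable_on UNIV"
  shows "(\<lambda>\<rho>. \<bar>real_of_int (n \<rho>)\<bar> / norm (\<rho> - \<sigma>) ^ q) summable_on - {\<sigma>}"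
proof -
  \<comment> \<open>A lower bound for every nonzero term with |\<rho> - \<sigma>| \<le> 1; only
    finitely many terms can reach it.\<close>
  let ?c = "1 / (2 + norm \<sigma>) ^ q"
  have pos: "0 < (1 + norm \<rho>) ^ q" for \<rho> :: complex by (auto intro!: zero_less_power add_pos_nonneg)
  have "finite {\<rho>\<in>UNIV. ?c \<le> \<bar>real_of_int (n \<rho>)\<bar> / (1 + norm \<rho>) ^ q}"
    by (rule finite_of_summable_ge[OF summ])
       (auto intro!: divide_nonneg_nonneg zero_le_power zero_less_power add_pos_nonneg)
  then obtain e where e: "e > 0"
     "\<And>\<rho>. ?c \<le> \<bar>real_of_int (n \<rho>)\<bar> / (1 + norm \<rho>) ^ q \<Longrightarrow> \<rho> \<noteq> \<sigma> \<Longrightarrow> e \<le> dist \<sigma> \<rho>"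
    using finite_set_avoid[of "{\<rho>\<in>UNIV. ?c \<le> \<bar>real_of_int (n \<rho>)\<bar> / (1 + norm \<rho>) ^ q}" \<sigma>] by auto
  define r where "r = min e 1"
  have r: "r > 0" using e by (simp add: r_def)
  have sep: "r \<le> norm (\<sigma> - \<rho>)" if "n \<rho> \<noteq> 0" "\<rho> \<noteq> \<sigma>" for \<rho>
  proof (rule ccontr)
    assume less: "\<not> ?thesis"
    then have "norm \<rho> \<le> 1 + norm \<sigma>" using norm_triangle_ineq2[of \<rho> \<sigma>] by (simp add: r_def norm_minus_commute)
    then have "(1 + norm \<rho>) ^ q \<le> (2 + norm \<sigma>) ^ q" by (intro power_mono) auto
    moreover have "1 \<le> \<bar>real_of_int (n \<rho>)\<bar>" using that by linarith
    ultimately have "?c \<le> \<bar>real_of_int (n \<rho>)\<bar> / (1 + norm \<rho>) ^ q"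
      using pos by (intro frac_le) auto
    from e(2)[OF this that(2)] less show False by (simp add: r_def dist_norm)
  qed
  define \<delta> where "\<delta> = min (1 / 4) (r / (2 * norm \<sigma> + 2))"
  have "\<delta> > 0" using r by (auto simp: \<delta>_def add_nonneg_pos)
  have "(\<lambda>\<rho>. 1 / \<delta> ^ q * (\<bar>real_of_int (n \<rho>)\<bar> / (1 + norm \<rho>) ^ q)) summable_on - {\<sigma>}"
    by (intro summable_on_cmult_right summable_on_subset[OF summ]) auto
  then show ?thesis
  proof (rule summable_on_comparison_test)
    fix \<rho> assume "\<rho> \<in> - {\<sigma>}"
    then have \<rho>: "\<rho> \<noteq> \<sigma>" by simp
    show "\<bar>real_of_int (n \<rho>)\<bar> / norm (\<rho> - \<sigma>) ^ q \<le> 1 / \<delta> ^ q * (\<bar>real_of_int (n \<rho>)\<bar> / (1 + norm \<rho>) ^ q)"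
    proof (cases "n \<rho> = 0")
      case False
      have "\<delta> * (1 + norm \<rho>) \<le> norm (\<sigma> - \<rho>)"
        unfolding \<delta>_def by (rule norm_diff_ge_of_separated[OF r sep[OF False \<rho>]])
      then have "(\<delta> * (1 + norm \<rho>)) ^ q \<le> norm (\<rho> - \<sigma>) ^ q"
        using \<open>\<delta> > 0\<close> by (intro power_mono) (auto simp: norm_minus_commute)
      then have "\<bar>real_of_int (n \<rho>)\<bar> / norm (\<rho> - \<sigma>) ^ q \<le> \<bar>real_of_int (n \<rho>)\<bar> / (\<delta> * (1 + norm \<rho>)) ^ q"
        using \<open>\<delta> > 0\<close> \<rho> by (intro divide_left_mono mult_pos_pos zero_less_power) (auto simp: add_pos_nonneg)
      then show ?thesis by (simp add: power_mult_distrib)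
    qed simp
  qed auto
qed

lemma summable_on_one_plus_norm:
  fixes n :: "complex \<Rightarrow> int"
  assumes "(\<lambda>\<rho>. \<bar>real_of_int (n \<rho>)\<bar> / norm \<rho> ^ q) summable_on - {0}"
  shows "(\<lambda>\<rho>. \<bar>real_of_int (n \<rho>)\<bar> / (1 + norm \<rho>) ^ q) summable_on UNIV"
proof -
  have "(\<lambda>\<rho>. \<bar>real_of_int (n \<rho>)\<bar> / (1 + norm \<rho>) ^ q) summable_on - {0}"
    by (rule summable_on_comparison_test[OF assms])
       (auto intro!: divide_left_mono power_mono mult_pos_pos zero_less_power divide_nonneg_nonneg zero_le_power add_pos_nonneg)
  then have "(\<lambda>\<rho>. \<bar>real_of_int (n \<rho>)\<bar> / (1 + norm \<rho>) ^ q) summable_on insert 0 (- {0})"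
    by (simp add: summable_on_insert_iff)
  moreover have "insert 0 (- {0}) = (UNIV :: complex set)" by auto
  ultimately show ?thesis by simp
qed

text \<open>Finite order provides some summable exponent, so the least one is attained; then the
  centre moves from 0 to \<sigma>.\<close>

lemma conv_exponent_summable:
  assumes "meromorphic_finite_order f" "\<not> f constant_on UNIV"
  shows "(\<lambda>\<rho>. \<bar>real_of_int (zorder f \<rho>)\<bar> / norm (\<rho> - \<sigma>) ^ conv_exponent f) summable_on - {\<sigma>}"
proof -
  obtain X q0 where "\<And>q. q0 \<le> q \<Longrightarrow> (\<lambda>\<rho>. \<bar>real_of_int (zorder f \<rho>)\<bar> / (1 + norm \<rho>) ^ q) summable_on UNIV"
    using meromorphic_log_derivative[OF assms] by metis
  from summable_on_center[OF this[OF order_refl], of 0]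
  have "(\<lambda>\<rho>. \<bar>of_int (zorder f \<rho>)\<bar> / norm \<rho> ^ q0) summable_on - {0 :: complex}" by simp
  then have "(\<lambda>\<rho>. \<bar>of_int (zorder f \<rho>)\<bar> / norm \<rho> ^ conv_exponent f) summable_on - {0 :: complex}"
    unfolding conv_exponent_def by (rule LeastI)
  then show ?thesis by (intro summable_on_center summable_on_one_plus_norm)
qed

context canonical_product begin

lemma lfactor_holomorphic:
  assumes "\<rho> \<noteq> \<sigma>" "n \<rho> = 0 \<or> \<rho> \<notin> S"
  shows "(\<lambda>s. lfactor \<rho> s) holomorphic_on S"
  using assms hkernel_holomorphic[OF assms(1), of S] by (cases "n \<rho> = 0") (auto intro!: holomorphic_on_mult)

text \<open>Termwise differentiation by locally uniform convergence. After q \<ge> m derivatives the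
  terms depend neither on m nor on the centre \<sigma>, so they are literally those of Landau's
  expansion of f'/f.\<close>

lemma higher_deriv_sum_lfactor:
  assumes "n s = 0" "s \<noteq> \<sigma>" "m \<le> q"
  shows "((\<lambda>\<rho>. of_int (n \<rho>) * ((-1) ^ q * fact q) / (s - \<rho>) ^ Suc q) has_sum
     (deriv ^^ q) (\<lambda>s. \<Sum>\<^sub>\<infinity>\<rho>\<in>- {\<sigma>}. lfactor \<rho> s) s) (- {\<sigma>})"
proof -
  obtain r where r: "r > 0" "\<And>s'. s' \<in> ball s r \<Longrightarrow> n s' = 0 \<or> s' = \<sigma>"
   "uniform_limit (ball s r) (\<lambda>A s. \<Sum>\<rho>\<in>A. lfactor \<rho> s) (\<lambda>s. \<Sum>\<^sub>\<infinity>\<rho>\<in>- {\<sigma>}. lfactor \<rho> s) (finite_subsets_at_top (- {\<sigma>}))"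
    using lfactor_uniform_limit[OF disjI1[OF assms(1)]] by blast
  have hol: "(\<lambda>s. lfactor \<rho> s) holomorphic_on ball s r" if "\<rho> \<noteq> \<sigma>" for \<rho>
    by (rule lfactor_holomorphic[OF that]) (use r(2)[of \<rho>] that in auto)
  have s: "s \<in> ball s r" using r by simp
  have "((\<lambda>A. (deriv ^^ q) (\<lambda>s. \<Sum>\<rho>\<in>A. lfactor \<rho> s) s) \<longlongrightarrow> (deriv ^^ q) (\<lambda>s. \<Sum>\<^sub>\<infinity>\<rho>\<in>- {\<sigma>}. lfactor \<rho> s) s)
      (finite_subsets_at_top (- {\<sigma>}))"
  proof (rule higher_deriv_complex_uniform_limit[OF r(3) _ _ open_ball s])
    show "\<forall>\<^sub>F A in finite_subsets_at_top (- {\<sigma>}). (\<lambda>s. \<Sum>\<rho>\<in>A. lfactor \<rho> s) holomorphic_on ball s r"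
      by (rule eventually_finite_subsets_at_top_weakI, rule holomorphic_on_sum, rule hol) auto
  qed simp
  then have "((\<lambda>A. \<Sum>\<rho>\<in>A. of_int (n \<rho>) * ((-1) ^ q * fact q) / (s - \<rho>) ^ Suc q) \<longlongrightarrow>
      (deriv ^^ q) (\<lambda>s. \<Sum>\<^sub>\<infinity>\<rho>\<in>- {\<sigma>}. lfactor \<rho> s) s) (finite_subsets_at_top (- {\<sigma>}))"
  proof (rule Lim_transform_eventually, intro eventually_finite_subsets_at_top_weakI)
    fix A assume A: "finite A" "A \<subseteq> - {\<sigma>}"
    have "(deriv ^^ q) (\<lambda>s. \<Sum>\<rho>\<in>A. lfactor \<rho> s) s = (\<Sum>\<rho>\<in>A. (deriv ^^ q) (\<lambda>s. lfactor \<rho> s) s)"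
      by (rule higher_deriv_sum[OF A(1) open_ball s], rule hol) (use A in auto)
    also have "\<dots> = (\<Sum>\<rho>\<in>A. of_int (n \<rho>) * ((-1) ^ q * fact q) / (s - \<rho>) ^ Suc q)"
    proof (rule sum.cong[OF refl])
      fix \<rho> assume "\<rho> \<in> A"
      then have \<rho>: "\<rho> \<noteq> \<sigma>" using A by auto
      show "(deriv ^^ q) (\<lambda>s. lfactor \<rho> s) s = of_int (n \<rho>) * ((-1) ^ q * fact q) / (s - \<rho>) ^ Suc q"
      proof (cases "n \<rho> = 0")
        case False
        then have "s \<noteq> \<rho>" using assms by auto
        then have "(deriv ^^ q) (\<lambda>s. lfactor \<rho> s) s = of_int (n \<rho>) * (deriv ^^ q) (hkernel m \<sigma> \<rho>) s"
          by (intro higher_deriv_cmult[of _ "- {\<rho>}"] hkernel_holomorphic \<rho>) auto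
        then show ?thesis using higher_deriv_hkernel[OF \<rho> assms(3) \<open>s \<noteq> \<rho>\<close>] by simp
      qed simp
    qed
    finally show "(deriv ^^ q) (\<lambda>s. \<Sum>\<rho>\<in>A. lfactor \<rho> s) s = (\<Sum>\<rho>\<in>A. of_int (n \<rho>) * ((-1) ^ q * fact q) / (s - \<rho>) ^ Suc q)" .
  qed
  then show ?thesis by (simp add: has_sum_def)
qed

end

text \<open>The logarithmic derivatives of f and of (s - \<sigma>)^n P have equal q-th derivatives,
  so they differ by a polynomial p; integrating p gives the exponent Q.\<close>

lemma Hadamard_log_form:
  assumes "meromorphic_finite_order f" "\<not> f constant_on UNIV" and d: "conv_exponent f = Suc m"
    and P: "\<And>s. zorder f s = 0 \<or> s = \<sigma> \<Longrightarrow> P s \<noteq> 0"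
    "\<And>s. zorder f s = 0 \<or> s = \<sigma> \<Longrightarrow> (P has_field_derivative P s *
       (\<Sum>\<^sub>\<infinity>\<rho>\<in>- {\<sigma>}. of_int (zorder f \<rho>) * hkernel m \<sigma> \<rho> s)) (at s)"
  obtains Q X where "countable X" "\<And>s. s \<notin> X \<Longrightarrow> f s = (s - \<sigma>) powi zorder f \<sigma> * exp (poly Q s) * P s"
proof -
  define n where "n = zorder f"
  obtain X q0 where X: "closed X" "countable X" "\<And>z. z \<notin> X \<Longrightarrow> f analytic_on {z} \<and> f z \<noteq> 0"
    "\<And>q z. q0 \<le> q \<Longrightarrow> z \<notin> X \<Longrightarrow>
      ((\<lambda>\<rho>. of_int (n \<rho>) * ((-1) ^ q * fact q) / (z - \<rho>) ^ Suc q) has_sum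
          (deriv ^^ q) (\<lambda>z. deriv f z / f z) z) UNIV"
    by (rule meromorphic_log_derivative[OF assms(1,2), folded n_def]) (rule that)
  interpret canonical_product n m \<sigma>
    by unfold_locales (use conv_exponent_summable[OF assms(1,2), of \<sigma>] in \<open>simp add: d n_def\<close>)
  define q where "q = max q0 m"
  \<comment> \<open>The complement of a countable closed set: open, connected and free of zeros and
    poles, so that differential identities integrate globally.\<close>
  define U where "U = - (insert \<sigma> X)"
  have opU: "open U" using X(1) by (simp add: U_def open_Compl)
  have conU: "connected U"
    unfolding U_def by (intro path_connected_imp_connected path_connected_complement_countable) (use X(2) in auto)
  have nU: "n z = 0" if "z \<in> U" for z
    using X(3)[of z] that by (auto simp: U_def n_def intro!: zorder_eq_0I)
  have fU: "f z \<noteq> 0" if "z \<in> U" for z using X(3)[of z] that by (auto simp: U_def)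
  have holf: "f holomorphic_on U"
    using X(3) by (intro analytic_imp_holomorphic) (auto simp: analytic_on_def U_def)
  define S where "S s = (\<Sum>\<^sub>\<infinity>\<rho>\<in>- {\<sigma>}. lfactor \<rho> s)" for s
  have PU: "P z \<noteq> 0" "(P has_field_derivative P z * S z) (at z)" if "z \<in> U" for z
    using P[of z] nU[OF that] by (auto simp: n_def S_def)
  have holP: "P holomorphic_on U"
    using PU(2) opU by (auto simp: holomorphic_on_open)
  have "(\<lambda>z. deriv P z / P z) holomorphic_on U"
    by (intro holomorphic_on_divide holomorphic_deriv holP opU) (use PU in auto)
  then have holS: "S holomorphic_on U"
    by (rule holomorphic_transform) (simp add: DERIV_imp_deriv[OF PU(2)] PU(1))
  have holL: "(\<lambda>z. deriv f z / f z) holomorphic_on U"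
    by (intro holomorphic_on_divide holomorphic_deriv holf opU) (use fU in auto)
  define E where "E z = of_int (n \<sigma>) / (z - \<sigma>)" for z
  have holE: "E holomorphic_on U"
    unfolding E_def[abs_def] U_def by (intro holomorphic_on_divide holomorphic_on_diff holomorphic_on_const holomorphic_on_ident) auto
  define D where "D z = deriv f z / f z - (E z + S z)" for z
  have holD: "D holomorphic_on U"
    unfolding D_def[abs_def] by (intro holomorphic_on_diff holomorphic_on_add holL holE holS)
  have "(deriv ^^ q) D z = 0" if z: "z \<in> U" for z
  proof -
    have z': "z \<notin> X" "z \<noteq> \<sigma>" using z by (auto simp: U_def)
    let ?t = "\<lambda>\<rho>. of_int (n \<rho>) * ((-1) ^ q * fact q) / (z - \<rho>) ^ Suc q"
    have "(?t has_sum (deriv ^^ q) S z) (- {\<sigma>})"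
      unfolding S_def[abs_def] by (rule higher_deriv_sum_lfactor) (use z' nU[OF z] in \<open>auto simp: q_def\<close>)
    \<comment> \<open>The expansion of f'/f also contains the term \<rho> = \<sigma>; it is the q-th
      derivative of E.\<close>
    then have "(?t has_sum ?t \<sigma> + (deriv ^^ q) S z) (insert \<sigma> (- {\<sigma>}))"
      by (intro has_sum_insert) auto
    moreover have "insert \<sigma> (- {\<sigma>}) = UNIV" by auto
    ultimately have "(?t has_sum ?t \<sigma> + (deriv ^^ q) S z) UNIV" by simp
    moreover have "(?t has_sum (deriv ^^ q) (\<lambda>z. deriv f z / f z) z) UNIV"
      by (rule X(4)) (use z' in \<open>auto simp: q_def\<close>)
    ultimately have 1: "(deriv ^^ q) (\<lambda>z. deriv f z / f z) z = ?t \<sigma> + (deriv ^^ q) S z"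
      by (rule has_sum_unique[rotated])
    have 2: "(deriv ^^ q) E z = ?t \<sigma>"
      using higher_deriv_partial_fractions[of "{\<sigma>}" z q "\<lambda>_. of_int (n \<sigma>)"] z' by (simp add: E_def[abs_def])
    have "(deriv ^^ q) D z = (deriv ^^ q) (\<lambda>z. deriv f z / f z) z - (deriv ^^ q) (\<lambda>z. E z + S z) z"
      unfolding D_def[abs_def] by (rule higher_deriv_diff[OF holL holomorphic_on_add[OF holE holS] opU z])
    also have "(deriv ^^ q) (\<lambda>z. E z + S z) z = (deriv ^^ q) E z + (deriv ^^ q) S z"
      by (rule higher_deriv_add[OF holE holS opU z])
    finally show ?thesis using 1 2 by simp
  qed
  then obtain p where p: "\<And>z. z \<in> U \<Longrightarrow> D z = poly p z"
    using higher_deriv_zero_imp_poly[OF holD opU conU] by metis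
  obtain Q0 where Q0: "pderiv Q0 = p" using pderiv_surj by blast
  define W where "W z = (z - \<sigma>) powi n \<sigma> * exp (poly Q0 z) * P z" for z
  have WU: "W z \<noteq> 0" "(W has_field_derivative deriv f z / f z * W z) (at z)" if z: "z \<in> U" for z
  proof -
    have nz: "z - \<sigma> \<noteq> 0" using z by (auto simp: U_def)
    then show "W z \<noteq> 0" using PU(1)[OF z] by (auto simp: W_def)
    have d1: "((\<lambda>z. (z - \<sigma>) powi n \<sigma>) has_field_derivative of_int (n \<sigma>) * (z - \<sigma>) powi (n \<sigma> - 1) * 1) (at z)"
      by (rule DERIV_power_int) (use nz in \<open>auto intro!: derivative_eq_intros\<close>)
    have d2: "((\<lambda>z. exp (poly Q0 z)) has_field_derivative exp (poly Q0 z) * poly p z) (at z)"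
      by (rule DERIV_fun_exp) (use poly_DERIV[of Q0 z] in \<open>simp add: Q0\<close>)
    have "(W has_field_derivative
       (of_int (n \<sigma>) * (z - \<sigma>) powi (n \<sigma> - 1) * 1 * exp (poly Q0 z) + exp (poly Q0 z) * poly p z * (z - \<sigma>) powi n \<sigma>) * P z
       + P z * S z * ((z - \<sigma>) powi n \<sigma> * exp (poly Q0 z))) (at z)"
      unfolding W_def[abs_def] by (rule DERIV_mult[OF DERIV_mult[OF d1 d2] PU(2)[OF z]])
    moreover have "(z - \<sigma>) powi (n \<sigma> - 1) = (z - \<sigma>) powi n \<sigma> / (z - \<sigma>)"
      using nz by (simp add: power_int_diff)
    moreover have "(i * (x / y) * 1 * e + e * a * x) * b + b * c * (x * e) = (i / y + a + c) * (x * e * b)" for i x y e a b c :: complex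
      by (simp add: algebra_simps)
    moreover have "deriv f z / f z = E z + poly p z + S z" using p[OF z] by (simp add: D_def algebra_simps)
    ultimately show "(W has_field_derivative deriv f z / f z * W z) (at z)"
      by (simp only: E_def W_def)
  qed
  \<comment> \<open>f and W have the same logarithmic derivative on the connected set U, so their
    quotient is a constant; it is nonzero and is absorbed into the constant term of the
    polynomial.\<close>
  have "((\<lambda>z. f z / W z) has_field_derivative 0) (at z)" if z: "z \<in> U" for z
    by (rule DERIV_cong[OF DERIV_divide[OF holomorphic_derivI[OF holf opU z] WU(2)[OF z] WU(1)[OF z]]])
       (use fU[OF z] in simp)
  then obtain c where c: "\<And>z. z \<in> U \<Longrightarrow> f z / W z = c"
    by (rule_tac DERIV_zero_connected_constant[OF conU opU finite.emptyI, of "\<lambda>z. f z / W z"])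
       (auto intro!: continuous_at_imp_continuous_on dest: DERIV_isCont)
  have "uncountable U"
  proof
    assume "countable U"
    then have "countable (U \<union> insert \<sigma> X)" using X(2) by auto
    moreover have "U \<union> insert \<sigma> X = UNIV" by (auto simp: U_def)
    ultimately show False using uncountable_UNIV_complex by metis
  qed
  then obtain z0 where z0: "z0 \<in> U" by (metis countable_empty equals0I)
  have "c \<noteq> 0" using c[OF z0] fU[OF z0] WU(1)[OF z0] by auto
  then obtain c0 where c0: "exp c0 = c" by (metis exp_Ln)
  show ?thesis
  proof (rule that[of "insert \<sigma> X" "Q0 + [:c0:]"])
    show "countable (insert \<sigma> X)" using X by simp
    fix s assume "s \<notin> insert \<sigma> X"
    then have s: "s \<in> U" by (simp add: U_def)
    have "f s = c * W s" using c[OF s] WU(1)[OF s] by (simp add: field_simps)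
    then show "f s = (s - \<sigma>) powi zorder f \<sigma> * exp (poly (Q0 + [:c0:]) s) * P s"
      by (simp add: W_def n_def exp_add c0 mult_ac)
  qed
qed

section \<open>From the complement of a countable set to all points that are not poles\<close>

lemma at_within_compl_countable:
  assumes "countable (X :: complex set)"
  shows "at s within - X \<noteq> bot"
  unfolding trivial_limit_within islimpt_approachable not_not
proof (intro allI impI)
  fix e :: real assume "0 < e"
  have "countable (insert s X)" using assms by simp
  then have "\<not> ball s e \<subseteq> insert s X"
    using uncountable_ball[OF \<open>0 < e\<close>, of s] countable_subset[of "ball s e" "insert s X"] by auto
  then show "\<exists>x'\<in>- X. x' \<noteq> s \<and> dist x' s < e" by (auto simp: dist_commute)
qed

text \<open>At points of order 0 the identity extends by continuity, since a countable set has dense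
  complement. At a zero both sides are 0: through the power of s - \<sigma> if s = \<sigma>, through
  the infinite product otherwise.\<close>

theorem hadamard_factorization_exists:
  assumes f: "meromorphic_finite_order f" "\<not> f constant_on UNIV" and d: "conv_exponent f = Suc m"
  shows "\<exists>Q. hadamard_factorization f m \<sigma> Q"
proof -
  define n where "n = zorder f"
  have nic: "f nicely_meromorphic_on UNIV" using f(1) by (simp add: meromorphic_finite_order_def)
  interpret canonical_product n m \<sigma>
    by unfold_locales (use conv_exponent_summable[OF f, of \<sigma>] in \<open>simp add: d n_def\<close>)
  obtain P where P: "\<And>s. ((\<lambda>A. \<Prod>\<rho>\<in>A. factor \<rho> s) \<longlongrightarrow> P s) (finite_subsets_at_top (- {\<sigma>}))"
    "\<And>s. n s = 0 \<or> s = \<sigma> \<Longrightarrow> P s \<noteq> 0"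
    "\<And>s. n s = 0 \<or> s = \<sigma> \<Longrightarrow> (P has_field_derivative P s * (\<Sum>\<^sub>\<infinity>\<rho>\<in>- {\<sigma>}. lfactor \<rho> s)) (at s)"
    by (rule canonical_product_exists) (rule that)
  obtain Q X where QX: "countable X" "\<And>s. s \<notin> X \<Longrightarrow> f s = (s - \<sigma>) powi zorder f \<sigma> * exp (poly Q s) * P s"
    by (rule Hadamard_log_form[OF f d P(2,3)[unfolded n_def]], assumption, assumption) (rule that)
  have "f s = (s - \<sigma>) powi n \<sigma> * exp (poly Q s) * P s" if np: "\<not> is_pole f s" for s
  proof -
    have an: "f analytic_on {s}" using nicely_meromorphic_on_imp_analytic_at[OF nic _ np] by simp
    have ev: "eventually (\<lambda>z. f z \<noteq> 0) (at s)"
    proof -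
      have "\<not> (\<forall>x\<in>UNIV. f x = 0)" using f(2) by (auto simp: constant_on_def)
      then have "\<forall>\<^sub>F z in cosparse UNIV. f z \<noteq> 0"
        using nicely_meromorphic_imp_constant_or_avoid[OF nic open_UNIV connected_UNIV, of 0] by blast
      then show ?thesis by (simp add: eventually_cosparse_open_eq)
    qed
    then have nn: "n s \<ge> 0" "n s = 0 \<longleftrightarrow> f s \<noteq> 0"
      using zorder_ge_0[OF an eventually_frequently[OF _ ev]] zorder_eq_0_iff[OF an eventually_frequently[OF _ ev]]
      by (auto simp: n_def)
    show ?thesis
    proof (cases "n s = 0")
      case True
      have cf: "isCont f s" using an by (rule analytic_at_imp_isCont)
      have cP: "isCont P s" using P(3)[of s] True DERIV_isCont by blast
      have c1: "isCont (\<lambda>z. (z - \<sigma>) powi n \<sigma>) s"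
      proof (cases "s = \<sigma>")
        case False
        have "((\<lambda>z. z - \<sigma>) has_field_derivative 1) (at s)" by (auto intro!: derivative_eq_intros)
        from DERIV_power_int[OF this, of "n \<sigma>"] False show ?thesis by (auto dest: DERIV_isCont)
      qed (use True in simp)
      have c2: "isCont (\<lambda>s. exp (poly Q s)) s" by (intro continuous_intros)
      have "isCont (\<lambda>s. (s - \<sigma>) powi n \<sigma> * exp (poly Q s) * P s) s"
        by (intro isCont_mult c1 c2 cP)
      then have 1: "((\<lambda>s. (s - \<sigma>) powi n \<sigma> * exp (poly Q s) * P s) \<longlongrightarrow> (s - \<sigma>) powi n \<sigma> * exp (poly Q s) * P s) (at s within - X)"
        unfolding isCont_def by (rule tendsto_within_subset) simp
      have "(f \<longlongrightarrow> f s) (at s within - X)" using cf unfolding isCont_def by (rule tendsto_within_subset) simp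
      then have "((\<lambda>s. (s - \<sigma>) powi n \<sigma> * exp (poly Q s) * P s) \<longlongrightarrow> f s) (at s within - X)"
        by (rule Lim_transform_eventually) (auto simp: eventually_at_filter QX(2) n_def)
      from tendsto_unique[OF at_within_compl_countable[OF QX(1)] this 1] show ?thesis .
    next
      case False
      then have fs: "f s = 0" using nn by simp
      show ?thesis
      proof (cases "s = \<sigma>")
        case True
        then show ?thesis using False fs by simp
      next
        case s: False
        \<comment> \<open>As soon as A contains s, the partial product has the factor E_m(1) = 0
          raised to a nonzero power.\<close>
        have "eventually (\<lambda>A. (\<Prod>\<rho>\<in>A. factor \<rho> s) = 0) (finite_subsets_at_top (- {\<sigma>}))"
          unfolding eventually_finite_subsets_at_top
        proof (intro exI[of _ "{s}"] conjI allI impI)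
          fix A assume A: "finite A \<and> {s} \<subseteq> A \<and> A \<subseteq> - {\<sigma>}"
          have "factor s s = 0" using s False by simp
          then show "(\<Prod>\<rho>\<in>A. factor \<rho> s) = 0" using A by (subst prod_zero_iff) auto
        qed (use s in auto)
        then have "((\<lambda>A. \<Prod>\<rho>\<in>A. factor \<rho> s) \<longlongrightarrow> 0) (finite_subsets_at_top (- {\<sigma>}))"
          by (rule tendsto_eventually)
        then have "P s = 0" using tendsto_unique[OF _ P(1)] by simp
        then show ?thesis using fs by simp
      qed
    qed
  qed
  then show ?thesis
    unfolding hadamard_factorization_def using P(1) by (auto simp: n_def)
qed


section \<open>The logarithmic derivative of a Dirichlet series\<close>

lemma sum_support_superset:
  assumes "finite K" "{n. k n \<noteq> 0} \<subseteq> K"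
  shows "seq_weight k = (\<Sum>n\<in>K. k n)" "frequency l k = (\<Sum>n\<in>K. l n * real (k n))"
    "(\<Prod>j | k j \<noteq> 0. fact (k j)) = (\<Prod>j\<in>K. fact (k j) :: 'a :: {semiring_char_0,comm_ring_1})"
    "(\<Prod>j | k j \<noteq> 0. a j ^ k j) = (\<Prod>j\<in>K. a j ^ k j :: 'b :: comm_ring_1)"
  unfolding seq_weight_def frequency_def
  by (rule sum.mono_neutral_left[OF assms] prod.mono_neutral_left[OF assms]; simp)+

text \<open>Differentiating log f = - \<Sum> b_k exp(-<l,k> s) brings down the frequency and cancels
  the sign. The same expression is the weighted Dirac mass at the frequency applied to exp(-s
  t).\<close>

definition log_deriv_term :: "(nat \<Rightarrow> complex) \<Rightarrow> (nat \<Rightarrow> real) \<Rightarrow> complex \<Rightarrow> (nat \<Rightarrow> nat) \<Rightarrow> complex" where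
  "log_deriv_term a l s k = of_real (frequency l k) * log_coeff a k * exp (- of_real (frequency l k) * s)"

definition lower :: "(nat \<Rightarrow> nat) \<Rightarrow> nat \<Rightarrow> nat \<Rightarrow> nat" where
  "lower k n = k(n := k n - 1)"

text \<open>The last claim is the point: apart from the factor \<open>k n\<close> its right side is
  independent of n, because lowering divides the product of powers by \<open>a n\<close> and the
  product of factorials by \<open>k n\<close>. Weight 1 is left out, as \<open>log_coeff\<close> has
  denominator 0 at the zero sequence.\<close>

lemma lower_facts:
  assumes fin: "finite {n. k n \<noteq> 0}" and "k n \<noteq> 0"
  shows "seq_weight (lower k n) = seq_weight k - 1" "frequency l (lower k n) = frequency l k - l n"
    "{j. lower k n j \<noteq> 0} \<subseteq> {j. k j \<noteq> 0}"
    "seq_weight k \<ge> 2 \<Longrightarrow> a n * log_coeff a (lower k n) =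
      (-1) ^ (seq_weight k - 1) * fact (seq_weight k - 2) * of_nat (k n) *
       ((\<Prod>j | k j \<noteq> 0. a j ^ k j) / (\<Prod>j | k j \<noteq> 0. fact (k j)))"
proof -
  let ?K = "{n. k n \<noteq> 0}"
  show sub: "{j. lower k n j \<noteq> 0} \<subseteq> ?K" by (auto simp: lower_def)
  have n: "n \<in> ?K" using assms by simp
  note L = sum_support_superset[OF fin sub]
  have eq: "(\<Sum>j\<in>?K - {n}. h (lower k n j) j) = (\<Sum>j\<in>?K - {n}. h (k j) j)" for h :: "nat \<Rightarrow> nat \<Rightarrow> 'z :: comm_monoid_add"
    by (rule sum.cong) (auto simp: lower_def)
  have eqp: "(\<Prod>j\<in>?K - {n}. h (lower k n j) j) = (\<Prod>j\<in>?K - {n}. h (k j) j)" for h :: "nat \<Rightarrow> nat \<Rightarrow> 'z :: comm_monoid_mult"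
    by (rule prod.cong) (auto simp: lower_def)
  have ln: "lower k n n = k n - 1" by (simp add: lower_def)
  show w: "seq_weight (lower k n) = seq_weight k - 1"
  proof -
    have "seq_weight (lower k n) = k n - 1 + (\<Sum>j\<in>?K - {n}. k j)"
      using sum.remove[OF fin n, of "lower k n"] eq[of "\<lambda>x _. x"] L(1) by (simp only: ln)
    moreover have "seq_weight k = k n + (\<Sum>j\<in>?K - {n}. k j)"
      unfolding seq_weight_def by (rule sum.remove[OF fin n])
    ultimately show ?thesis using n by simp
  qed
  show "frequency l (lower k n) = frequency l k - l n"
  proof -
    have "frequency l (lower k n) = l n * real (k n - 1) + (\<Sum>j\<in>?K - {n}. l j * real (k j))"
      using sum.remove[OF fin n, of "\<lambda>j. l j * real (lower k n j)"] eq[of "\<lambda>x j. l j * real x"] L(2)[of l] by (simp only: ln)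
    moreover have "frequency l k = l n * real (k n) + (\<Sum>j\<in>?K - {n}. l j * real (k j))"
      unfolding frequency_def by (rule sum.remove[OF fin n])
    ultimately show ?thesis using n by (simp add: of_nat_diff algebra_simps)
  qed
  assume m: "seq_weight k \<ge> 2"
  define A where "A = (\<Prod>j | k j \<noteq> 0. a j ^ k j)"
  define F where "F = (\<Prod>j | k j \<noteq> 0. fact (k j) :: complex)"
  define A' where "A' = (\<Prod>j | lower k n j \<noteq> 0. a j ^ lower k n j)"
  define F' where "F' = (\<Prod>j | lower k n j \<noteq> 0. fact (lower k n j) :: complex)"
  have A: "A = a n * A'"
    unfolding A_def A'_def L(4) prod.remove[OF fin n] using eqp[of "\<lambda>x j. a j ^ x"] n
    by (simp add: ln power_eq_if[of _ "k n"] mult_ac)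
  have F: "F = of_nat (k n) * F'"
    unfolding F_def F'_def L(3) prod.remove[OF fin n] using eqp[of "\<lambda>x j. fact x :: complex"] n
    by (simp add: ln fact_reduce[of "k n"] mult_ac)
  have "F' \<noteq> 0" unfolding F'_def L(3) using fin by simp
  obtain w where w2: "seq_weight k = Suc (Suc w)" using m by (metis add_2_eq_Suc le_Suc_ex)
  show "a n * log_coeff a (lower k n) =
      (-1) ^ (seq_weight k - 1) * fact (seq_weight k - 2) * of_nat (k n) * (A / F)"
    unfolding log_coeff_def w A'_def[symmetric] F'_def[symmetric] A F using assms(2) \<open>F' \<noteq> 0\<close>
    by (simp add: w2 fact_reduce[of "Suc w"] field_simps del: of_nat_Suc)
qed

text \<open>The recursion that \<open>f' = (f'/f) \<cdot> f\<close> predicts for the terms of \<open>f'/f\<close>. Deriving the expansion from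
  it makes the multinomial theorem and the branch of the logarithm superfluous.\<close>

lemma log_deriv_term_recursion:
  assumes fin: "finite {n. k n \<noteq> 0}" and m: "seq_weight k \<ge> 2"
  shows "log_deriv_term a l s k =
    - (\<Sum>n | k n \<noteq> 0. (a n * exp (- of_real (l n) * s)) * log_deriv_term a l s (lower k n))"
proof -
  obtain w where w: "seq_weight k = Suc (Suc w)" using m by (metis add_2_eq_Suc le_Suc_ex)
  define A where "A = (\<Prod>j | k j \<noteq> 0. a j ^ k j) / (\<Prod>j | k j \<noteq> 0. fact (k j))"
  define C where "C = (-1) ^ Suc w * fact w * A * exp (- of_real (frequency l k) * s)"
  have "(a n * exp (- of_real (l n) * s)) * log_deriv_term a l s (lower k n) =
      C * (of_real (frequency l k - l n) * of_nat (k n))" if "k n \<noteq> 0" for n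
  proof -
    note L = lower_facts[OF fin that]
    have "exp (- of_real (l n) * s) * exp (- of_real (frequency l k - l n) * s) = exp (- of_real (frequency l k) * s)"
      by (simp add: mult_exp_exp algebra_simps)
    moreover have "a n * log_coeff a (lower k n) = (-1) ^ Suc w * fact w * of_nat (k n) * A"
      using L(4)[OF m, of a] by (simp add: w A_def)
    moreover have "(an * e1) * (fr * lc * e2) = fr * (an * lc) * (e1 * e2)" for an e1 fr lc e2 :: complex
      by (simp add: mult_ac)
    ultimately have "(a n * exp (- of_real (l n) * s)) * log_deriv_term a l s (lower k n) =
        of_real (frequency l k - l n) * ((-1) ^ Suc w * fact w * of_nat (k n) * A) * exp (- of_real (frequency l k) * s)"
      unfolding log_deriv_term_def L(2) by (simp only:)
    then show ?thesis unfolding C_def by (simp only: mult_ac)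
  qed
  then have "(\<Sum>n | k n \<noteq> 0. (a n * exp (- of_real (l n) * s)) * log_deriv_term a l s (lower k n)) =
      (\<Sum>n | k n \<noteq> 0. C * (of_real (frequency l k - l n) * of_nat (k n)))" by simp
  \<comment> \<open>The multiplicities add up to the weight and the terms l n * k n to the
    frequency, so the sum collapses to the frequency times (weight - 1); that factor cancels a
    denominator of the factorial.\<close>
  also have "\<dots> = C * (of_real (frequency l k) * (\<Sum>n | k n \<noteq> 0. of_nat (k n)) - of_real (\<Sum>n | k n \<noteq> 0. l n * real (k n)))"
    by (simp add: sum_distrib_left[symmetric] sum_subtractf left_diff_distrib)
  also have "\<dots> = C * (of_real (frequency l k) * of_nat (seq_weight k) - of_real (frequency l k))"
    by (simp add: seq_weight_def frequency_def)
  also have "\<dots> = C * of_real (frequency l k) * of_nat (Suc w)" by (simp add: w algebra_simps)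
  finally show ?thesis
    by (simp add: log_deriv_term_def log_coeff_def w C_def A_def field_simps del: of_nat_Suc)
qed

section \<open>Cauchy products over multi-indices\<close>

lemma has_sum_product_nonneg:
  fixes F :: "'a \<Rightarrow> real" and G :: "'b \<Rightarrow> real"
  assumes "(F has_sum a) A" "(G has_sum b) B" "\<And>x. x \<in> A \<Longrightarrow> 0 \<le> F x" "\<And>y. y \<in> B \<Longrightarrow> 0 \<le> G y"
  shows "((\<lambda>(x, y). F x * G y) has_sum a * b) (A \<times> B)"
proof -
  have 1: "((\<lambda>y. F x * G y) has_sum F x * b) B" for x
    by (rule has_sum_cmult_right[OF assms(2)])
  have 2: "((\<lambda>x. F x * b) has_sum a * b) A"
    by (rule has_sum_cmult_left[OF assms(1)])
  have summ: "(\<lambda>(x, y). F x * G y) summable_on A \<times> B"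
    by (rule summable_on_SigmaI[where g = "\<lambda>x. F x * b"])
       (use 1 2 assms in \<open>auto intro: has_sum_imp_summable\<close>)
  have "infsum (\<lambda>(x, y). F x * G y) (A \<times> B) = infsum (\<lambda>x. infsum (\<lambda>y. F x * G y) B) A"
    by (rule infsum_Sigma'_banach[symmetric, OF summ])
  also have "\<dots> = infsum (\<lambda>x. F x * b) A" using 1 by (intro infsum_cong infsumI)
  also have "\<dots> = a * b" using 2 by (rule infsumI)
  finally show ?thesis using summ by (simp add: has_sum_infsum has_sum_iff)
qed

lemma has_sum_product_complex:
  fixes f :: "'a \<Rightarrow> complex" and g :: "'b \<Rightarrow> complex"
  assumes "(\<lambda>x. norm (f x)) summable_on A" "(\<lambda>y. norm (g y)) summable_on B"
  shows "((\<lambda>(x, y). f x * g y) has_sum infsum f A * infsum g B) (A \<times> B)"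
proof -
  have f: "f summable_on A" and g: "g summable_on B" using assms by (auto intro: abs_summable_summable)
  have "((\<lambda>(x, y). norm (f x) * norm (g y)) has_sum (\<Sum>\<^sub>\<infinity>x\<in>A. norm (f x)) * (\<Sum>\<^sub>\<infinity>y\<in>B. norm (g y))) (A \<times> B)"
    by (rule has_sum_product_nonneg) (use assms in auto)
  then have "(\<lambda>(x, y). norm (f x) * norm (g y)) summable_on (A \<times> B)" by (rule has_sum_imp_summable)
  then have "(\<lambda>p. norm ((\<lambda>(x, y). f x * g y) p)) summable_on (A \<times> B)"
    by (rule summable_on_cong[THEN iffD1, rotated]) (auto simp: norm_mult)
  then have summ: "(\<lambda>(x, y). f x * g y) summable_on A \<times> B" by (rule abs_summable_summable)
  have "infsum (\<lambda>(x, y). f x * g y) (A \<times> B) = infsum (\<lambda>x. infsum (\<lambda>y. f x * g y) B) A"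
    by (rule infsum_Sigma'_banach[symmetric, OF summ])
  also have "\<dots> = infsum (\<lambda>x. f x * infsum g B) A" using g by (intro infsum_cong infsum_cmult_right) auto
  also have "\<dots> = infsum f A * infsum g B" using f by (intro infsum_cmult_left) auto
  finally show ?thesis using summ by (simp add: has_sum_infsum has_sum_iff)
qed

text \<open>The weight is restricted by a predicate so that lowering by one amounts to replacing P
  by \<open>\<lambda>w. P (Suc w)\<close>; equalities, ranges and lower bounds are then treated
  alike.\<close>

definition seqs_of_weight :: "nat set \<Rightarrow> (nat \<Rightarrow> bool) \<Rightarrow> (nat \<Rightarrow> nat) set" where
  "seqs_of_weight I P = {k. {n. k n \<noteq> 0} \<subseteq> I \<and> finite {n. k n \<noteq> 0} \<and> P (seq_weight k)}"

lemma index_seqs_eq: "index_seqs I = seqs_of_weight I (\<lambda>w. 1 \<le> w)"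
  by (simp add: index_seqs_def seqs_of_weight_def)

lemma seq_weight_pos:
  assumes "finite {n. k n \<noteq> 0}" "k n \<noteq> 0"
  shows "seq_weight k \<noteq> 0"
  using assms by (auto simp: seq_weight_def)

text \<open>Turns a product of a sum over multi-indices with a sum over I into a sum over k of
  finite sums over the support of k, the shape of the recursion. The inverse raises the entry at n
  by one.\<close>

lemma bij_betw_lower:
  "bij_betw (\<lambda>(k, n). (lower k n, n)) (Sigma (seqs_of_weight I P) (\<lambda>k. {n. k n \<noteq> 0})) (seqs_of_weight I (\<lambda>w. P (Suc w)) \<times> I)"
proof (rule bij_betwI[where g = "\<lambda>(k, n). (k(n := Suc (k n)), n)"])
  have "lower k n \<in> seqs_of_weight I (\<lambda>w. P (Suc w)) \<and> n \<in> I" if k: "k \<in> seqs_of_weight I P" and n: "k n \<noteq> 0" for k n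
  proof -
    have fin: "finite {n. k n \<noteq> 0}" using k by (simp add: seqs_of_weight_def)
    note L = lower_facts[OF fin n]
    have "Suc (seq_weight k - 1) = seq_weight k" using seq_weight_pos[OF fin n] by simp
    then show ?thesis
      using k n L(1,3) finite_subset[OF L(3) fin] by (auto simp: seqs_of_weight_def simp del: neq0_conv)
  qed
  then show "(\<lambda>(k, n). (lower k n, n)) \<in> (SIGMA k:seqs_of_weight I P. {n. k n \<noteq> 0}) \<rightarrow> seqs_of_weight I (\<lambda>w. P (Suc w)) \<times> I"
    by (auto simp del: neq0_conv)
  have "k(n := Suc (k n)) \<in> seqs_of_weight I P" if k: "k \<in> seqs_of_weight I (\<lambda>w. P (Suc w))" and n: "n \<in> I" for k n
  proof -
    define k' where "k' = k(n := Suc (k n))"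
    have eq: "{j. k' j \<noteq> 0} = insert n {j. k j \<noteq> 0}" by (auto simp: k'_def)
    have fin: "finite {j. k' j \<noteq> 0}" unfolding eq using k by (simp add: seqs_of_weight_def)
    have k'n: "k' n \<noteq> 0" by (simp add: k'_def)
    have "lower k' n = k" by (auto simp: lower_def k'_def)
    then have "seq_weight k = seq_weight k' - 1" using lower_facts(1)[OF fin k'n] by simp
    then have "Suc (seq_weight k) = seq_weight k'" using seq_weight_pos[OF fin k'n] by simp
    moreover have "{j. k' j \<noteq> 0} \<subseteq> I" unfolding eq using k n by (auto simp: seqs_of_weight_def)
    ultimately have "k' \<in> seqs_of_weight I P"
      using k fin by (simp add: seqs_of_weight_def)
    then show ?thesis by (simp only: k'_def)
  qed
  then show "(\<lambda>(k, n). (k(n := Suc (k n)), n)) \<in> seqs_of_weight I (\<lambda>w. P (Suc w)) \<times> I \<rightarrow> (SIGMA k:seqs_of_weight I P. {n. k n \<noteq> 0})"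
    by auto
qed (auto simp: lower_def)

abbreviation unit_seq :: "nat \<Rightarrow> nat \<Rightarrow> nat" where
  "unit_seq n \<equiv> (\<lambda>_. 0)(n := 1)"

lemma seqs_of_weight_1: "bij_betw unit_seq I (seqs_of_weight I (\<lambda>w. w = 1))"
proof (rule bij_betw_imageI)
  show "inj_on unit_seq I"
    by (rule inj_onI) (metis fun_upd_apply zero_neq_one)
  show "unit_seq ` I = seqs_of_weight I (\<lambda>w. w = 1)"
  proof (intro equalityI subsetI)
    fix k assume "k \<in> unit_seq ` I"
    then obtain n where n: "n \<in> I" "k = unit_seq n" by auto
    then have eq: "{j. k j \<noteq> 0} = {n}" by auto
    show "k \<in> seqs_of_weight I (\<lambda>w. w = 1)" unfolding seqs_of_weight_def seq_weight_def mem_Collect_eq eq using n by simp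
  next
    fix k assume k: "k \<in> seqs_of_weight I (\<lambda>w. w = 1)"
    then have fin: "finite {j. k j \<noteq> 0}" and w1: "(\<Sum>j | k j \<noteq> 0. k j) = 1"
      by (auto simp: seqs_of_weight_def seq_weight_def)
    have "\<exists>n\<in>{j. k j \<noteq> 0}. k n = 1 \<and> (\<forall>j\<in>{j. k j \<noteq> 0}. n \<noteq> j \<longrightarrow> k j = 0)"
      by (rule sum_eq_1_iff[OF fin, THEN iffD1, OF w1])
    then obtain n where n: "n \<in> {j. k j \<noteq> 0}" "k n = 1" "\<And>j. j \<in> {j. k j \<noteq> 0} \<Longrightarrow> n \<noteq> j \<Longrightarrow> k j = 0"
      by (elim bexE conjE) (rule that; blast)
    have "k j = unit_seq n j" for j using n(2) n(3)[of j] by (cases "j = n") auto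
    then have "k = unit_seq n" by (rule ext)
    moreover have "n \<in> I" using k n(1) unfolding seqs_of_weight_def by blast
    ultimately show "k \<in> unit_seq ` I" by auto
  qed
qed

lemma log_deriv_term_unit:
  "log_deriv_term a l s (unit_seq n) = - (of_real (l n) * (a n * exp (- of_real (l n) * s)))"
proof -
  let ?k = "unit_seq n"
  have eq: "{j. ?k j \<noteq> 0} = {n}" by auto
  have "seq_weight ?k = 1" "frequency l ?k = l n" "log_coeff a ?k = - a n"
    unfolding log_coeff_def seq_weight_def frequency_def eq by simp_all
  then show ?thesis by (simp add: log_deriv_term_def)
qed

text \<open>By the recursion the norms up to weight M sum to some S_M with S_(M+1) \<le> N + A S_M,
  and N / (1 - A) is the fixed point that bounds them all. Summing the recursion itself gives U = -
  L - U X with L the sum of the l n * x n, which is f' = U f for f = 1 + X and f' = - L.\<close>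

lemma log_deriv_terms:
  fixes a :: "nat \<Rightarrow> complex" and l :: "nat \<Rightarrow> real" and s :: complex
  defines "x \<equiv> \<lambda>n. a n * exp (- of_real (l n) * s)" and "u \<equiv> log_deriv_term a l s"
  assumes x: "(\<lambda>n. norm (x n)) summable_on I" and less: "(\<Sum>\<^sub>\<infinity>n\<in>I. norm (x n)) < 1"
    and lx: "(\<lambda>n. norm (of_real (l n) * x n)) summable_on I"
  shows "(\<lambda>k. norm (u k)) summable_on index_seqs I"
    "infsum u (index_seqs I) * (1 + infsum x I) = - (\<Sum>\<^sub>\<infinity>n\<in>I. of_real (l n) * x n)"
proof -
  define A where "A = (\<Sum>\<^sub>\<infinity>n\<in>I. norm (x n))"
  define N where "N = (\<Sum>\<^sub>\<infinity>n\<in>I. norm (of_real (l n) * x n))"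
  have A: "0 \<le> A" "A < 1" using less by (auto simp: A_def intro: infsum_nonneg)
  have N0: "0 \<le> N" by (auto simp: N_def intro: infsum_nonneg)
  have unit: "u (unit_seq n) = - (of_real (l n) * x n)" for n
    unfolding u_def x_def by (rule log_deriv_term_unit)
  have "((\<lambda>n. norm (u (unit_seq n))) has_sum N) I" unfolding unit norm_minus_cancel N_def
    by (rule has_sum_infsum[OF lx])
  then have one: "((\<lambda>k. norm (u k)) has_sum N) (seqs_of_weight I (\<lambda>w. w = 1))"
    by (rule has_sum_reindex_bij_betw[OF seqs_of_weight_1, THEN iffD1])
  have rec: "u k = - (\<Sum>n | k n \<noteq> 0. u (lower k n) * x n)" if "k \<in> seqs_of_weight I P" "\<And>w. P w \<Longrightarrow> 2 \<le> w" for k P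
    using log_deriv_term_recursion[of k a l s] that by (simp add: seqs_of_weight_def u_def x_def mult_ac)
  have fin: "finite {n. k n \<noteq> 0}" if "k \<in> seqs_of_weight I P" for k P using that by (simp add: seqs_of_weight_def)
  have main: "(\<lambda>k. norm (u k)) summable_on seqs_of_weight I (\<lambda>w. 1 \<le> w \<and> w \<le> M) \<and>
     (\<Sum>\<^sub>\<infinity>k\<in>seqs_of_weight I (\<lambda>w. 1 \<le> w \<and> w \<le> M). norm (u k)) \<le> N / (1 - A)" for M
  proof (induction M)
    case 0
    have "seqs_of_weight I (\<lambda>w. 1 \<le> w \<and> w \<le> 0) = {}" by (auto simp: seqs_of_weight_def)
    then show ?case using A N0 by simp
  next
    case (Suc M)
    let ?S1 = "seqs_of_weight I (\<lambda>w. 1 \<le> w \<and> w \<le> M)" and ?S2 = "seqs_of_weight I (\<lambda>w. 2 \<le> w \<and> w \<le> Suc M)"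
    define B where "B = (\<Sum>\<^sub>\<infinity>k\<in>?S1. norm (u k))"
    have B: "((\<lambda>k. norm (u k)) has_sum B) ?S1" "B \<le> N / (1 - A)" using Suc by (auto simp: B_def)
    have "((\<lambda>(k, n). norm (u k) * norm (x n)) has_sum B * A) (?S1 \<times> I)"
      by (rule has_sum_product_nonneg[OF B(1)]) (use x in \<open>auto simp: A_def\<close>)
    moreover have "seqs_of_weight I (\<lambda>w. 2 \<le> Suc w \<and> Suc w \<le> Suc M) = ?S1" by (simp add: seqs_of_weight_def)
    ultimately have "((\<lambda>(k, n). norm (u k) * norm (x n)) has_sum B * A) (seqs_of_weight I (\<lambda>w. 2 \<le> Suc w \<and> Suc w \<le> Suc M) \<times> I)"
      by (simp only:)
    from has_sum_reindex_bij_betw[OF bij_betw_lower[of I "\<lambda>w. 2 \<le> w \<and> w \<le> Suc M"], THEN iffD2, OF this]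
    have "((\<lambda>(k, n). norm (u (lower k n)) * norm (x n)) has_sum B * A) (Sigma ?S2 (\<lambda>k. {n. k n \<noteq> 0}))"
      by (simp only: case_prod_unfold fst_conv snd_conv)
    then have v: "((\<lambda>k. \<Sum>n | k n \<noteq> 0. norm (u (lower k n)) * norm (x n)) has_sum B * A) ?S2"
      by (rule has_sum_SigmaD) (use fin in \<open>auto intro!: has_sum_finite simp del: neq0_conv\<close>)
    have le: "norm (u k) \<le> (\<Sum>n | k n \<noteq> 0. norm (u (lower k n)) * norm (x n))" if "k \<in> ?S2" for k
    proof -
      have "norm (u k) = norm (\<Sum>n | k n \<noteq> 0. u (lower k n) * x n)" using rec[OF that] by simp
      also have "\<dots> \<le> (\<Sum>n | k n \<noteq> 0. norm (u (lower k n) * x n))" by (rule norm_sum)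
      finally show ?thesis by (simp add: norm_mult)
    qed
    have s2: "(\<lambda>k. norm (u k)) summable_on ?S2"
      by (rule summable_on_comparison_test[OF has_sum_imp_summable[OF v] le]) auto
    have "(\<Sum>\<^sub>\<infinity>k\<in>?S2. norm (u k)) \<le> B * A"
      unfolding infsumI[OF v, symmetric] by (rule infsum_mono[OF s2 has_sum_imp_summable[OF v] le])
    also have "\<dots> \<le> N / (1 - A) * A" using B(2) A by (intro mult_right_mono)
    finally have i2: "(\<Sum>\<^sub>\<infinity>k\<in>?S2. norm (u k)) \<le> N / (1 - A) * A" .
    have eq: "seqs_of_weight I (\<lambda>w. 1 \<le> w \<and> w \<le> Suc M) = seqs_of_weight I (\<lambda>w. w = 1) \<union> ?S2"
      by (auto simp: seqs_of_weight_def)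
    have disj: "seqs_of_weight I (\<lambda>w. w = 1) \<inter> ?S2 = {}" by (auto simp: seqs_of_weight_def)
    have hs: "((\<lambda>k. norm (u k)) has_sum N + (\<Sum>\<^sub>\<infinity>k\<in>?S2. norm (u k))) (seqs_of_weight I (\<lambda>w. 1 \<le> w \<and> w \<le> Suc M))"
      unfolding eq by (rule has_sum_Un_disjoint[OF one has_sum_infsum[OF s2] disj])
    have "N + N / (1 - A) * A = N / (1 - A)" using A by (simp add: field_simps)
    then show ?case using hs i2 by (auto simp: infsumI intro: has_sum_imp_summable)
  qed
  show summ: "(\<lambda>k. norm (u k)) summable_on index_seqs I"
  proof (rule nonneg_bdd_above_summable_on)
    show "bdd_above (sum (\<lambda>k. norm (u k)) ` {F. F \<subseteq> index_seqs I \<and> finite F})"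
    proof (rule bdd_aboveI2)
      fix F assume F: "F \<in> {F. F \<subseteq> index_seqs I \<and> finite F}"
      define M where "M = Max (insert 0 (seq_weight ` F))"
      have "F \<subseteq> seqs_of_weight I (\<lambda>w. 1 \<le> w \<and> w \<le> M)" using F by (auto simp: M_def index_seqs_eq seqs_of_weight_def)
      then have "sum (\<lambda>k. norm (u k)) F \<le> (\<Sum>\<^sub>\<infinity>k\<in>seqs_of_weight I (\<lambda>w. 1 \<le> w \<and> w \<le> M). norm (u k))"
        using main[of M] F by (intro finite_sum_le_infsum) auto
      then show "sum (\<lambda>k. norm (u k)) F \<le> N / (1 - A)" using main[of M] by linarith
    qed
  qed auto
  let ?U = "infsum u (index_seqs I)" and ?X = "infsum x I" and ?S2 = "seqs_of_weight I (\<lambda>w. 2 \<le> w)"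
  have "seqs_of_weight I (\<lambda>w. 2 \<le> Suc w) = index_seqs I" by (simp add: seqs_of_weight_def index_seqs_eq)
  then have "((\<lambda>(k, n). u k * x n) has_sum ?U * ?X) (seqs_of_weight I (\<lambda>w. 2 \<le> Suc w) \<times> I)"
    using has_sum_product_complex[OF summ x] by (simp only:)
  from has_sum_reindex_bij_betw[OF bij_betw_lower[of I "\<lambda>w. 2 \<le> w"], THEN iffD2, OF this]
  have "((\<lambda>(k, n). u (lower k n) * x n) has_sum ?U * ?X) (Sigma ?S2 (\<lambda>k. {n. k n \<noteq> 0}))"
    by (simp only: case_prod_unfold fst_conv snd_conv)
  then have "((\<lambda>k. \<Sum>n | k n \<noteq> 0. u (lower k n) * x n) has_sum ?U * ?X) ?S2"
    by (rule has_sum_SigmaD) (use fin in \<open>auto intro!: has_sum_finite simp del: neq0_conv\<close>)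
  then have "((\<lambda>k. - u k) has_sum ?U * ?X) ?S2"
    by (rule has_sum_cong[THEN iffD1, rotated]) (use rec[of _ "\<lambda>w. 2 \<le> w"] in simp)
  then have 2: "(u has_sum - (?U * ?X)) ?S2" by (simp add: has_sum_uminus)
  have "(\<lambda>n. of_real (l n) * x n) summable_on I" using lx by (rule abs_summable_summable)
  then have "((\<lambda>n. u (unit_seq n)) has_sum - (\<Sum>\<^sub>\<infinity>n\<in>I. of_real (l n) * x n)) I"
    unfolding unit by (simp add: has_sum_uminus)
  then have 1: "(u has_sum - (\<Sum>\<^sub>\<infinity>n\<in>I. of_real (l n) * x n)) (seqs_of_weight I (\<lambda>w. w = 1))"
    by (rule has_sum_reindex_bij_betw[OF seqs_of_weight_1, THEN iffD1])
  have "seqs_of_weight I (\<lambda>w. w = 1) \<inter> ?S2 = {}" by (auto simp: seqs_of_weight_def)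
  moreover have "seqs_of_weight I (\<lambda>w. w = 1) \<union> ?S2 = index_seqs I" by (auto simp: seqs_of_weight_def index_seqs_eq)
  ultimately have "(u has_sum - (\<Sum>\<^sub>\<infinity>n\<in>I. of_real (l n) * x n) + - (?U * ?X)) (index_seqs I)"
    using has_sum_Un_disjoint[OF 1 2] by simp
  then have "?U = - (\<Sum>\<^sub>\<infinity>n\<in>I. of_real (l n) * x n) + - (?U * ?X)" by (rule infsumI)
  moreover have "v * (1 + y) = - c" if "v = - c + - (v * y)" for v y c :: complex
    using that by algebra
  ultimately show "?U * (1 + ?X) = - (\<Sum>\<^sub>\<infinity>n\<in>I. of_real (l n) * x n)" by blast
qed

section \<open>Expansion of f'/f in a right half-plane\<close>

lemma frequencies_bounded_below:
  fixes l :: "nat \<Rightarrow> real"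
  assumes "I = {1..} \<or> (\<exists>N. I = {1..N})" "strict_mono_on I l" "\<And>n. n \<in> I \<Longrightarrow> 0 < l n"
  obtains c where "0 < c" "\<And>n. n \<in> I \<Longrightarrow> c \<le> l n"
proof (cases "I = {}")
  case True
  then show ?thesis using that[of 1] by simp
next
  case False
  have 1: "1 \<in> I" using assms(1) False by auto
  have "l 1 \<le> l n" if "n \<in> I" for n
  proof (cases "n = 1")
    case False
    then have "1 < n" using that assms(1) by auto
    then show ?thesis using strict_mono_onD[OF assms(2) 1 that] by simp
  qed simp
  then show ?thesis using that[of "l 1"] assms(3)[OF 1] by simp
qed

lemma norm_dirichlet_term:
  "norm (a * exp (- of_real l * s)) = norm (a :: complex) * exp (- l * Re s)"
  by (simp add: norm_mult norm_exp_eq_Re)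

text \<open>Far to the right |f - 1| < 1, which gives f \<noteq> 0 and the hypotheses of
  \<open>log_deriv_terms\<close>; f' is computed termwise from uniform convergence on a disc
  contained in Re s \<ge> \<sigma>0.\<close>

lemma dirichlet_log_derivative:
  fixes I :: "nat set" and a :: "nat \<Rightarrow> complex" and l :: "nat \<Rightarrow> real" and f :: "complex \<Rightarrow> complex" and \<sigma>0 :: real
  assumes I: "I = {1..} \<or> (\<exists>N. I = {1..N})" "strict_mono_on I l" and pos: "\<And>n. n \<in> I \<Longrightarrow> 0 < l n"
    and summ: "\<And>s. Re s \<ge> \<sigma>0 \<Longrightarrow> (\<lambda>n. norm (a n * exp (- of_real (l n) * s))) summable_on I"
    and f: "\<And>s. Re s \<ge> \<sigma>0 \<Longrightarrow> f s = 1 + (\<Sum>\<^sub>\<infinity>n\<in>I. a n * exp (- of_real (l n) * s))"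
  obtains \<sigma>1 where "\<And>s. \<sigma>1 < Re s \<Longrightarrow> f analytic_on {s} \<and> f s \<noteq> 0"
    "\<And>s. \<sigma>1 < Re s \<Longrightarrow> (\<lambda>k. norm (log_deriv_term a l s k)) summable_on index_seqs I"
    "\<And>s. \<sigma>1 < Re s \<Longrightarrow> deriv f s / f s = infsum (log_deriv_term a l s) (index_seqs I)"
proof -
  obtain c where c: "0 < c" "\<And>n. n \<in> I \<Longrightarrow> c \<le> l n"
    using frequencies_bounded_below[OF I pos] by metis
  define B where "B n = norm (a n) * exp (- l n * \<sigma>0)" for n
  have B: "B summable_on I" using summ[of "of_real \<sigma>0"] unfolding norm_dirichlet_term B_def by simp
  have B0: "0 \<le> B n" for n by (simp add: B_def)
  define S where "S = infsum B I"
  have S: "0 \<le> S" unfolding S_def using B0 by (auto intro: infsum_nonneg)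
  have xB: "norm (a n * exp (- of_real (l n) * s)) = B n * exp (- l n * (Re s - \<sigma>0))" for n s
    unfolding norm_dirichlet_term B_def by (simp add: mult_exp_exp mult.assoc algebra_simps)
  have xB1: "norm (a n * exp (- of_real (l n) * s)) \<le> B n" if "\<sigma>0 \<le> Re s" "n \<in> I" for n s
    unfolding xB using that pos[OF that(2)] B0[of n] by (simp add: mult_left_le)
  \<comment> \<open>The surplus (S + 1) / c over \<sigma>0 together with l n \<ge> c shrinks the sum
    of norms to at most S exp(-(S + 1)), which is below 1.\<close>
  define \<sigma>1 where "\<sigma>1 = \<sigma>0 + (S + 1) / c"
  have \<sigma>1: "\<sigma>0 < \<sigma>1" using S c by (simp add: \<sigma>1_def)
  have "(f analytic_on {s} \<and> f s \<noteq> 0) \<and> (\<lambda>k. norm (log_deriv_term a l s k)) summable_on index_seqs I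
     \<and> deriv f s / f s = infsum (log_deriv_term a l s) (index_seqs I)" if s: "\<sigma>1 < Re s" for s
  proof -
    define x where "x = (\<lambda>n. a n * exp (- of_real (l n) * s))"
    have x: "(\<lambda>n. norm (x n)) summable_on I" unfolding x_def by (rule summ) (use s \<sigma>1 in simp)
    have "(\<Sum>\<^sub>\<infinity>n\<in>I. norm (x n)) \<le> (\<Sum>\<^sub>\<infinity>n\<in>I. B n * exp (- (S + 1)))"
    proof (rule infsum_mono[OF x summable_on_cmult_left[OF B]])
      fix n assume n: "n \<in> I"
      have "S + 1 = c * (\<sigma>1 - \<sigma>0)" using c by (simp add: \<sigma>1_def)
      also have "\<dots> \<le> l n * (Re s - \<sigma>0)" using c(1) c(2)[OF n] s \<sigma>1 by (intro mult_mono) auto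
      finally show "norm (x n) \<le> B n * exp (- (S + 1))"
        unfolding x_def xB using B0 by (intro mult_left_mono) auto
    qed
    also have "\<dots> = S * exp (- (S + 1))" unfolding S_def by (rule infsum_cmult_left) (use B in simp)
    also have "\<dots> < 1"
    proof -
      have "S < exp (S + 1)" using exp_ge_add_one_self[of "S + 1"] by linarith
      then have "S / exp (S + 1) < 1" by simp
      then show ?thesis by (simp only: exp_minus divide_inverse)
    qed
    finally have less: "(\<Sum>\<^sub>\<infinity>n\<in>I. norm (x n)) < 1" .
    \<comment> \<open>As x \<le> exp x, the unbounded factor l n is paid for by the surplus decay Re
      s - \<sigma>0 > 0.\<close>
    have lx: "(\<lambda>n. norm (of_real (l n) * x n)) summable_on I"
    proof (rule summable_on_comparison_test[OF summable_on_cmult_left[OF B, of "1 / (Re s - \<sigma>0)"]])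
      fix n assume n: "n \<in> I"
      let ?\<delta> = "Re s - \<sigma>0"
      have \<delta>: "?\<delta> > 0" using s \<sigma>1 by simp
      have "l n * ?\<delta> \<le> exp (l n * ?\<delta>)" using exp_ge_add_one_self[of "l n * ?\<delta>"] by linarith
      then have "l n / exp (l n * ?\<delta>) \<le> 1 / ?\<delta>" using \<delta> by (simp add: divide_le_eq le_divide_eq mult.commute)
      then have "l n * exp (- l n * ?\<delta>) \<le> 1 / ?\<delta>" by (simp add: exp_minus divide_inverse)
      from mult_left_mono[OF this B0[of n]] have "B n * (l n * exp (- l n * ?\<delta>)) \<le> B n * (1 / ?\<delta>)" .
      then show "norm (of_real (l n) * x n) \<le> B n * (1 / ?\<delta>)"
        unfolding norm_mult[of "of_real (l n)"] x_def xB using pos[OF n] by (simp add: mult.left_commute)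
    qed auto
    note log_terms = log_deriv_terms[of a l s I, OF x[unfolded x_def] less[unfolded x_def] lx[unfolded x_def]]
    have t2: "infsum (log_deriv_term a l s) (index_seqs I) * (1 + infsum x I) = - (\<Sum>\<^sub>\<infinity>n\<in>I. of_real (l n) * x n)"
      unfolding x_def by (rule log_terms(2))
    have X: "norm (infsum x I) < 1" using norm_infsum_bound[OF x] less by linarith
    have fs: "f s = 1 + infsum x I" unfolding x_def by (rule f) (use s \<sigma>1 in simp)
    then have nz: "f s \<noteq> 0" using X by (metis add_eq_0_iff norm_minus_cancel norm_one order_less_irrefl)
    define r where "r = Re s - \<sigma>0"
    have r: "r > 0" using s \<sigma>1 by (simp add: r_def)
    have Re: "\<sigma>0 \<le> Re w" if "w \<in> cball s r" for w
      using that complex_Re_le_cmod[of "s - w"] by (simp add: r_def dist_norm)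
    define G where "G w = (\<Sum>\<^sub>\<infinity>n\<in>I. a n * exp (- of_real (l n) * w))" for w
    have ul: "uniform_limit (cball s r) (\<lambda>A w. \<Sum>n\<in>A. a n * exp (- of_real (l n) * w)) G (finite_subsets_at_top I)"
      unfolding G_def by (rule Weierstrass_m_test_general[OF _ B]) (use xB1 Re in blast)
    have ev: "\<forall>\<^sub>F A in finite_subsets_at_top I. continuous_on (cball s r) (\<lambda>w. \<Sum>n\<in>A. a n * exp (- of_real (l n) * w)) \<and>
        (\<lambda>w. \<Sum>n\<in>A. a n * exp (- of_real (l n) * w)) holomorphic_on ball s r"
      by (intro always_eventually allI conjI continuous_intros holomorphic_intros)
    have holG: "G holomorphic_on ball s r"
      by (rule holomorphic_uniform_limit[OF ev ul]) auto
    have ball: "s \<in> ball s r" "ball s r \<subseteq> cball s r" using r by auto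
    have "((\<lambda>A. (deriv ^^ 1) (\<lambda>w. \<Sum>n\<in>A. a n * exp (- of_real (l n) * w)) s) \<longlongrightarrow> (deriv ^^ 1) G s) (finite_subsets_at_top I)"
      by (rule higher_deriv_complex_uniform_limit[OF uniform_limit_on_subset[OF ul ball(2)] _ _ open_ball ball(1)])
         (use ev in \<open>auto elim: eventually_mono\<close>)
    moreover have "(deriv ^^ 1) (\<lambda>w. \<Sum>n\<in>A. a n * exp (- of_real (l n) * w)) s = (\<Sum>n\<in>A. - (of_real (l n) * x n))" for A
    proof -
      have "((\<lambda>w. a n * exp (- of_real (l n) * w)) has_field_derivative - (of_real (l n) * x n)) (at s)" for n
        by (auto intro!: derivative_eq_intros simp: x_def)
      then have "((\<lambda>w. \<Sum>n\<in>A. a n * exp (- of_real (l n) * w)) has_field_derivative (\<Sum>n\<in>A. - (of_real (l n) * x n))) (at s)"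
        by (intro DERIV_sum)
      from DERIV_imp_deriv[OF this] show ?thesis by simp
    qed
    ultimately have "((\<lambda>n. - (of_real (l n) * x n)) has_sum deriv G s) I"
      by (simp add: has_sum_def)
    then have "deriv G s = (\<Sum>\<^sub>\<infinity>n\<in>I. - (of_real (l n) * x n))" by (simp add: infsumI)
    then have dG: "deriv G s = - (\<Sum>\<^sub>\<infinity>n\<in>I. of_real (l n) * x n)" by (simp only: infsum_uminus)
    have fG: "f w = 1 + G w" if "w \<in> ball s r" for w
      unfolding G_def by (rule f) (use that Re in auto)
    have "(\<lambda>w. 1 + G w) holomorphic_on ball s r" by (intro holomorphic_intros holG)
    then have "f holomorphic_on ball s r" by (rule holomorphic_transform) (simp add: fG)
    then have an: "f analytic_on {s}" using r analytic_at[of f s] centre_in_ball open_ball by blast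
    have "(f has_field_derivative deriv G s) (at s)"
    proof (rule has_field_derivative_transform_within_open[OF _ open_ball ball(1)])
      show "((\<lambda>w. 1 + G w) has_field_derivative deriv G s) (at s)"
        using holomorphic_derivI[OF holG open_ball ball(1)] by (auto intro!: derivative_eq_intros)
    qed (simp add: fG)
    then have "deriv f s = - (\<Sum>\<^sub>\<infinity>n\<in>I. of_real (l n) * x n)" unfolding dG by (rule DERIV_imp_deriv)
    then have "deriv f s / f s = infsum (log_deriv_term a l s) (index_seqs I)"
      using t2 nz unfolding fs by (metis nonzero_mult_div_cancel_right)
    then show ?thesis using an nz log_terms(1) by simp
  qed
  then show ?thesis by (intro that[of \<sigma>1]) blast+
qed


section \<open>Laplace transforms of exponential sums\<close>

lemma tendsto_exp_neg_linear:
  assumes "a < (0::real)"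
  shows "((\<lambda>t. exp (a * t)) \<longlongrightarrow> 0) at_top"
  by (rule filterlim_compose[OF exp_at_bot filterlim_tendsto_neg_mult_at_bot[OF tendsto_const assms filterlim_ident]])

lemma exp_decay_integral:
  assumes "0 < (\<delta>::real)"
  shows "integrable lborel (\<lambda>t. indicator {0..} t *\<^sub>R exp (- \<delta> * t))"
    "(\<integral>t. indicator {0..} t *\<^sub>R exp (- \<delta> * t) \<partial>lborel) = 1 / \<delta>"
proof -
  have lim: "((\<lambda>t. exp (- \<delta> * t)) \<longlongrightarrow> 0) at_top"
    by (rule tendsto_exp_neg_linear) (use assms in simp)
  have lim': "((\<lambda>t. - exp (- \<delta> * t) / \<delta>) \<longlongrightarrow> - 0 / \<delta>) at_top"
    using assms by (intro tendsto_intros lim) auto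
  have "(\<integral>\<^sup>+t. ennreal (exp (- \<delta> * t)) * indicator {0..} t \<partial>lborel) = ennreal (- 0 / \<delta> - (- exp (- \<delta> * 0) / \<delta>))"
    by (rule nn_integral_FTC_atLeast[OF _ _ _ lim']) (use assms in \<open>auto intro!: derivative_eq_intros\<close>)
  then have nn: "(\<integral>\<^sup>+t. ennreal (indicator {0..} t *\<^sub>R exp (- \<delta> * t)) \<partial>lborel) = ennreal (1 / \<delta>)"
    by (subst (asm) nn_integral_cong[where v = "\<lambda>t. ennreal (indicator {0..} t *\<^sub>R exp (- \<delta> * t))"])
       (auto simp: indicator_def)
  show "integrable lborel (\<lambda>t. indicator {0..} t *\<^sub>R exp (- \<delta> * t))"
    by (rule integrableI_nn_integral_finite[OF _ _ nn]) auto
  show "(\<integral>t. indicator {0..} t *\<^sub>R exp (- \<delta> * t) \<partial>lborel) = 1 / \<delta>"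
    by (rule integral_eq_nn_integral[THEN trans]) (use assms in \<open>auto simp: nn[simplified]\<close>)
qed

lemma half_line_integrable:
  fixes f :: "real \<Rightarrow> complex"
  assumes "0 < \<delta>" "(\<lambda>t. indicator {0..} t *\<^sub>R f t) \<in> borel_measurable borel"
    and "\<And>t. 0 \<le> t \<Longrightarrow> norm (f t) \<le> C * exp (- \<delta> * t)"
  shows "integrable lborel (\<lambda>t. indicator {0..} t *\<^sub>R f t)"
    "norm (\<integral>t. indicator {0..} t *\<^sub>R f t \<partial>lborel) \<le> C / \<delta>"
proof -
  note I = exp_decay_integral[OF assms(1)]
  have iC: "integrable lborel (\<lambda>t. C * (indicator {0..} t *\<^sub>R exp (- \<delta> * t)))"
    by (intro integrable_mult_right I)
  have le: "norm (indicator {0..} t *\<^sub>R f t) \<le> C * (indicator {0..} t *\<^sub>R exp (- \<delta> * t))" for t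
    using assms(3)[of t] by (auto simp: indicator_def)
  show int: "integrable lborel (\<lambda>t. indicator {0..} t *\<^sub>R f t)"
    by (rule Bochner_Integration.integrable_bound[OF iC]) (use assms(2) le in \<open>auto intro: order_trans[OF _ abs_ge_self]\<close>)
  have "norm (\<integral>t. indicator {0..} t *\<^sub>R f t \<partial>lborel) \<le> (\<integral>t. C * (indicator {0..} t *\<^sub>R exp (- \<delta> * t)) \<partial>lborel)"
    by (rule Bochner_Integration.integral_norm_bound_integral[OF int iC]) (rule le)
  also have "\<dots> = C / \<delta>" unfolding integral_mult_right_zero I by simp
  finally show "norm (\<integral>t. indicator {0..} t *\<^sub>R f t \<partial>lborel) \<le> C / \<delta>" .
qed

lemma half_line_FTC:
  fixes F f :: "real \<Rightarrow> complex"
  assumes "0 < \<delta>" "continuous_on UNIV f" "\<And>t. 0 \<le> t \<Longrightarrow> norm (f t) \<le> C * exp (- \<delta> * t)"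
    and F: "\<And>t. (F has_vector_derivative f t) (at t)" and lim: "(F \<longlongrightarrow> 0) at_top"
  shows "(\<integral>t. indicator {0..} t *\<^sub>R f t \<partial>lborel) = - F 0"
proof -
  have int: "integrable lborel (\<lambda>t. indicator {0..} t *\<^sub>R f t)"
    by (rule half_line_integrable[OF assms(1) _ assms(3)])
       (auto intro!: borel_measurable_continuous_on_indicator continuous_on_subset[OF assms(2)])
  have "((\<lambda>y. \<integral>t. indicator {..y} t *\<^sub>R (indicator {0..} t *\<^sub>R f t) \<partial>lborel) \<longlongrightarrow> (\<integral>t. indicator {0..} t *\<^sub>R f t \<partial>lborel)) at_top"
    by (rule tendsto_integral_at_top[OF _ int]) simp
  moreover have "((\<lambda>y. \<integral>t. indicator {..y} t *\<^sub>R (indicator {0..} t *\<^sub>R f t) \<partial>lborel) \<longlongrightarrow> 0 - F 0) at_top"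
  proof (rule Lim_transform_eventually)
    show "((\<lambda>y. F y - F 0) \<longlongrightarrow> 0 - F 0) at_top" by (intro tendsto_intros lim)
    show "\<forall>\<^sub>F y in at_top. F y - F 0 = (\<integral>t. indicator {..y} t *\<^sub>R (indicator {0..} t *\<^sub>R f t) \<partial>lborel)"
      using eventually_ge_at_top[of 0]
    proof eventually_elim
      case (elim y)
      have "(\<integral>t. indicator {0..y} t *\<^sub>R f t \<partial>lborel) = F y - F 0"
        by (rule integral_FTC_atLeastAtMost[OF elim])
           (auto intro: has_vector_derivative_at_within F continuous_on_subset[OF assms(2)])
      moreover have "(\<lambda>t. indicator {..y} t *\<^sub>R (indicator {0..} t *\<^sub>R f t)) = (\<lambda>t. indicator {0..y} t *\<^sub>R f t)"
        by (rule ext) (auto simp: indicator_def)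
      ultimately show ?case by (simp only:)
    qed
  qed
  ultimately show ?thesis using tendsto_unique[OF trivial_limit_at_top_linorder] by fastforce
qed

lemma exp_has_vector_derivative:
  "((\<lambda>t. exp (z * of_real t)) has_vector_derivative z * exp (z * of_real t)) (at t)" for z :: complex
proof -
  have "((\<lambda>t. of_real t) has_vector_derivative (1::complex)) (at t)"
    using has_vector_derivative_of_real[OF DERIV_ident] by simp
  then have "((\<lambda>t. z * of_real t) has_vector_derivative z) (at t)"
    using has_vector_derivative_mult_right[of "\<lambda>t. of_real t" 1 "at t" z] by simp
  from field_vector_diff_chain_at[OF this DERIV_exp] show ?thesis by (simp add: o_def)
qed

lemma tendsto_exp_decay:
  assumes "Re z < 0"
  shows "((\<lambda>t. exp (z * of_real t)) \<longlongrightarrow> (0::complex)) at_top"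
proof -
  have "((\<lambda>t. exp (Re z * t)) \<longlongrightarrow> 0) at_top" using assms by (rule tendsto_exp_neg_linear)
  then have "((\<lambda>t. norm (exp (z * of_real t))) \<longlongrightarrow> 0) at_top" by (simp add: norm_exp_eq_Re)
  then show ?thesis by (rule tendsto_norm_zero_cancel)
qed

lemma laplace_exp:
  assumes "0 < Re z"
  shows "(\<integral>t. indicator {0..} t *\<^sub>R exp (- z * of_real t) \<partial>lborel) = 1 / z"
proof -
  have nz: "z \<noteq> 0" using assms by auto
  have "(\<integral>t. indicator {0..} t *\<^sub>R exp (- z * of_real t) \<partial>lborel) = - (- (1 / z) * exp (- z * of_real 0))"
  proof (rule half_line_FTC[OF assms])
    show "continuous_on UNIV (\<lambda>t. exp (- z * of_real t))" by (intro continuous_intros)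
    show "norm (exp (- z * of_real t)) \<le> 1 * exp (- Re z * t)" for t by (simp add: norm_exp_eq_Re)
    show "((\<lambda>t. - (1 / z) * exp (- z * of_real t)) has_vector_derivative exp (- z * of_real t)) (at t)" for t
      using has_vector_derivative_mult_right[OF exp_has_vector_derivative[of "- z" t], of "- (1 / z)"] nz by simp
    show "((\<lambda>t. - (1 / z) * exp (- z * of_real t)) \<longlongrightarrow> 0) at_top"
      using tendsto_mult_right_zero[OF tendsto_exp_decay[of "- z"], of "- (1 / z)"] assms by simp
  qed
  then show ?thesis by simp
qed

lemma power_fact_le_exp:
  assumes "0 \<le> (x::real)"
  shows "x ^ d / fact d \<le> exp x"
proof -
  have "(\<Sum>n\<in>{d}. x ^ n /\<^sub>R fact n) \<le> (\<Sum>n. x ^ n /\<^sub>R fact n)"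
    by (rule sum_le_suminf[OF summable_exp_generic]) (use assms in auto)
  then show ?thesis by (simp add: exp_def divide_inverse mult.commute)
qed

text \<open>Half of the decay is spent on the power, through x^d / d! \<le> exp x at x = y t /
  2.\<close>

lemma power_exp_bound:
  assumes "0 < (y::real)" "0 \<le> t"
  shows "\<bar>t ^ d / fact d * exp (- y * t)\<bar> \<le> (2 / y) ^ d * exp (- (y / 2) * t)"
proof -
  have "(y / 2 * t) ^ d / fact d \<le> exp (y / 2 * t)" by (rule power_fact_le_exp) (use assms in simp)
  then have "(2 / y) ^ d * ((y / 2 * t) ^ d / fact d) \<le> (2 / y) ^ d * exp (y / 2 * t)"
    using assms by (intro mult_left_mono) auto
  moreover have "(2 / y) ^ d * ((y / 2 * t) ^ d / fact d) = t ^ d / fact d"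
    using assms by (simp add: power_mult_distrib[symmetric])
  ultimately have "t ^ d / fact d * exp (- y * t) \<le> (2 / y) ^ d * exp (y / 2 * t) * exp (- y * t)"
    by (intro mult_right_mono) auto
  also have "\<dots> = (2 / y) ^ d * exp (- (y / 2) * t)" by (simp add: mult_exp_exp mult.assoc)
  finally show ?thesis using assms by simp
qed

text \<open>The primitive of t^d / d! exp(-y t) that vanishes at infinity, built by integration by
  parts; minus its value at 0 is the Laplace transform.\<close>

fun power_exp_primitive :: "nat \<Rightarrow> real \<Rightarrow> real \<Rightarrow> complex" where
  "power_exp_primitive 0 y t = - (exp (- of_real y * of_real t) / of_real y)"
| "power_exp_primitive (Suc d) y t =
     (power_exp_primitive d y t - of_real t ^ Suc d / fact (Suc d) * exp (- of_real y * of_real t)) / of_real y"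

lemma power_exp_primitive:
  assumes "0 < y"
  shows "(power_exp_primitive d y has_vector_derivative of_real t ^ d / fact d * exp (- of_real y * of_real t)) (at t)"
    "(power_exp_primitive d y \<longlongrightarrow> 0) at_top" "power_exp_primitive d y 0 = - (1 / of_real y ^ Suc d)"
proof (induction d arbitrary: t)
  case 0
  { case 1 show ?case using has_vector_derivative_mult_right[OF exp_has_vector_derivative[of "- of_real y" t], of "- (1 / of_real y)"] assms
      by simp }
  { case 2 show ?case using tendsto_mult_right_zero[OF tendsto_exp_decay[of "- of_real y"], of "- (1 / of_real y)"] assms
      by simp }
  { case 3 show ?case by simp }
next
  case (Suc d)
  { case 1
    have "((\<lambda>t. of_real (t ^ Suc d / fact (Suc d)) :: complex) has_vector_derivative of_real (t ^ d / fact d)) (at t)"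
    proof (rule has_vector_derivative_of_real)
      show "((\<lambda>t. t ^ Suc d / fact (Suc d)) has_real_derivative t ^ d / fact d) (at t)"
        by (rule DERIV_cong[OF DERIV_cdivide[OF DERIV_pow]]) (simp add: field_simps del: of_nat_Suc)
    qed
    then have p: "((\<lambda>t. of_real t ^ Suc d / fact (Suc d)) has_vector_derivative (of_real t ^ d / fact d :: complex)) (at t)"
      by (simp only: of_real_divide of_real_power of_real_fact)
    let ?e = "exp (- of_real y * of_real t) :: complex" and ?p = "of_real t ^ Suc d / fact (Suc d) :: complex" and ?q = "of_real t ^ d / fact d :: complex"
    have "((\<lambda>t. (1 / of_real y) * (power_exp_primitive d y t - of_real t ^ Suc d / fact (Suc d) * exp (- of_real y * of_real t))) has_vector_derivative
       (1 / of_real y) * (?q * ?e - (?p * (- of_real y * ?e) + ?q * ?e))) (at t)"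
      by (intro has_vector_derivative_mult_right has_vector_derivative_diff Suc has_vector_derivative_mult p exp_has_vector_derivative)
    moreover have "(1 / of_real y) * (?q * ?e - (?p * (- of_real y * ?e) + ?q * ?e)) = ?p * ?e"
      using assms by (simp del: power_Suc fact_Suc)
    ultimately show ?case by (simp del: power_Suc fact_Suc)
  next
    case 2
    have "((\<lambda>t. of_real (t ^ Suc d / fact (Suc d) * exp (- y * t))) \<longlongrightarrow> (of_real 0 :: complex)) at_top"
    proof (rule tendsto_of_real, rule Lim_null_comparison)
      have "((\<lambda>t. exp (- (y / 2) * t)) \<longlongrightarrow> 0) at_top"
        by (rule tendsto_exp_neg_linear) (use assms in simp)
      then show "((\<lambda>t. (2 / y) ^ Suc d * exp (- (y / 2) * t)) \<longlongrightarrow> 0) at_top" by (rule tendsto_mult_right_zero)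
      show "\<forall>\<^sub>F t in at_top. norm (t ^ Suc d / fact (Suc d) * exp (- y * t)) \<le> (2 / y) ^ Suc d * exp (- (y / 2) * t)"
        using eventually_ge_at_top[of 0] by eventually_elim (use power_exp_bound[OF assms, of _ "Suc d"] in simp)
    qed
    then have "((\<lambda>t. of_real t ^ Suc d / fact (Suc d) * exp (- of_real y * of_real t)) \<longlongrightarrow> (0 :: complex)) at_top"
      by (simp add: exp_of_real[symmetric] del: power_Suc fact_Suc)
    from tendsto_mult_right_zero[OF tendsto_diff[OF Suc(2) this, unfolded diff_0_right], of "1 / of_real y"]
    show ?case by (simp del: power_Suc fact_Suc)
  next
    case 3
    show ?case using Suc(3) by simp
  }
qed

lemma laplace_power:
  assumes "0 < y"
  shows "integrable lborel (\<lambda>t. indicator {0..} t *\<^sub>R (of_real t ^ d / fact d * exp (- of_real y * of_real t) :: complex))"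
    "(\<integral>t. indicator {0..} t *\<^sub>R (of_real t ^ d / fact d * exp (- of_real y * of_real t)) \<partial>lborel) = (1 / of_real y ^ Suc d :: complex)"
proof -
  have cont: "continuous_on A (\<lambda>t. of_real t ^ d / fact d * exp (- of_real y * of_real t) :: complex)" for A
    by (intro continuous_intros) auto
  have y2: "0 < y / 2" using assms by simp
  have bound: "norm (of_real t ^ d / fact d * exp (- of_real y * of_real t) :: complex) \<le> (2 / y) ^ d * exp (- (y / 2) * t)" if "0 \<le> t" for t
    using power_exp_bound[OF assms that, of d] that
    by (simp add: norm_mult norm_divide norm_power norm_exp_eq_Re)
  show "integrable lborel (\<lambda>t. indicator {0..} t *\<^sub>R (of_real t ^ d / fact d * exp (- of_real y * of_real t) :: complex))"
    by (rule half_line_integrable[OF y2 _ bound]) (intro borel_measurable_continuous_on_indicator cont, simp_all)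
  show "(\<integral>t. indicator {0..} t *\<^sub>R (of_real t ^ d / fact d * exp (- of_real y * of_real t)) \<partial>lborel) = (1 / of_real y ^ Suc d :: complex)"
    using half_line_FTC[OF y2 cont bound power_exp_primitive(1,2)[OF assms]] power_exp_primitive(3)[OF assms, of d] by simp
qed

text \<open>The real parts are bounded only where the coefficient is nonzero: the index set will be
  all of \<open>- {\<sigma>}\<close>, while just the zeros and poles lie in a left
  half-plane.\<close>

locale exponential_sum =
  fixes A :: "'a set" and c w :: "'a \<Rightarrow> complex" and b :: real
  assumes summ: "(\<lambda>\<rho>. norm (c \<rho>)) summable_on A"
    and w: "\<And>\<rho>. \<rho> \<in> A \<Longrightarrow> c \<rho> \<noteq> 0 \<Longrightarrow> Re (w \<rho>) \<le> b"
begin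

definition "h t = (\<Sum>\<^sub>\<infinity>\<rho>\<in>A. c \<rho> * exp (w \<rho> * of_real t))"

definition "S = (\<Sum>\<^sub>\<infinity>\<rho>\<in>A. norm (c \<rho>))"

lemma term_bound:
  assumes "\<rho> \<in> A" "0 \<le> t"
  shows "norm (c \<rho> * exp (w \<rho> * of_real t)) \<le> norm (c \<rho>) * exp (b * t)"
proof (cases "c \<rho> = 0")
  case False
  have "Re (w \<rho>) * t \<le> b * t" using w[OF assms(1) False] assms(2) by (intro mult_right_mono)
  then show ?thesis by (simp add: norm_mult norm_exp_eq_Re mult_left_mono)
qed simp

lemma terms_summable:
  assumes "0 \<le> t"
  shows "(\<lambda>\<rho>. norm (c \<rho> * exp (w \<rho> * of_real t))) summable_on A"
  by (rule summable_on_comparison_test[OF summable_on_cmult_left[OF summ] term_bound]) (use assms in auto)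

lemma remainder_bound:
  assumes "0 \<le> t" "finite F" "F \<subseteq> A"
  shows "norm (h t - (\<Sum>\<rho>\<in>F. c \<rho> * exp (w \<rho> * of_real t))) \<le> (S - (\<Sum>\<rho>\<in>F. norm (c \<rho>))) * exp (b * t)"
proof -
  let ?f = "\<lambda>\<rho>. c \<rho> * exp (w \<rho> * of_real t)"
  have fA: "?f summable_on A" by (rule abs_summable_summable[OF terms_summable[OF assms(1)]])
  have sF: "(\<lambda>\<rho>. norm (c \<rho>)) summable_on A - F" by (rule summable_on_subset[OF summ]) auto
  have tF: "(\<lambda>\<rho>. norm (?f \<rho>)) summable_on A - F" by (rule summable_on_subset[OF terms_summable[OF assms(1)]]) auto
  have "h t - sum ?f F = infsum ?f (A - F)"
    unfolding h_def using infsum_Diff[OF fA _ assms(3)] assms(2) by simp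
  then have "norm (h t - sum ?f F) \<le> (\<Sum>\<^sub>\<infinity>\<rho>\<in>A - F. norm (?f \<rho>))"
    using norm_infsum_bound[OF tF] by simp
  also have "\<dots> \<le> (\<Sum>\<^sub>\<infinity>\<rho>\<in>A - F. norm (c \<rho>) * exp (b * t))"
    by (rule infsum_mono[OF tF summable_on_cmult_left[OF sF]]) (use term_bound assms in auto)
  also have "\<dots> = (\<Sum>\<^sub>\<infinity>\<rho>\<in>A - F. norm (c \<rho>)) * exp (b * t)"
    by (rule infsum_cmult_left) (use sF in simp)
  also have "(\<Sum>\<^sub>\<infinity>\<rho>\<in>A - F. norm (c \<rho>)) = S - (\<Sum>\<rho>\<in>F. norm (c \<rho>))"
    unfolding S_def using infsum_Diff[OF summ _ assms(3)] assms(2) by simp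
  finally show ?thesis .
qed

lemma h_bound: "0 \<le> t \<Longrightarrow> norm (h t) \<le> S * exp (b * t)"
  using remainder_bound[of t "{}"] by simp

text \<open>After multiplication by exp(-b t) the terms are bounded by |c \<rho>| uniformly on the
  half-line, so the series converges uniformly.\<close>

lemma h_continuous: "continuous_on {0..} h"
proof -
  have "uniform_limit {0..} (\<lambda>F t. \<Sum>\<rho>\<in>F. exp (- b * t) *\<^sub>R (c \<rho> * exp (w \<rho> * of_real t)))
     (\<lambda>t. \<Sum>\<^sub>\<infinity>\<rho>\<in>A. exp (- b * t) *\<^sub>R (c \<rho> * exp (w \<rho> * of_real t))) (finite_subsets_at_top A)"
  proof (rule Weierstrass_m_test_general[OF _ summ])
    fix \<rho> and t :: real assume "\<rho> \<in> A" "t \<in> {0..}"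
    then have "norm (exp (- b * t) *\<^sub>R (c \<rho> * exp (w \<rho> * of_real t))) \<le> exp (- b * t) * (norm (c \<rho>) * exp (b * t))"
      using term_bound[of \<rho> t] by (simp add: mult_left_mono)
    also have "\<dots> = norm (c \<rho>)" by (simp add: exp_minus)
    finally show "norm (exp (- b * t) *\<^sub>R (c \<rho> * exp (w \<rho> * of_real t))) \<le> norm (c \<rho>)" .
  qed
  then have "continuous_on {0..} (\<lambda>t. \<Sum>\<^sub>\<infinity>\<rho>\<in>A. exp (- b * t) *\<^sub>R (c \<rho> * exp (w \<rho> * of_real t)))"
    by (rule uniform_limit_theorem[rotated])
       (auto intro!: always_eventually continuous_intros)
  then have "continuous_on {0..} (\<lambda>t. exp (b * t) *\<^sub>R (\<Sum>\<^sub>\<infinity>\<rho>\<in>A. exp (- b * t) *\<^sub>R (c \<rho> * exp (w \<rho> * of_real t))))"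
    by (intro continuous_intros)
  moreover have "exp (b * t) *\<^sub>R (\<Sum>\<^sub>\<infinity>\<rho>\<in>A. exp (- b * t) *\<^sub>R (c \<rho> * exp (w \<rho> * of_real t))) = h t" for t
    by (simp add: infsum_scaleR_right h_def exp_minus)
  ultimately show ?thesis by simp
qed

text \<open>Dominated convergence concerns sequences, while the sum is a limit along finite subsets
  of an arbitrary index set. The interchange is therefore quantitative: the remainder after F has
  integral at most (S - \<Sum> over F of |c \<rho>|) / (y - b), which tends to 0 along finite
  subsets.\<close>

lemma laplace:
  assumes y: "b < y"
  shows "integrable lborel (\<lambda>t. indicator {0..} t *\<^sub>R (h t * exp (- of_real y * of_real t)))"
    "(\<integral>t. indicator {0..} t *\<^sub>R (h t * exp (- of_real y * of_real t)) \<partial>lborel) = (\<Sum>\<^sub>\<infinity>\<rho>\<in>A. c \<rho> / (of_real y - w \<rho>))"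
proof -
  have yb: "0 < y - b" using y by simp
  have meas: "(\<lambda>t. indicator {0..} t *\<^sub>R (h t * exp (- of_real y * of_real t))) \<in> borel_measurable borel"
    by (intro borel_measurable_continuous_on_indicator continuous_intros h_continuous) auto
  have nexp: "norm (exp (- of_real y * of_real t) :: complex) = exp (- y * t)" for t
    by (simp add: norm_exp_eq_Re)
  have fac: "exp (b * t) * exp (- y * t) = exp (- (y - b) * t)" for t
    by (simp add: mult_exp_exp algebra_simps)
  let ?I = "\<integral>t. indicator {0..} t *\<^sub>R (h t * exp (- of_real y * of_real t)) \<partial>lborel"
  have hb: "norm (h t * exp (- of_real y * of_real t)) \<le> S * exp (- (y - b) * t)" if "0 \<le> t" for t
    using mult_right_mono[OF h_bound[OF that], of "exp (- y * t)"] unfolding norm_mult nexp mult.assoc fac by simp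
  show int: "integrable lborel (\<lambda>t. indicator {0..} t *\<^sub>R (h t * exp (- of_real y * of_real t)))"
    by (rule half_line_integrable[OF yb meas hb])
  have ti: "integrable lborel (\<lambda>t. indicator {0..} t *\<^sub>R (c \<rho> * exp (w \<rho> * of_real t) * exp (- of_real y * of_real t)))"
    "(\<integral>t. indicator {0..} t *\<^sub>R (c \<rho> * exp (w \<rho> * of_real t) * exp (- of_real y * of_real t)) \<partial>lborel) = c \<rho> / (of_real y - w \<rho>)"
    if \<rho>: "\<rho> \<in> A" for \<rho>
  proof -
    show "integrable lborel (\<lambda>t. indicator {0..} t *\<^sub>R (c \<rho> * exp (w \<rho> * of_real t) * exp (- of_real y * of_real t)))"
    proof (rule half_line_integrable[OF yb])
      show "norm (c \<rho> * exp (w \<rho> * of_real t) * exp (- of_real y * of_real t)) \<le> norm (c \<rho>) * exp (- (y - b) * t)" if "0 \<le> t" for t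
      proof -
        have "norm (c \<rho> * exp (w \<rho> * of_real t) * exp (- of_real y * of_real t)) = norm (c \<rho> * exp (w \<rho> * of_real t)) * exp (- y * t)"
          by (simp only: norm_mult[of "c \<rho> * exp (w \<rho> * of_real t)"] nexp)
        also have "\<dots> \<le> norm (c \<rho>) * exp (b * t) * exp (- y * t)"
          by (intro mult_right_mono term_bound \<rho> that) simp
        finally show ?thesis by (simp only: mult.assoc fac)
      qed
      show "(\<lambda>t. indicator {0..} t *\<^sub>R (c \<rho> * exp (w \<rho> * of_real t) * exp (- of_real y * of_real t))) \<in> borel_measurable borel"
        by (intro borel_measurable_continuous_on_indicator continuous_intros) auto
    qed
    show "(\<integral>t. indicator {0..} t *\<^sub>R (c \<rho> * exp (w \<rho> * of_real t) * exp (- of_real y * of_real t)) \<partial>lborel) = c \<rho> / (of_real y - w \<rho>)"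
    proof (cases "c \<rho> = 0")
      case False
      have "Re (of_real y - w \<rho>) > 0" using w[OF \<rho> False] y by simp
      from laplace_exp[OF this]
      have "c \<rho> * (\<integral>t. indicator {0..} t *\<^sub>R exp (- (of_real y - w \<rho>) * of_real t) \<partial>lborel) = c \<rho> / (of_real y - w \<rho>)" by simp
      moreover have "(\<lambda>t. indicator {0..} t *\<^sub>R (c \<rho> * exp (w \<rho> * of_real t) * exp (- of_real y * of_real t))) =
          (\<lambda>t. c \<rho> * (indicator {0..} t *\<^sub>R exp (- (of_real y - w \<rho>) * of_real t)))"
      proof
        fix t
        have "exp (w \<rho> * of_real t) * exp (- of_real y * of_real t) = exp (- (of_real y - w \<rho>) * of_real t)"
          by (simp add: mult_exp_exp algebra_simps)
        then show "indicator {0..} t *\<^sub>R (c \<rho> * exp (w \<rho> * of_real t) * exp (- of_real y * of_real t)) =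
          c \<rho> * (indicator {0..} t *\<^sub>R exp (- (of_real y - w \<rho>) * of_real t))" by (simp add: mult.assoc)
      qed
      ultimately show ?thesis by (simp only: integral_mult_right_zero)
    qed simp
  qed
  have lim: "((\<lambda>F. (S - (\<Sum>\<rho>\<in>F. norm (c \<rho>))) / (y - b)) \<longlongrightarrow> (S - S) / (y - b)) (finite_subsets_at_top A)"
    using has_sum_infsum[OF summ] yb unfolding has_sum_def S_def by (intro tendsto_intros) auto
  have "((\<lambda>F. ?I - (\<Sum>\<rho>\<in>F. c \<rho> / (of_real y - w \<rho>))) \<longlongrightarrow> 0) (finite_subsets_at_top A)"
  proof (rule Lim_null_comparison)
    show "((\<lambda>F. (S - (\<Sum>\<rho>\<in>F. norm (c \<rho>))) / (y - b)) \<longlongrightarrow> 0) (finite_subsets_at_top A)" using lim by simp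
    show "\<forall>\<^sub>F F in finite_subsets_at_top A. norm (?I - (\<Sum>\<rho>\<in>F. c \<rho> / (of_real y - w \<rho>))) \<le> (S - (\<Sum>\<rho>\<in>F. norm (c \<rho>))) / (y - b)"
    proof (rule eventually_finite_subsets_at_top_weakI)
      fix F assume F: "finite F" "F \<subseteq> A"
      let ?R = "\<lambda>t. (h t - (\<Sum>\<rho>\<in>F. c \<rho> * exp (w \<rho> * of_real t))) * exp (- of_real y * of_real t)"
      have eq: "indicator {0..} t *\<^sub>R ?R t = indicator {0..} t *\<^sub>R (h t * exp (- of_real y * of_real t)) -
         (\<Sum>\<rho>\<in>F. indicator {0..} t *\<^sub>R (c \<rho> * exp (w \<rho> * of_real t) * exp (- of_real y * of_real t)))" for t
        by (simp add: left_diff_distrib sum_distrib_right scaleR_right_diff_distrib scaleR_sum_right)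
      have "(\<integral>t. indicator {0..} t *\<^sub>R ?R t \<partial>lborel) =
        ?I - (\<integral>t. (\<Sum>\<rho>\<in>F. indicator {0..} t *\<^sub>R (c \<rho> * exp (w \<rho> * of_real t) * exp (- of_real y * of_real t))) \<partial>lborel)"
        unfolding eq using F ti(1) by (intro Bochner_Integration.integral_diff int Bochner_Integration.integrable_sum) auto
      also have "(\<integral>t. (\<Sum>\<rho>\<in>F. indicator {0..} t *\<^sub>R (c \<rho> * exp (w \<rho> * of_real t) * exp (- of_real y * of_real t))) \<partial>lborel) =
        (\<Sum>\<rho>\<in>F. (\<integral>t. indicator {0..} t *\<^sub>R (c \<rho> * exp (w \<rho> * of_real t) * exp (- of_real y * of_real t)) \<partial>lborel))"
        by (rule Bochner_Integration.integral_sum) (use F ti(1) in auto)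
      also have "\<dots> = (\<Sum>\<rho>\<in>F. c \<rho> / (of_real y - w \<rho>))"
        by (rule sum.cong[OF refl ti(2)]) (use F in auto)
      finally have Req: "(\<integral>t. indicator {0..} t *\<^sub>R ?R t \<partial>lborel) = ?I - (\<Sum>\<rho>\<in>F. c \<rho> / (of_real y - w \<rho>))" .
      have "norm (\<integral>t. indicator {0..} t *\<^sub>R ?R t \<partial>lborel) \<le> (S - (\<Sum>\<rho>\<in>F. norm (c \<rho>))) / (y - b)"
      proof (rule half_line_integrable(2)[OF yb])
        show "(\<lambda>t. indicator {0..} t *\<^sub>R ?R t) \<in> borel_measurable borel"
          by (intro borel_measurable_continuous_on_indicator continuous_intros h_continuous) auto
        show "norm (?R t) \<le> (S - (\<Sum>\<rho>\<in>F. norm (c \<rho>))) * exp (- (y - b) * t)" if "0 \<le> t" for t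
          using mult_right_mono[OF remainder_bound[OF that F], of "exp (- y * t)"]
          unfolding norm_mult[of _ "exp (- of_real y * of_real t)"] nexp mult.assoc fac by simp
      qed
      then show "norm (?I - (\<Sum>\<rho>\<in>F. c \<rho> / (of_real y - w \<rho>))) \<le> (S - (\<Sum>\<rho>\<in>F. norm (c \<rho>))) / (y - b)"
        by (simp only: Req)
    qed
  qed
  then have "((\<lambda>F. ?I - (?I - (\<Sum>\<rho>\<in>F. c \<rho> / (of_real y - w \<rho>)))) \<longlongrightarrow> ?I - 0) (finite_subsets_at_top A)"
    by (intro tendsto_intros)
  then have "((\<lambda>\<rho>. c \<rho> / (of_real y - w \<rho>)) has_sum ?I) A" by (simp add: has_sum_def)
  then show "?I = (\<Sum>\<^sub>\<infinity>\<rho>\<in>A. c \<rho> / (of_real y - w \<rho>))" by (rule infsumI[symmetric])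
qed

end

text \<open>The power term has transform n / y^(d+1), which after multiplication by y^d is the
  logarithmic derivative n / y of (s - \<sigma>)^n at s = \<sigma> + y. The other terms match those
  of the canonical product one by one.\<close>

lemma newton_cramer_kernel_laplace:
  fixes f :: "complex \<Rightarrow> complex" and \<sigma> :: complex and m :: nat
  defines "d \<equiv> Suc m" and "K \<equiv> newton_cramer_kernel f (Suc m) \<sigma>"
  defines "H \<equiv> \<lambda>t. (K t - K 0) * indicator {0..} t"
  assumes summ: "(\<lambda>\<rho>. \<bar>real_of_int (zorder f \<rho>)\<bar> / norm (\<rho> - \<sigma>) ^ d) summable_on - {\<sigma>}"
    and Re: "\<And>\<rho>. zorder f \<rho> \<noteq> 0 \<Longrightarrow> Re \<rho> \<le> \<sigma>1"
  obtains C b where "0 \<le> C" "0 \<le> b" "H \<in> borel_measurable borel" "\<And>t. t < 0 \<Longrightarrow> H t = 0"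
    "\<And>t. 0 \<le> t \<Longrightarrow> norm (H t) \<le> C * exp (b * t)"
    "\<And>y. b < y \<Longrightarrow> of_real y ^ d * (\<integral>t. indicator {0..} t *\<^sub>R (H t * exp (- of_real y * of_real t)) \<partial>lborel) =
       of_int (zorder f \<sigma>) / of_real y + (\<Sum>\<^sub>\<infinity>\<rho>\<in>- {\<sigma>}. of_int (zorder f \<rho>) * hkernel m \<sigma> \<rho> (\<sigma> + of_real y))"
proof -
  define c where "c \<rho> = of_int (zorder f \<rho>) / (\<rho> - \<sigma>) ^ d" for \<rho>
  define w where "w \<rho> = \<rho> - \<sigma>" for \<rho>
  define b0 where "b0 = max 0 (\<sigma>1 - Re \<sigma>)"
  have b0: "0 \<le> b0" by (simp add: b0_def)
  interpret exponential_sum "- {\<sigma>}" c w b0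
  proof
    show "(\<lambda>\<rho>. norm (c \<rho>)) summable_on - {\<sigma>}"
      using summ by (simp add: c_def norm_divide norm_power)
    show "Re (w \<rho>) \<le> b0" if "\<rho> \<in> - {\<sigma>}" "c \<rho> \<noteq> 0" for \<rho>
      using Re[of \<rho>] that by (auto simp: c_def w_def b0_def)
  qed
  define \<nu> where "\<nu> = (of_int (zorder f \<sigma>) :: complex)"
  have K: "K t = (\<nu> * of_real t ^ d / fact d + h t) * indicator {0..} t" for t
    by (simp only: K_def newton_cramer_kernel_def d_def[symmetric] \<nu>_def h_def c_def w_def)
  \<comment> \<open>As d is positive, the power term vanishes at t = 0.\<close>
  have K0: "K 0 = h 0" by (simp add: K d_def)
  have Hpos: "H t = \<nu> * (of_real t ^ d / fact d) + h t - h 0" if "0 \<le> t" for t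
    using that unfolding H_def K0 by (simp add: K)
  have Hneg: "H t = 0" if "t < 0" for t using that by (simp add: H_def)
  have meas: "H \<in> borel_measurable borel"
  proof -
    have "(\<lambda>t. indicator {0..} t *\<^sub>R (\<nu> * (of_real t ^ d / fact d) + h t - h 0)) \<in> borel_measurable borel"
      by (intro borel_measurable_continuous_on_indicator continuous_intros h_continuous) auto
    also have "(\<lambda>t. indicator {0..} t *\<^sub>R (\<nu> * (of_real t ^ d / fact d) + h t - h 0)) = H"
      by (rule ext) (auto simp: Hpos Hneg indicator_def)
    finally show ?thesis .
  qed
  \<comment> \<open>One unit above the growth rate of the exponential sum, so that t^d / d! \<le>
    exp t fits under the same exponential.\<close>
  define b where "b = b0 + 1"
  define C where "C = norm \<nu> + 2 * S"
  have S0: "0 \<le> S" unfolding S_def by (auto intro: infsum_nonneg)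
  show ?thesis
  proof (rule that[of C b])
    show "0 \<le> C" "0 \<le> b" using S0 b0 by (auto simp: C_def b_def)
    show "H \<in> borel_measurable borel" by (rule meas)
    show "H t = 0" if "t < 0" for t by (rule Hneg[OF that])
    show "norm (H t) \<le> C * exp (b * t)" if t: "0 \<le> t" for t
    proof -
      have e1: "exp (1 * t) \<le> exp (b * t)" "exp (b0 * t) \<le> exp (b * t)" "exp (b0 * 0) \<le> exp (b * t)"
        using t b0 mult_right_mono[of 1 b t] mult_right_mono[of b0 b t] by (auto simp: b_def)
      have "norm (\<nu> * (of_real t ^ d / fact d)) = norm \<nu> * (t ^ d / fact d)"
        using t by (simp add: norm_mult norm_divide norm_power)
      also have "\<dots> \<le> norm \<nu> * exp (b * t)"
        using order_trans[OF power_fact_le_exp[OF t, of d]] e1(1) by (intro mult_left_mono) auto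
      finally have 1: "norm (\<nu> * (of_real t ^ d / fact d)) \<le> norm \<nu> * exp (b * t)" .
      have 2: "norm (h t) \<le> S * exp (b * t)"
        using h_bound[OF t] mult_left_mono[OF e1(2) S0] by linarith
      have 3: "norm (h 0) \<le> S * exp (b * t)"
        using h_bound[of 0] mult_left_mono[OF e1(3) S0] by linarith
      have "norm (H t) \<le> norm (\<nu> * (of_real t ^ d / fact d)) + norm (h t) + norm (h 0)"
        unfolding Hpos[OF t] by (meson norm_triangle_ineq norm_triangle_ineq4 add_right_mono order_trans)
      also have "\<dots> \<le> norm \<nu> * exp (b * t) + S * exp (b * t) + S * exp (b * t)" using 1 2 3 by linarith
      finally show ?thesis by (simp add: C_def algebra_simps)
    qed
    fix y assume y: "b < y"
    then have y0: "0 < y" and yb: "b0 < y" using b0 by (auto simp: b_def)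
    let ?e = "\<lambda>t. exp (- of_real y * of_real t) :: complex"
    note P = laplace_power[OF y0, of d] and L = laplace[OF yb] and Q = laplace_power[OF y0, of 0]
    have int: "integrable lborel (\<lambda>t. \<nu> * (indicator {0..} t *\<^sub>R (of_real t ^ d / fact d * ?e t)))"
      "integrable lborel (\<lambda>t. h 0 * (indicator {0..} t *\<^sub>R (of_real t ^ 0 / fact 0 * ?e t)))"
      by (intro integrable_mult_right P Q)+
    have eq: "indicator {0..} t *\<^sub>R (H t * ?e t) =
       \<nu> * (indicator {0..} t *\<^sub>R (of_real t ^ d / fact d * ?e t)) + indicator {0..} t *\<^sub>R (h t * ?e t)
       - h 0 * (indicator {0..} t *\<^sub>R (of_real t ^ 0 / fact 0 * ?e t))" for t
    proof (cases "0 \<le> t")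
      case True
      then show ?thesis unfolding Hpos[OF True] by (simp add: algebra_simps)
    qed simp
    have "(\<integral>t. indicator {0..} t *\<^sub>R (H t * ?e t) \<partial>lborel) =
       \<nu> * (1 / of_real y ^ Suc d) + (\<Sum>\<^sub>\<infinity>\<rho>\<in>- {\<sigma>}. c \<rho> / (of_real y - w \<rho>)) - h 0 * (1 / of_real y ^ Suc 0)"
      unfolding eq
      by (subst Bochner_Integration.integral_diff[OF Bochner_Integration.integrable_add[OF int(1) L(1)] int(2)],
          subst Bochner_Integration.integral_add[OF int(1) L(1)])
         (simp only: integral_mult_right_zero P(2) L(2) Q(2))
    then have LI: "of_real y ^ d * (\<integral>t. indicator {0..} t *\<^sub>R (H t * ?e t) \<partial>lborel) =
       of_real y ^ d * (\<nu> * (1 / (of_real y * of_real y ^ d)) + (\<Sum>\<^sub>\<infinity>\<rho>\<in>- {\<sigma>}. c \<rho> / (of_real y - w \<rho>)) - h 0 * (1 / of_real y ^ Suc 0))"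
      by (simp only: power_Suc)
    have h0: "h 0 = (\<Sum>\<^sub>\<infinity>\<rho>\<in>- {\<sigma>}. c \<rho>)" by (simp add: h_def)
    have I: "of_real y ^ d * (\<integral>t. indicator {0..} t *\<^sub>R (H t * ?e t) \<partial>lborel) =
       \<nu> / of_real y + of_real y ^ d * ((\<Sum>\<^sub>\<infinity>\<rho>\<in>- {\<sigma>}. c \<rho> / (of_real y - w \<rho>)) - (\<Sum>\<^sub>\<infinity>\<rho>\<in>- {\<sigma>}. c \<rho>) * (1 / of_real y))"
    proof -
      have "Yd * (v * (1 / (Y * Yd)) + a - a' * (1 / Y ^ Suc 0)) = v / Y + Yd * (a - a' * (1 / Y))" if "Y \<noteq> 0" "Yd \<noteq> 0" for v a a' Y Yd :: complex
        using that by (simp add: field_simps)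
      from this[of "of_real y" "of_real y ^ d"] y0 show ?thesis unfolding LI h0 by simp
    qed
    have sc: "c summable_on - {\<sigma>}" by (rule abs_summable_summable[OF local.summ])
    have sl: "(\<lambda>\<rho>. c \<rho> / (of_real y - w \<rho>)) summable_on - {\<sigma>}"
    proof (rule abs_summable_summable, rule Infinite_Sum.abs_summable_on_comparison_test'[OF summable_on_cmult_left[OF local.summ, of "1 / (y - b0)"]])
      fix \<rho> assume \<rho>: "\<rho> \<in> - {\<sigma>}"
      show "norm (c \<rho> / (of_real y - w \<rho>)) \<le> norm (c \<rho>) * (1 / (y - b0))"
      proof (cases "c \<rho> = 0")
        case False
        have "y - b0 \<le> Re (of_real y - w \<rho>)" using local.w[OF \<rho> False] by simp
        also have "\<dots> \<le> norm (of_real y - w \<rho>)" by (rule complex_Re_le_cmod)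
        finally show ?thesis using yb unfolding norm_divide by (simp add: frac_le)
      qed simp
    qed
    have "of_real y ^ d * ((\<Sum>\<^sub>\<infinity>\<rho>\<in>- {\<sigma>}. c \<rho> / (of_real y - w \<rho>)) - (\<Sum>\<^sub>\<infinity>\<rho>\<in>- {\<sigma>}. c \<rho>) * (1 / of_real y)) =
       (\<Sum>\<^sub>\<infinity>\<rho>\<in>- {\<sigma>}. of_real y ^ d * (c \<rho> / (of_real y - w \<rho>) - c \<rho> * (1 / of_real y)))"
      by (rule infsumI[symmetric], rule has_sum_cmult_right, rule has_sum_diff)
         (rule has_sum_infsum[OF sl], rule has_sum_cmult_left[OF has_sum_infsum[OF sc]])
    also have "\<dots> = (\<Sum>\<^sub>\<infinity>\<rho>\<in>- {\<sigma>}. of_int (zorder f \<rho>) * hkernel m \<sigma> \<rho> (\<sigma> + of_real y))"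
    proof (rule infsum_cong)
      fix \<rho> assume \<rho>: "\<rho> \<in> - {\<sigma>}"
      show "of_real y ^ d * (c \<rho> / (of_real y - w \<rho>) - c \<rho> * (1 / of_real y)) = of_int (zorder f \<rho>) * hkernel m \<sigma> \<rho> (\<sigma> + of_real y)"
      proof (cases "zorder f \<rho> = 0")
        case False
        have w0: "w \<rho> \<noteq> 0" using \<rho> by (simp add: w_def)
        have "Re (w \<rho>) < y" using local.w[OF \<rho>] w0 False yb by (auto simp: c_def w_def)
        then have "of_real y \<noteq> w \<rho>" by (metis Re_complex_of_real less_irrefl)
        then have nz: "of_real y - w \<rho> \<noteq> 0" "(of_real y :: complex) \<noteq> 0" using y0 by auto
        have hk: "hkernel m \<sigma> \<rho> (\<sigma> + of_real y) = of_real y ^ m / (w \<rho> ^ m * (of_real y - w \<rho>))"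
          by (simp add: hkernel_def w_def algebra_simps)
        have cw: "c \<rho> = of_int (zorder f \<rho>) / (w \<rho> * w \<rho> ^ m)" by (simp add: c_def w_def d_def)
        \<comment> \<open>The partial fraction 1/(y - w) - 1/y = w / ((y - w) y) cancels one power
          of y and one of w, leaving the exponent m in both.\<close>
        have "y' * ym * (n / (a * am) / (y' - a) - n / (a * am) * (1 / y')) = n * (ym / (am * (y' - a)))"
          if "a \<noteq> 0" "am \<noteq> 0" "y' - a \<noteq> 0" "y' \<noteq> 0" for y' ym n a am :: complex
        proof -
          have "1 / (y' - a) - 1 / y' = a / ((y' - a) * y')" using that by (simp add: field_simps)
          then have "n / (a * am) / (y' - a) - n / (a * am) * (1 / y') = n / (a * am) * (a / ((y' - a) * y'))"
            by (metis (no_types) right_diff_distrib times_divide_eq_right mult.right_neutral)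
          then show ?thesis using that by simp
        qed
        from this[OF w0 _ nz(1) nz(2), of "w \<rho> ^ m" "of_real y ^ m" "of_int (zorder f \<rho>)"] w0
        show ?thesis unfolding hk cw d_def by simp
      qed (simp add: c_def)
    qed
    finally show "of_real y ^ d * (\<integral>t. indicator {0..} t *\<^sub>R (H t * exp (- of_real y * of_real t)) \<partial>lborel) =
       of_int (zorder f \<sigma>) / of_real y + (\<Sum>\<^sub>\<infinity>\<rho>\<in>- {\<sigma>}. of_int (zorder f \<rho>) * hkernel m \<sigma> \<rho> (\<sigma> + of_real y))"
      unfolding I \<nu>_def by simp
  qed
qed


section \<open>Approximation of test functions by exponentials\<close>

lemma nderiv_0 [simp]: "nderiv 0 \<phi> = \<phi>" by (simp add: nderiv_def)

lemma nderiv_Suc: "nderiv (Suc j) \<phi> t = vector_derivative (nderiv j \<phi>) (at t)"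
  by (simp add: nderiv_def)

lemma nderiv_nderiv_1: "nderiv j (nderiv 1 \<phi>) = nderiv (Suc j) \<phi>"
proof (induction j)
  case (Suc j)
  show ?case by (rule ext) (simp only: nderiv_Suc[of j "nderiv 1 \<phi>"] nderiv_Suc[of "Suc j" \<phi>] Suc)
qed simp

text \<open>A candidate sequence in which each member is the derivative of its predecessor settles
  all orders together; sums, multiples and products with exponentials are treated this way.\<close>

lemma nderiv_unique:
  assumes "\<And>j t. (F j has_vector_derivative F (Suc j) t) (at t)"
  shows "nderiv j (F 0) = F j"
proof (induction j)
  case (Suc j)
  show ?case by (rule ext) (use Suc vector_derivative_at[OF assms] in \<open>simp add: nderiv_Suc\<close>)
qed simp

lemma smooth_nderivI:
  assumes "\<And>j t. (F j has_vector_derivative F (Suc j) t) (at t)"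
  shows "smooth (F 0)"
  unfolding smooth_def nderiv_unique[of F, OF assms]
  using assms by (auto intro: differentiableI_vector)

lemma smooth_has_nderiv:
  assumes "smooth \<phi>"
  shows "(nderiv j \<phi> has_vector_derivative nderiv (Suc j) \<phi> t) (at t)"
  using assms unfolding smooth_def nderiv_Suc by (simp add: vector_derivative_works)

lemma smooth_continuous: "smooth \<phi> \<Longrightarrow> continuous_on A (nderiv j \<phi>)"
  by (rule continuous_at_imp_continuous_on) (auto intro: has_vector_derivative_continuous smooth_has_nderiv)

lemma smooth_add:
  assumes "smooth \<phi>" "smooth \<psi>"
  shows "smooth (\<lambda>t. \<phi> t + \<psi> t)" "nderiv j (\<lambda>t. \<phi> t + \<psi> t) t = nderiv j \<phi> t + nderiv j \<psi> t"
proof -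
  define F where "F j t = nderiv j \<phi> t + nderiv j \<psi> t" for j t
  have F: "(F j has_vector_derivative F (Suc j) t) (at t)" for j t
    unfolding F_def by (intro has_vector_derivative_add smooth_has_nderiv assms)
  have F0: "F 0 = (\<lambda>t. \<phi> t + \<psi> t)" by (rule ext) (simp add: F_def)
  show "smooth (\<lambda>t. \<phi> t + \<psi> t)" using smooth_nderivI[of F, OF F] by (simp only: F0)
  show "nderiv j (\<lambda>t. \<phi> t + \<psi> t) t = nderiv j \<phi> t + nderiv j \<psi> t"
    using nderiv_unique[of F, OF F] by (simp add: F0 F_def)
qed

lemma smooth_cmult:
  assumes "smooth \<phi>"
  shows "smooth (\<lambda>t. c * \<phi> t)" "nderiv j (\<lambda>t. c * \<phi> t) t = c * nderiv j \<phi> t"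
proof -
  define F where "F j t = c * nderiv j \<phi> t" for j t
  have F: "(F j has_vector_derivative F (Suc j) t) (at t)" for j t
    unfolding F_def by (intro has_vector_derivative_mult_right smooth_has_nderiv assms)
  have F0: "F 0 = (\<lambda>t. c * \<phi> t)" by (rule ext) (simp add: F_def)
  show "smooth (\<lambda>t. c * \<phi> t)" using smooth_nderivI[of F, OF F] by (simp only: F0)
  show "nderiv j (\<lambda>t. c * \<phi> t) t = c * nderiv j \<phi> t"
    using nderiv_unique[of F, OF F] by (simp add: F0 F_def)
qed

text \<open>The coefficients of \<open>(\<tau> + D)\<^sup>j\<close>.\<close>

fun ecoeff :: "complex \<Rightarrow> nat \<Rightarrow> nat \<Rightarrow> complex" where
  "ecoeff \<tau> 0 i = (if i = 0 then 1 else 0)"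
| "ecoeff \<tau> (Suc j) i = \<tau> * ecoeff \<tau> j i + (if i = 0 then 0 else ecoeff \<tau> j (i - 1))"

lemma ecoeff_eq_0: "j < i \<Longrightarrow> ecoeff \<tau> j i = 0"
  by (induction j arbitrary: i) auto

lemma smooth_exp_mult:
  assumes "smooth \<phi>"
  shows "smooth (\<lambda>t. exp (\<tau> * of_real t) * \<phi> t)"
    "nderiv j (\<lambda>t. exp (\<tau> * of_real t) * \<phi> t) t =
       exp (\<tau> * of_real t) * (\<Sum>i\<le>j. ecoeff \<tau> j i * nderiv i \<phi> t)"
proof -
  define G where "G j t = (\<Sum>i\<le>j. ecoeff \<tau> j i * nderiv i \<phi> t)" for j t
  define F where "F j t = exp (\<tau> * of_real t) * G j t" for j t
  have G': "(G j has_vector_derivative (\<Sum>i\<le>j. ecoeff \<tau> j i * nderiv (Suc i) \<phi> t)) (at t)" for j t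
    unfolding G_def
    by (intro has_vector_derivative_sum has_vector_derivative_mult_right smooth_has_nderiv assms)
  have rec: "G (Suc j) t = \<tau> * G j t + (\<Sum>i\<le>j. ecoeff \<tau> j i * nderiv (Suc i) \<phi> t)" for j t
  proof -
    have "G (Suc j) t = (\<Sum>i\<le>Suc j. \<tau> * (ecoeff \<tau> j i * nderiv i \<phi> t)) +
        (\<Sum>i\<le>Suc j. (if i = 0 then 0 else ecoeff \<tau> j (i - 1)) * nderiv i \<phi> t)"
      by (simp add: G_def sum.distrib[symmetric] algebra_simps del: sum.atMost_Suc)
    also have "(\<Sum>i\<le>Suc j. \<tau> * (ecoeff \<tau> j i * nderiv i \<phi> t)) = \<tau> * G j t"
      by (simp add: G_def sum_distrib_left ecoeff_eq_0)
    also have "(\<Sum>i\<le>Suc j. (if i = 0 then 0 else ecoeff \<tau> j (i - 1)) * nderiv i \<phi> t) =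
        (\<Sum>i\<le>j. ecoeff \<tau> j i * nderiv (Suc i) \<phi> t)"
      by (subst sum.atMost_Suc_shift) simp
    finally show ?thesis .
  qed
  have F: "(F j has_vector_derivative F (Suc j) t) (at t)" for j t
  proof -
    have "(F j has_vector_derivative exp (\<tau> * of_real t) * (\<Sum>i\<le>j. ecoeff \<tau> j i * nderiv (Suc i) \<phi> t) +
        \<tau> * exp (\<tau> * of_real t) * G j t) (at t)"
      unfolding F_def by (intro has_vector_derivative_mult exp_has_vector_derivative G')
    then show ?thesis by (simp add: F_def rec algebra_simps)
  qed
  have F0: "F 0 = (\<lambda>t. exp (\<tau> * of_real t) * \<phi> t)" by (auto simp: F_def G_def)
  show "smooth (\<lambda>t. exp (\<tau> * of_real t) * \<phi> t)" using smooth_nderivI[of F, OF F] by (simp only: F0)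
  show "nderiv j (\<lambda>t. exp (\<tau> * of_real t) * \<phi> t) t = exp (\<tau> * of_real t) * (\<Sum>i\<le>j. ecoeff \<tau> j i * nderiv i \<phi> t)"
    using nderiv_unique[of F, OF F] by (simp add: F0 F_def G_def)
qed

lemma nderiv_outside_support:
  assumes "t \<notin> fun_supp \<phi>"
  shows "nderiv j \<phi> t = 0"
  using assms
proof (induction j arbitrary: t)
  case 0
  then show ?case using closure_subset[of "{t. \<phi> t \<noteq> 0}"] by (auto simp: fun_supp_def)
next
  case (Suc j)
  have op: "open (- fun_supp \<phi>)" by (simp add: fun_supp_def open_Compl)
  have "((\<lambda>_. 0) has_vector_derivative 0) (at t)" by simp
  then have "(nderiv j \<phi> has_vector_derivative 0) (at t)"
    by (rule has_vector_derivative_transform_within_open[OF _ op]) (use Suc in auto)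
  then show ?case by (simp add: nderiv_Suc vector_derivative_at)
qed

lemma test_funs_bounded:
  assumes "\<phi> \<in> test_funs"
  shows "bounded (range (nderiv j \<phi>))"
proof -
  have "compact (nderiv j \<phi> ` fun_supp \<phi>)"
    using assms by (auto simp: test_funs_def intro!: compact_continuous_image smooth_continuous)
  then have "bounded (insert 0 (nderiv j \<phi> ` fun_supp \<phi>))" using compact_imp_bounded by auto
  moreover have "range (nderiv j \<phi>) \<subseteq> insert 0 (nderiv j \<phi> ` fun_supp \<phi>)"
    using nderiv_outside_support[of _ \<phi> j] by blast
  ultimately show ?thesis by (rule bounded_subset)
qed

lemma fun_supp_exp_mult: "fun_supp (\<lambda>t. exp (\<tau> * of_real t) * \<phi> t) = fun_supp \<phi>"
  by (simp add: fun_supp_def)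

lemma test_funs_exp_mult: "\<phi> \<in> test_funs \<Longrightarrow> (\<lambda>t. exp (\<tau> * of_real t) * \<phi> t) \<in> test_funs"
  by (simp add: test_funs_def smooth_exp_mult fun_supp_exp_mult)

text \<open>Integration from infinity improves the constant to e / a, so a \<ge> 1 lets the same e
  be carried through repeated use.\<close>

lemma norm_le_exp_of_derivative:
  fixes g g' :: "real \<Rightarrow> complex"
  assumes d: "\<And>t. (g has_vector_derivative g' t) (at t)" and a: "1 \<le> a" and "0 \<le> e"
    and b: "\<And>t. 0 \<le> t \<Longrightarrow> norm (g' t) \<le> e * exp (- a * t)" and lim: "(g \<longlongrightarrow> 0) at_top" and t: "0 \<le> t"
  shows "norm (g t) \<le> e * exp (- a * t)"
proof -
  have le: "norm (g T - g t) \<le> e * exp (- a * t)" if T: "t < T" for T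
  proof -
    have "norm (g T - g t) \<le> - (e / a) * exp (- a * T) - - (e / a) * exp (- a * t)"
    proof (rule differentiable_bound_general[OF T])
      show "continuous_on {t..T} g"
        by (rule continuous_at_imp_continuous_on) (auto intro: has_vector_derivative_continuous d)
      show "continuous_on {t..T} (\<lambda>t. - (e / a) * exp (- a * t))" by (intro continuous_intros)
      show "(g has_vector_derivative g' x) (at x)" for x by (rule d)
      show "((\<lambda>t. - (e / a) * exp (- a * t)) has_vector_derivative e * exp (- a * x)) (at x)" for x
        unfolding has_real_derivative_iff_has_vector_derivative[symmetric]
        using a by (auto intro!: derivative_eq_intros)
      show "norm (g' x) \<le> e * exp (- a * x)" if "t < x" for x using b that t by simp
    qed
    also have "\<dots> \<le> e / a * exp (- a * t)" using \<open>0 \<le> e\<close> a by simp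
    also have "\<dots> \<le> e / 1 * exp (- a * t)" using \<open>0 \<le> e\<close> a by (intro mult_right_mono divide_left_mono) auto
    finally show ?thesis by simp
  qed
  have "((\<lambda>T. norm (g T - g t)) \<longlongrightarrow> norm (0 - g t)) at_top" by (intro tendsto_intros lim)
  moreover have "eventually (\<lambda>T. norm (g T - g t) \<le> e * exp (- a * t)) at_top"
    using eventually_gt_at_top[of t] by eventually_elim (rule le)
  ultimately have "norm (0 - g t) \<le> e * exp (- a * t)" by (rule tendsto_upperbound) simp
  then show ?thesis by simp
qed

lemma Weierstrass_complex:
  fixes q :: "real \<Rightarrow> complex"
  assumes "continuous_on {0..1} q" "0 < e"
  obtains a :: "nat \<Rightarrow> complex" and M where "\<And>x. x \<in> {0..1} \<Longrightarrow> norm (q x - (\<Sum>k\<le>M. a k * of_real x ^ k)) < e"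
proof -
  have R: "\<exists>a M. \<forall>x\<in>{0..1}. \<bar>h x - (\<Sum>k\<le>M. a k * x ^ k)\<bar> < e / 2" if h: "continuous_on {0..1} h" for h :: "real \<Rightarrow> real"
  proof -
    obtain p where p: "real_polynomial_function p" "\<And>x. x \<in> {0..1} \<Longrightarrow> \<bar>h x - p x\<bar> < e / 2"
      by (rule Stone_Weierstrass_real_polynomial_function[OF compact_Icc h, of "e / 2"]) (use \<open>0 < e\<close> in auto)
    then show ?thesis unfolding real_polynomial_function_iff_sum by fastforce
  qed
  obtain a M where aM: "\<And>x. x \<in> {0..1} \<Longrightarrow> \<bar>Re (q x) - (\<Sum>k\<le>M. a k * x ^ k)\<bar> < e / 2"
    using R[OF continuous_on_Re[OF assms(1)]] by blast
  obtain b L where bL: "\<And>x. x \<in> {0..1} \<Longrightarrow> \<bar>Im (q x) - (\<Sum>k\<le>L. b k * x ^ k)\<bar> < e / 2"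
    using R[OF continuous_on_Im[OF assms(1)]] by blast
  define c where "c k = of_real (if k \<le> M then a k else 0) + \<i> * of_real (if k \<le> L then b k else 0)" for k
  show ?thesis
  proof (rule that[of c "max M L"])
    fix x :: real assume x: "x \<in> {0..1}"
    have 1: "(\<Sum>k\<le>max M L. (if k \<le> M then a k else 0) * x ^ k) = (\<Sum>k\<le>M. a k * x ^ k)"
      by (rule sum.mono_neutral_cong_right) auto
    have 2: "(\<Sum>k\<le>max M L. (if k \<le> L then b k else 0) * x ^ k) = (\<Sum>k\<le>L. b k * x ^ k)"
      by (rule sum.mono_neutral_cong_right) auto
    have "(\<Sum>k\<le>max M L. c k * of_real x ^ k) =
       of_real (\<Sum>k\<le>max M L. (if k \<le> M then a k else 0) * x ^ k) + \<i> * of_real (\<Sum>k\<le>max M L. (if k \<le> L then b k else 0) * x ^ k)"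
      by (simp add: c_def distrib_right sum.distrib sum_distrib_left mult.assoc)
    then have eq: "(\<Sum>k\<le>max M L. c k * of_real x ^ k) = Complex (\<Sum>k\<le>M. a k * x ^ k) (\<Sum>k\<le>L. b k * x ^ k)"
      unfolding 1 2 by (simp add: complex_eq_iff)
    have "norm (q x - (\<Sum>k\<le>max M L. c k * of_real x ^ k)) \<le>
      \<bar>Re (q x - (\<Sum>k\<le>max M L. c k * of_real x ^ k))\<bar> + \<bar>Im (q x - (\<Sum>k\<le>max M L. c k * of_real x ^ k))\<bar>"
      by (rule cmod_le)
    also have "\<dots> < e / 2 + e / 2" unfolding eq using aM[OF x] bL[OF x] by (intro add_strict_mono) simp_all
    finally show "norm (q x - (\<Sum>k\<le>max M L. c k * of_real x ^ k)) < e" by simp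
  qed
qed

text \<open>With \<open>x = exp (- t)\<close>, Weierstrass' theorem is applied to the \<open>N\<close>-th derivative divided by
  \<open>x\<close> to the power \<open>c + 1\<close>; the lower derivatives follow by integrating from infinity.\<close>

lemma test_funs_exp_approx:
  assumes \<eta>: "\<eta> \<in> test_funs" and "0 < c" "0 < e"
  obtains \<alpha> :: "nat \<Rightarrow> complex" and M where "\<And>j t. j \<le> N \<Longrightarrow> 0 \<le> t \<Longrightarrow>
    norm (nderiv j \<eta> t - (\<Sum>k\<le>M. \<alpha> k * (- of_real (c + 1 + real k)) ^ j * exp (- of_real (c + 1 + real k) * of_real t)))
      \<le> e * exp (- c * t)"
proof -
  have sm: "smooth \<eta>" and "compact (fun_supp \<eta>)" using \<eta> by (auto simp: test_funs_def)
  then have "bounded (fun_supp \<eta>)" using compact_imp_bounded by auto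
  then obtain B0 where B0: "\<And>t. t \<in> fun_supp \<eta> \<Longrightarrow> \<bar>t\<bar> \<le> B0" unfolding bounded_iff by auto
  define B where "B = max B0 0 + 1"
  have B: "nderiv j \<eta> t = 0" if "B \<le> t" for j t
  proof (rule nderiv_outside_support)
    have "B0 < t" using that by (simp add: B_def max_def split: if_splits)
    then show "t \<notin> fun_supp \<eta>" using B0[of t] by auto
  qed
  have B_pos: "0 < B" by (simp add: B_def)
  define \<delta> where "\<delta> = exp (- B)"
  have \<delta>: "0 < \<delta>" by (simp add: \<delta>_def)
  \<comment> \<open>Capping x from below at exp(-B) removes the singularity at x = 0: for smaller x
    the logarithm is frozen at t = B, where \<eta> and its derivatives vanish.\<close>
  define q where "q x = of_real ((max x \<delta>) powr - (c + 1)) * nderiv N \<eta> (- ln (max x \<delta>))" for x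
  have pos: "0 < max x \<delta>" for x using \<delta> by (simp add: less_max_iff_disj)
  have nz: "max x \<delta> \<noteq> 0" for x using pos[of x] by linarith
  have c0: "continuous_on {0..1} (\<lambda>x. max x \<delta>)" by (intro continuous_intros)
  have c1: "continuous_on {0..1} (\<lambda>x. max x \<delta> powr - (c + 1))"
    by (rule continuous_on_powr[OF c0 continuous_on_const]) (use nz in auto)
  have "continuous_on {0..1} (nderiv N \<eta> \<circ> (\<lambda>x. - ln (max x \<delta>)))"
    by (intro continuous_on_compose smooth_continuous[OF sm] continuous_on_minus continuous_on_ln c0) (use nz in auto)
  then have cq: "continuous_on {0..1} q"
    unfolding q_def by (intro continuous_on_mult continuous_on_of_real c1) (simp add: o_def)
  obtain a :: "nat \<Rightarrow> complex" and M where aM: "\<And>x. x \<in> {0..1} \<Longrightarrow> norm (q x - (\<Sum>k\<le>M. a k * of_real x ^ k)) < e"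
    by (rule Weierstrass_complex[OF cq \<open>0 < e\<close>]) (rule that)
  define y where "y k = c + 1 + real k" for k
  have y: "y k \<ge> 1" for k using \<open>0 < c\<close> by (simp add: y_def)
  \<comment> \<open>Chosen so that the N-th derivative of the sum of \<alpha> k exp(-y k t) has the
    coefficients a k; the y k are nonzero.\<close>
  define \<alpha> where "\<alpha> k = a k / (- of_real (y k)) ^ N" for k
  define g where "g j t = nderiv j \<eta> t - (\<Sum>k\<le>M. \<alpha> k * (- of_real (y k)) ^ j * exp (- of_real (y k) * of_real t))" for j t
  have qt: "q (exp (- t)) = of_real (exp ((c + 1) * t)) * nderiv N \<eta> t" if "0 \<le> t" for t
  proof (cases "t \<le> B")
    case True
    then have "max (exp (- t)) \<delta> = exp (- t)" by (simp add: \<delta>_def)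
    then show ?thesis by (simp add: q_def powr_def algebra_simps)
  next
    case False
    then have "max (exp (- t)) \<delta> = exp (- B)" by (simp add: \<delta>_def)
    then show ?thesis using B[of B N] B[of t N] False by (simp add: q_def)
  qed
  have base: "norm (g N t) \<le> e * exp (- (c + 1) * t)" if t: "0 \<le> t" for t
  proof -
    have "(\<Sum>k\<le>M. \<alpha> k * (- of_real (y k)) ^ N * exp (- of_real (y k) * of_real t)) = of_real (exp (- (c + 1) * t)) * (\<Sum>k\<le>M. a k * of_real (exp (- t)) ^ k)"
      unfolding sum_distrib_left
    proof (rule sum.cong[OF refl])
      fix k
      have "y k \<noteq> 0" using y[of k] by linarith
      then have "\<alpha> k * (- of_real (y k)) ^ N = a k" by (simp add: \<alpha>_def)
      moreover have "exp (- of_real (y k) * of_real t) = (of_real (exp (- (c + 1) * t) * exp (- t) ^ k) :: complex)"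
      proof -
        have "exp (- (c + 1) * t) * exp (- t) ^ k = exp (- y k * t)"
          by (simp add: exp_of_nat_mult[symmetric] mult_exp_exp y_def algebra_simps)
        moreover have "- of_real (y k) * of_real t = (of_real (- y k * t) :: complex)" by simp
        ultimately show ?thesis by (metis exp_of_real)
      qed
      ultimately show "\<alpha> k * (- of_real (y k)) ^ N * exp (- of_real (y k) * of_real t) = of_real (exp (- (c + 1) * t)) * (a k * of_real (exp (- t)) ^ k)"
        by (simp only: of_real_mult of_real_power mult_ac)
    qed
    moreover have "nderiv N \<eta> t = of_real (exp (- (c + 1) * t)) * q (exp (- t))"
    proof -
      have "of_real (exp (- (c + 1) * t)) * (of_real (exp ((c + 1) * t)) :: complex) = of_real (exp (- (c + 1) * t) * exp ((c + 1) * t))" by (simp only: of_real_mult)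
      also have "\<dots> = 1" by (simp add: mult_exp_exp algebra_simps)
      finally show ?thesis unfolding qt[OF t] mult.assoc[symmetric] by simp
    qed
    ultimately have "g N t = of_real (exp (- (c + 1) * t)) * (q (exp (- t)) - (\<Sum>k\<le>M. a k * of_real (exp (- t)) ^ k))"
      by (simp only: g_def right_diff_distrib)
    then have "norm (g N t) = exp (- (c + 1) * t) * norm (q (exp (- t)) - (\<Sum>k\<le>M. a k * of_real (exp (- t)) ^ k))"
      by (simp only: norm_mult norm_of_real abs_exp_cancel)
    also have "\<dots> \<le> exp (- (c + 1) * t) * e"
      by (intro mult_left_mono less_imp_le[OF aM]) (use t in auto)
    finally show ?thesis by (simp only: mult.commute)
  qed
  have dg: "(g j has_vector_derivative g (Suc j) t) (at t)" for j t
  proof -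
    have "((\<lambda>t. \<Sum>k\<le>M. \<alpha> k * (- of_real (y k)) ^ j * exp (- of_real (y k) * of_real t)) has_vector_derivative
       (\<Sum>k\<le>M. \<alpha> k * (- of_real (y k)) ^ j * (- of_real (y k) * exp (- of_real (y k) * of_real t)))) (at t)"
      by (intro has_vector_derivative_sum has_vector_derivative_mult_right exp_has_vector_derivative)
    from has_vector_derivative_diff[OF smooth_has_nderiv[OF sm] this]
    show ?thesis unfolding g_def by (simp only: power_Suc mult_ac)
  qed
  have lim: "(g j \<longlongrightarrow> 0) at_top" for j
  proof -
    have "(nderiv j \<eta> \<longlongrightarrow> 0) at_top"
      by (rule tendsto_eventually) (rule eventually_mono[OF eventually_ge_at_top[of B] B])
    moreover have "((\<lambda>t. \<Sum>k\<le>M. \<alpha> k * (- of_real (y k)) ^ j * exp (- of_real (y k) * of_real t)) \<longlongrightarrow> (\<Sum>k\<le>M. \<alpha> k * (- of_real (y k)) ^ j * 0)) at_top"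
    proof (intro tendsto_sum tendsto_mult tendsto_const)
      fix k
      have "filterlim (\<lambda>t. - y k * t) at_bot at_top"
        using y[of k] by (intro filterlim_tendsto_neg_mult_at_bot[OF tendsto_const _ filterlim_ident]) auto
      then have "((\<lambda>t. exp (- y k * t)) \<longlongrightarrow> 0) at_top" by (rule filterlim_compose[OF exp_at_bot])
      then have "((\<lambda>t. of_real (exp (- y k * t))) \<longlongrightarrow> (of_real 0 :: complex)) at_top" by (rule tendsto_of_real)
      then show "((\<lambda>t. exp (- of_real (y k) * of_real t)) \<longlongrightarrow> (0 :: complex)) at_top"
        by (simp add: exp_of_real[symmetric])
    qed
    ultimately show ?thesis unfolding g_def using tendsto_diff by fastforce
  qed
  \<comment> \<open>Descends from order N to 0; the rate c + 1 \<ge> 1 preserves the constant e. For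
    i beyond N truncated subtraction just repeats order 0.\<close>
  have all: "norm (g (N - i) t) \<le> e * exp (- (c + 1) * t)" if "0 \<le> t" for i t
    using that
  proof (induction i arbitrary: t)
    case (Suc i)
    show ?case
    proof (cases "i < N")
      case True
      then have eq: "N - i = Suc (N - Suc i)" by simp
      show ?thesis
        by (rule norm_le_exp_of_derivative[OF dg _ _ _ lim Suc.prems]) (use Suc.IH[unfolded eq] \<open>0 < c\<close> \<open>0 < e\<close> in auto)
    next
      case False
      then show ?thesis using Suc.IH[OF Suc.prems] by simp
    qed
  qed (use base in simp)
  show ?thesis
  proof (rule that[of \<alpha> M])
    fix j :: nat and t :: real assume j: "j \<le> N" and t: "0 \<le> t"
    have "norm (g j t) \<le> e * exp (- (c + 1) * t)" using all[OF t, of "N - j"] j by simp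
    also have "\<dots> \<le> e * exp (- c * t)" using t \<open>0 < e\<close> by (intro mult_left_mono) (auto simp: algebra_simps)
    finally show "norm (nderiv j \<eta> t - (\<Sum>k\<le>M. \<alpha> k * (- of_real (c + 1 + real k)) ^ j * exp (- of_real (c + 1 + real k) * of_real t)))
      \<le> e * exp (- c * t)" unfolding g_def y_def .
  qed
qed


section \<open>Laplace transformability\<close>

lemma dist_deriv_pow: "(dist_deriv ^^ k) U \<phi> = (-1) ^ k * U (nderiv k \<phi>)"
proof (induction k arbitrary: \<phi>)
  case (Suc k)
  have "(dist_deriv ^^ Suc k) U \<phi> = - (dist_deriv ^^ k) U (nderiv 1 \<phi>)"
    by (simp only: funpow.simps o_apply dist_deriv_def[of "(dist_deriv ^^ k) U"])
  then show ?case by (simp add: Suc nderiv_nderiv_1 del: One_nat_def)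
qed simp

lemma norm_le_SUP_norm:
  assumes "bounded (range g)"
  shows "norm (g t) \<le> (SUP t. norm (g t))"
proof (rule cSUP_upper)
  from assms obtain B where "\<And>t. norm (g t) \<le> B" unfolding bounded_iff by auto
  then show "bdd_above (range (\<lambda>t. norm (g t)))" by (rule bdd_aboveI2)
qed simp

lemma SUP_norm_nonneg:
  assumes "bounded (range g)"
  shows "0 \<le> (SUP t. norm (g t))"
  using norm_le_SUP_norm[OF assms, of undefined] norm_ge_zero order_trans by blast

lemma test_funs_add:
  assumes "\<phi> \<in> test_funs" "\<psi> \<in> test_funs"
  shows "(\<lambda>t. \<phi> t + \<psi> t) \<in> test_funs"
proof -
  have "closure {t. \<phi> t + \<psi> t \<noteq> 0} \<subseteq> closure ({t. \<phi> t \<noteq> 0} \<union> {t. \<psi> t \<noteq> 0})"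
    by (rule closure_mono) auto
  then have sub: "fun_supp (\<lambda>t. \<phi> t + \<psi> t) \<subseteq> fun_supp \<phi> \<union> fun_supp \<psi>"
    by (simp add: fun_supp_def closure_Un)
  have "compact (fun_supp \<phi> \<union> fun_supp \<psi>)" using assms by (auto simp: test_funs_def)
  then have "compact (fun_supp (\<lambda>t. \<phi> t + \<psi> t))"
    using compact_Int_closed[of "fun_supp \<phi> \<union> fun_supp \<psi>" "fun_supp (\<lambda>t. \<phi> t + \<psi> t)"] sub
    by (simp add: fun_supp_def Int_absorb1)
  then show ?thesis using assms smooth_add(1) by (auto simp: test_funs_def)
qed

lemma test_funs_cmult:
  assumes "\<phi> \<in> test_funs"
  shows "(\<lambda>t. c * \<phi> t) \<in> test_funs"
proof (cases "c = 0")
  case True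
  have "smooth (\<lambda>t. 0 * \<phi> t)" using assms smooth_cmult(1) unfolding test_funs_def by blast
  then show ?thesis using True by (simp add: test_funs_def fun_supp_def)
next
  case False
  then have "fun_supp (\<lambda>t. c * \<phi> t) = fun_supp \<phi>" by (simp add: fun_supp_def)
  then show ?thesis using assms smooth_cmult(1) by (auto simp: test_funs_def)
qed

lemma of_real_exp_linear: "of_real (exp (x * t)) = (exp (of_real x * of_real t) :: complex)"
  by (metis exp_of_real of_real_mult)

text \<open>Each ingredient of the notion looks at test functions only, and twisting by an
  exponential maps these to themselves. Thus the Dirac side inherits transformability from the
  kernel side without estimates of its own.\<close>

lemma laplace_transformable_cong:
  assumes eq: "dist_eq U V" and U: "laplace_transformable U"
  shows "laplace_transformable V"
proof -
  have UV: "U \<phi> = V \<phi>" if "\<phi> \<in> test_funs" for \<phi> using eq that by (simp add: dist_eq_def)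
  have "is_distribution V"
    using U unfolding laplace_transformable_def is_distribution_def linear_functional_on_def
    by (simp add: UV test_funs_add test_funs_cmult)
  moreover have "dist_supp V = dist_supp U"
    unfolding dist_supp_def using UV by auto
  moreover have "is_tempered (dist_mult (\<lambda>t. of_real (exp (- c * t))) V)"
    if "is_tempered (dist_mult (\<lambda>t. of_real (exp (- c * t))) U)" for c
  proof -
    have "dist_eq T (dist_mult (\<lambda>t. of_real (exp (- c * t))) V)" if "dist_eq T (dist_mult (\<lambda>t. of_real (exp (- c * t))) U)" for T
      unfolding dist_eq_def
    proof
      fix \<phi> assume \<phi>: "\<phi> \<in> test_funs"
      then have "T \<phi> = dist_mult (\<lambda>t. of_real (exp (- c * t))) U \<phi>" using that by (simp add: dist_eq_def)
      then show "T \<phi> = dist_mult (\<lambda>t. of_real (exp (- c * t))) V \<phi>"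
        unfolding dist_mult_def of_real_exp_linear UV[OF test_funs_exp_mult[OF \<phi>]] .
    qed
    then show ?thesis using that unfolding is_tempered_def by blast
  qed
  ultimately show ?thesis using U unfolding laplace_transformable_def by auto
qed

text \<open>A common home for test and Schwartz functions, on which one estimate serves both
  continuity and temperedness.\<close>

definition bounded_derivs :: "(real \<Rightarrow> complex) \<Rightarrow> bool" where
  "bounded_derivs \<phi> \<longleftrightarrow> smooth \<phi> \<and> (\<forall>j. bounded (range (nderiv j \<phi>)))"

locale kernel_functional =
  fixes H :: "real \<Rightarrow> complex" and C b :: real and d :: nat
  assumes meas: "H \<in> borel_measurable borel" and neg: "\<And>t. t < 0 \<Longrightarrow> H t = 0"
    and bound: "\<And>t. 0 \<le> t \<Longrightarrow> norm (H t) \<le> C * exp (b * t)" and C0: "0 \<le> C"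
begin

text \<open>The distribution exp(\<tau> t) D^d H after moving the derivatives to the test function.
  With \<tau> as a parameter, multiplication by an exponential stays within the family.\<close>

definition T :: "complex \<Rightarrow> functional" where
  "T \<tau> \<psi> = (-1) ^ d * (\<integral>t. H t * nderiv d (\<lambda>t. exp (\<tau> * of_real t) * \<psi> t) t \<partial>lborel)"

lemma integral_half_line: "H t * g t = indicator {0..} t *\<^sub>R (H t * g t)"
  using neg[of t] by (cases "0 \<le> t") auto

lemma integral_bound:
  assumes g: "g \<in> borel_measurable borel" and "0 < \<delta>"
    and le: "\<And>t. 0 \<le> t \<Longrightarrow> norm (g t) \<le> B * exp (- (b + \<delta>) * t)"
  shows "integrable lborel (\<lambda>t. H t * g t)" "norm (\<integral>t. H t * g t \<partial>lborel) \<le> C * B / \<delta>"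
proof -
  have m: "(\<lambda>t. indicator {0..} t *\<^sub>R (H t * g t)) \<in> borel_measurable borel"
    using meas g by simp
  have bd: "norm (H t * g t) \<le> C * B * exp (- \<delta> * t)" if t: "0 \<le> t" for t
  proof -
    have "norm (H t * g t) \<le> C * exp (b * t) * (B * exp (- (b + \<delta>) * t))"
      unfolding norm_mult by (intro mult_mono bound le t) (use C0 in auto)
    also have "\<dots> = C * B * (exp (b * t) * exp (- (b + \<delta>) * t))" by (simp only: mult_ac)
    also have "exp (b * t) * exp (- (b + \<delta>) * t) = exp (- \<delta> * t)" by (simp add: mult_exp_exp algebra_simps)
    finally show ?thesis .
  qed
  note I = half_line_integrable[OF \<open>0 < \<delta>\<close> m bd, folded integral_half_line]
  show "integrable lborel (\<lambda>t. H t * g t)" "norm (\<integral>t. H t * g t \<partial>lborel) \<le> C * B / \<delta>"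
    using I by simp_all
qed

text \<open>The factor exp(\<tau> t) beats the growth exp(b t) of H by a margin of 1, so a single
  exp(-t) remains to be integrated and only sup norms of the derivatives of \<psi> enter.\<close>

lemma norm_T_le:
  assumes \<psi>: "bounded_derivs \<psi>" and \<tau>: "Re \<tau> \<le> - (b + 1)"
  shows "integrable lborel (\<lambda>t. H t * nderiv d (\<lambda>t. exp (\<tau> * of_real t) * \<psi> t) t)"
    "norm (T \<tau> \<psi>) \<le> C * (\<Sum>i\<le>d. norm (ecoeff \<tau> d i)) * (\<Sum>j\<le>d. SUP t. norm (nderiv j \<psi> t))"
proof -
  have sm: "smooth \<psi>" and bd: "\<And>j. bounded (range (nderiv j \<psi>))" using \<psi> by (auto simp: bounded_derivs_def)
  define E where "E = (\<Sum>i\<le>d. norm (ecoeff \<tau> d i))"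
  define Q where "Q = (\<Sum>j\<le>d. SUP t. norm (nderiv j \<psi> t))"
  let ?g = "nderiv d (\<lambda>t. exp (\<tau> * of_real t) * \<psi> t)"
  have g: "?g \<in> borel_measurable borel"
    by (rule borel_measurable_continuous_onI[OF smooth_continuous[OF smooth_exp_mult(1)[OF sm]]])
  have le: "norm (?g t) \<le> E * Q * exp (- (b + 1) * t)" if t: "0 \<le> t" for t
  proof -
    have "norm (\<Sum>i\<le>d. ecoeff \<tau> d i * nderiv i \<psi> t) \<le> (\<Sum>i\<le>d. norm (ecoeff \<tau> d i) * Q)"
    proof (rule order_trans[OF norm_sum sum_mono])
      fix i assume i: "i \<in> {..d}"
      have "norm (nderiv i \<psi> t) \<le> (SUP t. norm (nderiv i \<psi> t))" by (rule norm_le_SUP_norm[OF bd])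
      also have "\<dots> \<le> Q" unfolding Q_def by (rule member_le_sum[OF i]) (auto intro: SUP_norm_nonneg bd)
      finally show "norm (ecoeff \<tau> d i * nderiv i \<psi> t) \<le> norm (ecoeff \<tau> d i) * Q"
        unfolding norm_mult by (rule mult_left_mono) simp
    qed
    then have 1: "norm (\<Sum>i\<le>d. ecoeff \<tau> d i * nderiv i \<psi> t) \<le> E * Q" by (simp add: E_def sum_distrib_right)
    have 2: "norm (exp (\<tau> * of_real t)) \<le> exp (- (b + 1) * t)"
      using mult_right_mono[OF \<tau> t] by (simp add: norm_exp_eq_Re)
    have "norm (?g t) = norm (exp (\<tau> * of_real t)) * norm (\<Sum>i\<le>d. ecoeff \<tau> d i * nderiv i \<psi> t)"
      unfolding smooth_exp_mult(2)[OF sm] by (rule norm_mult)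
    also have "\<dots> \<le> exp (- (b + 1) * t) * (E * Q)" by (intro mult_mono 1 2) auto
    finally show ?thesis by (simp only: mult.commute)
  qed
  note I = integral_bound[OF g zero_less_one le]
  show "integrable lborel (\<lambda>t. H t * ?g t)" by (rule I(1))
  show "norm (T \<tau> \<psi>) \<le> C * E * Q" using I(2) by (simp add: T_def norm_mult norm_power mult.assoc)
qed

lemma T_linear:
  assumes D: "\<And>\<phi>. \<phi> \<in> D \<Longrightarrow> bounded_derivs \<phi>" and \<tau>: "Re \<tau> \<le> - (b + 1)"
  shows "linear_functional_on D (T \<tau>)"
  unfolding linear_functional_on_def
proof (intro conjI ballI allI)
  fix \<phi> \<psi> assume \<phi>: "\<phi> \<in> D" and \<psi>: "\<psi> \<in> D"
  note I\<phi> = norm_T_le(1)[OF D[OF \<phi>] \<tau>] and I\<psi> = norm_T_le(1)[OF D[OF \<psi>] \<tau>]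
  have s: "smooth (\<lambda>t. exp (\<tau> * of_real t) * \<phi> t)" "smooth (\<lambda>t. exp (\<tau> * of_real t) * \<psi> t)"
    using D[OF \<phi>] D[OF \<psi>] by (auto simp: bounded_derivs_def intro: smooth_exp_mult)
  show "T \<tau> (\<lambda>t. \<phi> t + \<psi> t) = T \<tau> \<phi> + T \<tau> \<psi>"
    unfolding T_def distrib_left[of "exp _"] smooth_add(2)[OF s] distrib_left[of "H _"]
    by (simp add: Bochner_Integration.integral_add[OF I\<phi> I\<psi>] distrib_left)
next
  fix \<phi> c assume \<phi>: "\<phi> \<in> D"
  have s: "smooth (\<lambda>t. exp (\<tau> * of_real t) * \<phi> t)"
    using D[OF \<phi>] by (auto simp: bounded_derivs_def intro: smooth_exp_mult)
  show "T \<tau> (\<lambda>t. c * \<phi> t) = c * T \<tau> \<phi>"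
    unfolding T_def mult.left_commute[of "exp _" c] smooth_cmult(2)[OF s] mult.left_commute[of "H _" c]
    by simp
qed

lemma test_funs_bounded_derivs: "\<phi> \<in> test_funs \<Longrightarrow> bounded_derivs \<phi>"
  using test_funs_bounded by (auto simp: bounded_derivs_def test_funs_def)

lemma schwartz_funs_bounded_derivs: "\<phi> \<in> schwartz_funs \<Longrightarrow> bounded_derivs \<phi>"
  unfolding schwartz_funs_def bounded_derivs_def
proof (safe, goal_cases)
  case (1 j)
  then show ?case using spec[OF 1(2), of 0] by simp
qed

lemma T_shift: "T \<tau> (\<lambda>t. exp (\<tau>' * of_real t) * \<psi> t) = T (\<tau> + \<tau>') \<psi>"
proof -
  have "(\<lambda>t. exp (\<tau> * of_real t) * (exp (\<tau>' * of_real t) * \<psi> t)) = (\<lambda>t. exp ((\<tau> + \<tau>') * of_real t) * \<psi> t)"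
    by (simp add: distrib_right exp_add mult.assoc)
  then show ?thesis by (simp only: T_def)
qed

lemma T_tempered:
  assumes \<tau>: "Re \<tau> \<le> - (b + 1)"
  shows "is_tempered (T \<tau>)"
  unfolding is_tempered_def
proof (intro exI conjI ballI)
  show "linear_functional_on schwartz_funs (T \<tau>)" using schwartz_funs_bounded_derivs \<tau> by (rule T_linear)
  show "dist_eq (T \<tau>) (T \<tau>)" by (simp add: dist_eq_def)
  fix \<phi> assume \<phi>: "\<phi> \<in> schwartz_funs"
  let ?p = "\<lambda>i j. SUP t. norm (of_real t ^ i * nderiv j \<phi> t)"
  have p0: "0 \<le> ?p i j" for i j
    using \<phi> by (intro SUP_norm_nonneg) (auto simp: schwartz_funs_def)
  have "(\<Sum>j\<le>d. SUP t. norm (nderiv j \<phi> t)) = (\<Sum>j\<le>d. ?p 0 j)" by simp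
  also have "\<dots> \<le> (\<Sum>i\<le>d. \<Sum>j\<le>d. ?p i j)"
    by (rule member_le_sum[of 0 "{..d}" "\<lambda>i. \<Sum>j\<le>d. ?p i j"]) (auto intro!: sum_nonneg p0)
  finally have "C * (\<Sum>i\<le>d. norm (ecoeff \<tau> d i)) * (\<Sum>j\<le>d. SUP t. norm (nderiv j \<phi> t)) \<le>
     C * (\<Sum>i\<le>d. norm (ecoeff \<tau> d i)) * (\<Sum>i\<le>d. \<Sum>j\<le>d. ?p i j)"
    using C0 by (intro mult_left_mono) (auto intro!: mult_nonneg_nonneg sum_nonneg)
  then show "norm (T \<tau> \<phi>) \<le> C * (\<Sum>i\<le>d. norm (ecoeff \<tau> d i)) * (\<Sum>i\<le>d. \<Sum>j\<le>d. ?p i j)"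
    using norm_T_le(2)[OF schwartz_funs_bounded_derivs[OF \<phi>] \<tau>] by linarith
qed

text \<open>Write \<sigma> = \<tau> + c with Re \<tau> = -(b + 1), so that T \<sigma> is T \<tau>
  preceded by multiplication with exp(c t). On a fixed compact set this multiplication is bounded,
  which yields the distribution estimate; the twist by exp(-c t) undoes it, which yields
  temperedness.\<close>

lemma T_laplace_transformable: "laplace_transformable (T \<sigma>)"
proof -
  define c where "c = Re \<sigma> + b + 1"
  define \<tau> where "\<tau> = \<sigma> - of_real c"
  have \<tau>: "Re \<tau> \<le> - (b + 1)" by (simp add: \<tau>_def c_def)
  define e where "e \<phi> = (\<lambda>t. exp (of_real c * of_real t) * \<phi> t)" for \<phi> :: "real \<Rightarrow> complex"
  have Te: "T \<sigma> \<phi> = T \<tau> (e \<phi>)" for \<phi> unfolding e_def T_shift \<tau>_def by simp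
  have eT: "e \<phi> \<in> test_funs" if "\<phi> \<in> test_funs" for \<phi> using that by (simp add: e_def test_funs_exp_mult)
  have lin: "linear_functional_on test_funs (T \<tau>)" using test_funs_bounded_derivs \<tau> by (rule T_linear)
  have "is_distribution (T \<sigma>)"
    unfolding is_distribution_def
  proof (intro conjI allI impI)
    show "linear_functional_on test_funs (T \<sigma>)"
      unfolding linear_functional_on_def
    proof (intro conjI ballI allI)
      fix \<phi> \<psi> assume "\<phi> \<in> test_funs" "\<psi> \<in> test_funs"
      moreover have "e (\<lambda>t. \<phi> t + \<psi> t) = (\<lambda>t. e \<phi> t + e \<psi> t)" by (simp add: e_def distrib_left)
      ultimately show "T \<sigma> (\<lambda>t. \<phi> t + \<psi> t) = T \<sigma> \<phi> + T \<sigma> \<psi>"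
        using lin eT unfolding Te linear_functional_on_def by simp
    next
      fix \<phi> a assume "\<phi> \<in> test_funs"
      moreover have "e (\<lambda>t. a * \<phi> t) = (\<lambda>t. a * e \<phi> t)" by (simp add: e_def mult.left_commute)
      ultimately show "T \<sigma> (\<lambda>t. a * \<phi> t) = a * T \<sigma> \<phi>"
        using lin eT unfolding Te linear_functional_on_def by simp
    qed
    fix K :: "real set" assume K: "compact K"
    obtain B where B: "\<And>t. t \<in> K \<Longrightarrow> \<bar>t\<bar> \<le> B" using compact_imp_bounded[OF K] unfolding bounded_iff by auto
    define A where "A = exp (\<bar>c\<bar> * B)"
    define E where "E = (\<Sum>i\<le>d. norm (ecoeff \<tau> d i))"
    define G where "G = (\<Sum>j\<le>d. A * (\<Sum>i\<le>j. norm (ecoeff (of_real c) j i)))"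
    have "norm (T \<sigma> \<phi>) \<le> C * E * G * (\<Sum>j\<le>d. SUP t. norm (nderiv j \<phi> t))" if \<phi>: "\<phi> \<in> test_funs" "fun_supp \<phi> \<subseteq> K" for \<phi>
    proof -
      have sm: "smooth \<phi>" using \<phi> by (simp add: test_funs_def)
      note bd = test_funs_bounded[OF \<phi>(1)]
      define Q where "Q = (\<Sum>j\<le>d. SUP t. norm (nderiv j \<phi> t))"
      have Q0: "0 \<le> Q" unfolding Q_def by (intro sum_nonneg SUP_norm_nonneg bd)
      have le: "(SUP t. norm (nderiv j (e \<phi>) t)) \<le> A * (\<Sum>i\<le>j. norm (ecoeff (of_real c) j i)) * Q" if j: "j \<le> d" for j
      proof (rule cSUP_least)
        fix t
        show "norm (nderiv j (e \<phi>) t) \<le> A * (\<Sum>i\<le>j. norm (ecoeff (of_real c) j i)) * Q"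
        proof (cases "t \<in> K")
          case False
          then have "nderiv j (e \<phi>) t = 0"
            using \<phi>(2) by (intro nderiv_outside_support) (auto simp: e_def fun_supp_exp_mult)
          then show ?thesis using Q0 by (auto simp: A_def intro!: mult_nonneg_nonneg sum_nonneg)
        next
          case True
          have "c * t \<le> \<bar>c\<bar> * \<bar>t\<bar>" by (metis abs_ge_self abs_mult)
          also have "\<dots> \<le> \<bar>c\<bar> * B" using B[OF True] by (intro mult_left_mono) auto
          finally have 1: "norm (exp (of_real c * of_real t) :: complex) \<le> A" by (simp add: A_def norm_exp_eq_Re)
          have "norm (\<Sum>i\<le>j. ecoeff (of_real c) j i * nderiv i \<phi> t) \<le> (\<Sum>i\<le>j. norm (ecoeff (of_real c) j i) * Q)"
          proof (rule order_trans[OF norm_sum sum_mono])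
            fix i assume i: "i \<in> {..j}"
            have "norm (nderiv i \<phi> t) \<le> (SUP t. norm (nderiv i \<phi> t))" by (rule norm_le_SUP_norm[OF bd])
            also have "\<dots> \<le> Q" unfolding Q_def using i j by (intro member_le_sum) (auto intro: SUP_norm_nonneg bd)
            finally show "norm (ecoeff (of_real c) j i * nderiv i \<phi> t) \<le> norm (ecoeff (of_real c) j i) * Q"
              unfolding norm_mult by (rule mult_left_mono) simp
          qed
          then have 2: "norm (\<Sum>i\<le>j. ecoeff (of_real c) j i * nderiv i \<phi> t) \<le> (\<Sum>i\<le>j. norm (ecoeff (of_real c) j i)) * Q"
            by (simp add: sum_distrib_right)
          have "norm (nderiv j (e \<phi>) t) \<le> A * ((\<Sum>i\<le>j. norm (ecoeff (of_real c) j i)) * Q)"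
            unfolding e_def smooth_exp_mult(2)[OF sm] norm_mult by (intro mult_mono 1 2) (auto simp: A_def)
          then show ?thesis by (simp only: mult.assoc)
        qed
      qed simp
      have "(\<Sum>j\<le>d. SUP t. norm (nderiv j (e \<phi>) t)) \<le> (\<Sum>j\<le>d. A * (\<Sum>i\<le>j. norm (ecoeff (of_real c) j i)) * Q)"
        by (rule sum_mono) (use le in auto)
      then have "(\<Sum>j\<le>d. SUP t. norm (nderiv j (e \<phi>) t)) \<le> G * Q" by (simp add: G_def sum_distrib_right)
      then have "C * E * (\<Sum>j\<le>d. SUP t. norm (nderiv j (e \<phi>) t)) \<le> C * E * (G * Q)"
        using C0 by (intro mult_left_mono) (auto simp: E_def intro!: mult_nonneg_nonneg sum_nonneg)
      moreover have "norm (T \<sigma> \<phi>) \<le> C * E * (\<Sum>j\<le>d. SUP t. norm (nderiv j (e \<phi>) t))"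
        unfolding Te E_def by (rule norm_T_le(2)[OF test_funs_bounded_derivs[OF eT[OF \<phi>(1)]] \<tau>])
      ultimately show ?thesis by (simp add: Q_def mult.assoc)
    qed
    then show "\<exists>C N. \<forall>\<phi>\<in>test_funs. fun_supp \<phi> \<subseteq> K \<longrightarrow> norm (T \<sigma> \<phi>) \<le> C * (\<Sum>j\<le>N. SUP t. norm (nderiv j \<phi> t))"
      by blast
  qed
  \<comment> \<open>H vanishes on the negative axis, so the support lies in t \<ge> 0; as an open
    half-line is asked for, M = 1 is taken.\<close>
  moreover have "dist_supp (T \<sigma>) \<subseteq> {- 1<..}"
  proof
    fix t assume t: "t \<in> dist_supp (T \<sigma>)"
    show "t \<in> {- 1<..}"
    proof (rule ccontr)
      assume "t \<notin> {- 1<..}"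
      then have "open {..<0::real}" "t \<in> {..<0}" by auto
      then obtain \<phi> where \<phi>: "\<phi> \<in> test_funs" "fun_supp \<phi> \<subseteq> {..<0}" "T \<sigma> \<phi> \<noteq> 0"
        using t unfolding dist_supp_def by blast
      have "H t * nderiv d (\<lambda>t. exp (\<sigma> * of_real t) * \<phi> t) t = 0" for t
      proof (cases "t < 0")
        case False
        then have "nderiv d (\<lambda>t. exp (\<sigma> * of_real t) * \<phi> t) t = 0"
          using \<phi>(2) by (intro nderiv_outside_support) (auto simp: fun_supp_exp_mult)
        then show ?thesis by simp
      qed (simp add: neg)
      then have "(\<lambda>t. H t * nderiv d (\<lambda>t. exp (\<sigma> * of_real t) * \<phi> t) t) = (\<lambda>_. 0)" by (rule ext)
      then have "T \<sigma> \<phi> = 0" unfolding T_def by simp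
      then show False using \<phi>(3) by simp
    qed
  qed
  moreover have "is_tempered (dist_mult (\<lambda>t. of_real (exp (- c * t))) (T \<sigma>))"
  proof -
    have "dist_mult (\<lambda>t. of_real (exp (- c * t))) (T \<sigma>) = T (\<sigma> + of_real (- c))"
      unfolding dist_mult_def of_real_exp_linear T_shift ..
    then show ?thesis using T_tempered[OF \<tau>] by (simp add: \<tau>_def)
  qed
  ultimately show ?thesis unfolding laplace_transformable_def by blast
qed

end


section \<open>The Newton--Cramer distribution of a Dirichlet series\<close>

text \<open>The effect of (\<tau> + D)^k on exp(u t) at t = 0; it recovers powers of \<sigma> + y
  when the Dirac derivatives meet exponentials.\<close>

lemma ecoeff_sum_powers: "(\<Sum>i\<le>k. ecoeff \<tau> k i * u ^ i) = (\<tau> + u) ^ k"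
proof (induction k)
  case (Suc k)
  have "(\<Sum>i\<le>Suc k. ecoeff \<tau> (Suc k) i * u ^ i) =
     (\<Sum>i\<le>Suc k. \<tau> * (ecoeff \<tau> k i * u ^ i)) + (\<Sum>i\<le>Suc k. (if i = 0 then 0 else ecoeff \<tau> k (i - 1)) * u ^ i)"
    by (simp add: sum.distrib[symmetric] algebra_simps del: sum.atMost_Suc)
  also have "(\<Sum>i\<le>Suc k. \<tau> * (ecoeff \<tau> k i * u ^ i)) = \<tau> * (\<tau> + u) ^ k"
    by (simp add: sum_distrib_left[symmetric] Suc ecoeff_eq_0)
  also have "(\<Sum>i\<le>Suc k. (if i = 0 then 0 else ecoeff \<tau> k (i - 1)) * u ^ i) = (\<Sum>i\<le>k. u * (ecoeff \<tau> k i * u ^ i))"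
    by (subst sum.atMost_Suc_shift) (simp add: mult_ac)
  also have "\<dots> = u * (\<tau> + u) ^ k" by (simp add: sum_distrib_left[symmetric] Suc)
  finally show ?case by (simp add: algebra_simps)
qed simp

text \<open>Holds for any Q with the factorization property, since the discrepancy polynomial comes
  from an unspecified choice. Uniqueness of limits identifies the product in that property with
  P.\<close>

lemma hadamard_factorization_log_derivative:
  assumes f: "meromorphic_finite_order f" "\<not> f constant_on UNIV" and d: "conv_exponent f = Suc m"
    and H: "hadamard_factorization f m \<sigma> Q"
    and U: "open U" "\<And>s. s \<in> U \<Longrightarrow> f analytic_on {s} \<and> f s \<noteq> 0" and s: "s \<in> U" "s \<noteq> \<sigma>"
  shows "deriv f s / f s = of_int (zorder f \<sigma>) / (s - \<sigma>) + poly (pderiv Q) s +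
    (\<Sum>\<^sub>\<infinity>\<rho>\<in>- {\<sigma>}. of_int (zorder f \<rho>) * hkernel m \<sigma> \<rho> s)"
proof -
  define n where "n = zorder f"
  interpret canonical_product n m \<sigma>
    by unfold_locales (use conv_exponent_summable[OF f, of \<sigma>] in \<open>simp add: d n_def\<close>)
  obtain P where P: "\<And>s. ((\<lambda>A. \<Prod>\<rho>\<in>A. factor \<rho> s) \<longlongrightarrow> P s) (finite_subsets_at_top (- {\<sigma>}))"
    "\<And>s. n s = 0 \<or> s = \<sigma> \<Longrightarrow> P s \<noteq> 0"
    "\<And>s. n s = 0 \<or> s = \<sigma> \<Longrightarrow> (P has_field_derivative P s * (\<Sum>\<^sub>\<infinity>\<rho>\<in>- {\<sigma>}. lfactor \<rho> s)) (at s)"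
    by (rule canonical_product_exists) (rule that)
  define W where "W z = (z - \<sigma>) powi n \<sigma> * exp (poly Q z) * P z" for z
  have fW: "f z = W z" if z: "z \<in> U" for z
  proof -
    have "\<not> is_pole f z" using U(2)[OF z] analytic_at_imp_no_pole by blast
    then obtain p where p: "((\<lambda>A. \<Prod>\<rho>\<in>A. factor \<rho> z) \<longlongrightarrow> p) (finite_subsets_at_top (- {\<sigma>}))"
      "f z = (z - \<sigma>) powi n \<sigma> * exp (poly Q z) * p"
      using H unfolding hadamard_factorization_def n_def by blast
    have "p = P z" using tendsto_unique[OF _ p(1) P(1)] by simp
    then show ?thesis using p(2) by (simp add: W_def)
  qed
  have ns: "n s = 0" unfolding n_def by (rule zorder_eq_0I) (use U(2)[OF s(1)] in auto)
  have nz: "s - \<sigma> \<noteq> 0" using s by simp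
  let ?S = "\<Sum>\<^sub>\<infinity>\<rho>\<in>- {\<sigma>}. lfactor \<rho> s"
  have d1: "((\<lambda>z. (z - \<sigma>) powi n \<sigma>) has_field_derivative of_int (n \<sigma>) * (s - \<sigma>) powi (n \<sigma> - 1) * 1) (at s)"
    by (rule DERIV_power_int) (use nz in \<open>auto intro!: derivative_eq_intros\<close>)
  have d2: "((\<lambda>z. exp (poly Q z)) has_field_derivative exp (poly Q s) * poly (pderiv Q) s) (at s)"
    by (rule DERIV_fun_exp[OF poly_DERIV])
  have "(W has_field_derivative
     (of_int (n \<sigma>) * (s - \<sigma>) powi (n \<sigma> - 1) * 1 * exp (poly Q s) + exp (poly Q s) * poly (pderiv Q) s * (s - \<sigma>) powi n \<sigma>) * P s
     + P s * ?S * ((s - \<sigma>) powi n \<sigma> * exp (poly Q s))) (at s)"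
    unfolding W_def[abs_def] by (rule DERIV_mult[OF DERIV_mult[OF d1 d2] P(3)[OF disjI1[OF ns]]])
  moreover have "(s - \<sigma>) powi (n \<sigma> - 1) = (s - \<sigma>) powi n \<sigma> / (s - \<sigma>)"
    using nz by (simp add: power_int_diff)
  moreover have "(i * (x / y) * 1 * e + e * a * x) * b + b * c * (x * e) = (i / y + a + c) * (x * e * b)" for i x y e a b c :: complex
    by (simp add: algebra_simps)
  ultimately have "(W has_field_derivative (of_int (n \<sigma>) / (s - \<sigma>) + poly (pderiv Q) s + ?S) * W s) (at s)"
    by (simp only: W_def)
  then have "(f has_field_derivative (of_int (n \<sigma>) / (s - \<sigma>) + poly (pderiv Q) s + ?S) * W s) (at s)"
    by (rule has_field_derivative_transform_within_open[OF _ U(1) s(1)]) (simp add: fW)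
  from DERIV_imp_deriv[OF this] show ?thesis
    using U(2)[OF s(1)] unfolding fW[OF s(1)] n_def by simp
qed

lemma log_deriv_term_add:
  "log_deriv_term a l (s + s') k = log_deriv_term a l s k * exp (- of_real (frequency l k) * s')"
  by (simp add: log_deriv_term_def exp_add[symmetric] algebra_simps)

lemma has_sum_finite_combination:
  fixes c :: "'b \<Rightarrow> complex"
  assumes "\<And>j. j \<in> J \<Longrightarrow> (f j has_sum x j) A"
  shows "((\<lambda>k. \<Sum>j\<in>J. c j * f j k) has_sum (\<Sum>j\<in>J. c j * x j)) A"
proof -
  have "((\<lambda>F. \<Sum>j\<in>J. c j * sum (f j) F) \<longlongrightarrow> (\<Sum>j\<in>J. c j * x j)) (finite_subsets_at_top A)"
    using assms unfolding has_sum_def by (intro tendsto_intros)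
  moreover have "(\<Sum>j\<in>J. c j * sum (f j) F) = (\<Sum>k\<in>F. \<Sum>j\<in>J. c j * f j k)" for F
    by (simp add: sum_distrib_left sum.swap[of _ J])
  ultimately show ?thesis by (simp add: has_sum_def)
qed

lemma poly_eq_sum_less:
  fixes p :: "complex poly"
  assumes "\<And>k. g \<le> k \<Longrightarrow> coeff p k = 0"
  shows "poly p x = (\<Sum>k<g. coeff p k * x ^ k)"
proof -
  have "poly p x = (\<Sum>k\<in>{..degree p} \<union> {..<g}. coeff p k * x ^ k)"
    unfolding poly_altdef by (rule sum.mono_neutral_left) (auto simp: coeff_eq_0)
  also have "\<dots> = (\<Sum>k<g. coeff p k * x ^ k)"
    by (rule sum.mono_neutral_right) (use assms in \<open>auto simp: not_less\<close>)
  finally show ?thesis .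
qed

theorem theorem4p1:
  fixes I :: "nat set" and a :: "nat \<Rightarrow> complex" and l :: "nat \<Rightarrow> real"
    and f :: "complex \<Rightarrow> complex" and \<sigma>0 :: real and \<sigma> :: complex
  defines "rhs \<equiv> (\<lambda>\<phi>.
      (\<Sum>k<genus f \<sigma>. discrepancy_coeff f \<sigma> k * (dist_deriv ^^ k) (dirac 0) \<phi>) +
      (\<Sum>\<^sub>\<infinity>k\<in>index_seqs I.
         of_real (frequency l k) * log_coeff a k * dirac (frequency l k) \<phi>))"
  assumes "I = {1..} \<or> (\<exists>N. I = {1..N})"
    and "strict_mono_on I l"
    and "\<And>n. n \<in> I \<Longrightarrow> 0 < l n"
    and "infinite I \<Longrightarrow> filterlim l at_top sequentially"
    and "\<And>s. Re s \<ge> \<sigma>0 \<Longrightarrow>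
           (\<lambda>n. norm (a n * exp (- of_real (l n) * s))) summable_on I"
    and "\<And>s. Re s \<ge> \<sigma>0 \<Longrightarrow>
           f s = 1 + (\<Sum>\<^sub>\<infinity>n\<in>I. a n * exp (- of_real (l n) * s))"
    and "meromorphic_finite_order f"
    and "\<not> f constant_on UNIV"
    and "conv_exponent f \<ge> 1"
  shows "laplace_transformable (newton_cramer f \<sigma>)
       \<and> laplace_transformable rhs
       \<and> dist_eq (newton_cramer f \<sigma>) rhs"
proof -
  note f = \<open>meromorphic_finite_order f\<close> \<open>\<not> f constant_on UNIV\<close>
  obtain m where d: "conv_exponent f = Suc m" using \<open>conv_exponent f \<ge> 1\<close> by (cases "conv_exponent f") auto
  define Q where "Q = hadamard_poly f \<sigma>"
  \<comment> \<open>Existence makes the choice behind \<open>hadamard_poly\<close> a genuine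
    factorization.\<close>
  have Q: "hadamard_factorization f m \<sigma> Q"
    unfolding Q_def hadamard_poly_def d diff_Suc_1 by (rule someI_ex[OF hadamard_factorization_exists[OF f d]])
  define p where "p = - pderiv Q"
  have poly_p: "poly p s = (\<Sum>k<genus f \<sigma>. discrepancy_coeff f \<sigma> k * s ^ k)" for s
  proof -
    have "coeff p k = 0" if "genus f \<sigma> \<le> k" for k
      using that by (auto simp: p_def coeff_pderiv genus_def Q_def intro!: coeff_eq_0)
    then show ?thesis by (subst poly_eq_sum_less) (auto simp: discrepancy_coeff_def p_def Q_def)
  qed
  obtain \<sigma>1 where dir: "\<And>s. \<sigma>1 < Re s \<Longrightarrow> f analytic_on {s} \<and> f s \<noteq> 0"
    "\<And>s. \<sigma>1 < Re s \<Longrightarrow> (\<lambda>k. norm (log_deriv_term a l s k)) summable_on index_seqs I"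
    "\<And>s. \<sigma>1 < Re s \<Longrightarrow> deriv f s / f s = infsum (log_deriv_term a l s) (index_seqs I)"
    by (rule dirichlet_log_derivative[OF assms(2-4,6,7)], assumption, assumption, assumption) (rule that)
  have Re: "Re \<rho> \<le> \<sigma>1" if "zorder f \<rho> \<noteq> 0" for \<rho>
    using dir(1)[of \<rho>] that by (metis not_less zorder_eq_0I)
  define K where "K = newton_cramer_kernel f (Suc m) \<sigma>"
  define H where "H t = (K t - K 0) * indicator {0..} t" for t
  obtain C b where C: "0 \<le> C" "0 \<le> b" "H \<in> borel_measurable borel" "\<And>t. t < 0 \<Longrightarrow> H t = 0"
    "\<And>t. 0 \<le> t \<Longrightarrow> norm (H t) \<le> C * exp (b * t)"
    and lap: "\<And>y. b < y \<Longrightarrow> of_real y ^ Suc m * (\<integral>t. indicator {0..} t *\<^sub>R (H t * exp (- of_real y * of_real t)) \<partial>lborel) =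
       of_int (zorder f \<sigma>) / of_real y + (\<Sum>\<^sub>\<infinity>\<rho>\<in>- {\<sigma>}. of_int (zorder f \<rho>) * hkernel m \<sigma> \<rho> (\<sigma> + of_real y))"
    by (rule newton_cramer_kernel_laplace[OF conv_exponent_summable[OF f, of \<sigma>, unfolded d] Re, folded K_def, folded H_def], assumption)
       (rule that)
  interpret kernel_functional H C b "Suc m"
    by unfold_locales (use C in auto)
  have NC: "newton_cramer f \<sigma> = T \<sigma>"
    by (rule ext) (simp only: newton_cramer_def Let_def d dist_mult_def dist_deriv_pow dist_of_fun_def T_def K_def H_def)
  define U where "U s = infsum (log_deriv_term a l s) (index_seqs I)" for s
  \<comment> \<open>The Hadamard factorization turns the transform of the kernel into f'/f - Q' at
    \<sigma> + y, and the Dirichlet series gives f'/f = U there.\<close>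
  have key: "of_real y ^ Suc m * (\<integral>t. H t * exp (- of_real y * of_real t) \<partial>lborel) = poly p (\<sigma> + of_real y) + U (\<sigma> + of_real y)"
    if y: "b < y" "\<sigma>1 < Re \<sigma> + y" for y
  proof -
    have op: "open {s. \<sigma>1 < Re s}" by (rule open_halfspace_Re_gt)
    have "\<sigma> + of_real y \<in> {s. \<sigma>1 < Re s}" "\<sigma> + of_real y \<noteq> \<sigma>" using y C(2) by auto
    from hadamard_factorization_log_derivative[OF f d Q op _ this] dir(1) lap[OF y(1)] dir(3)[of "\<sigma> + of_real y"] y(2)
    have "of_real y ^ Suc m * (\<integral>t. indicator {0..} t *\<^sub>R (H t * exp (- of_real y * of_real t)) \<partial>lborel) = poly p (\<sigma> + of_real y) + U (\<sigma> + of_real y)"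
      by (simp add: U_def p_def)
    moreover have "(\<lambda>t. indicator {0..} t *\<^sub>R (H t * exp (- of_real y * of_real t))) = (\<lambda>t. H t * exp (- of_real y * of_real t))"
      by (rule ext) (rule integral_half_line[symmetric])
    ultimately show ?thesis by (simp only:)
  qed
  have freq: "0 \<le> frequency l k" if "k \<in> index_seqs I" for k
    unfolding frequency_def
  proof (rule sum_nonneg)
    fix n assume "n \<in> {n. k n \<noteq> 0}"
    then have "n \<in> I" using that by (auto simp: index_seqs_def)
    then show "0 \<le> l n * real (k n)" using assms(4)[of n] by simp
  qed
  define g where "g = genus f \<sigma>"
  \<comment> \<open>The discrepancy part in terms of the derivatives v i of \<eta> at 0, where
    \<phi> = exp(- \<sigma> t) \<eta>; hence the coefficients of (- \<sigma> + D)^k. Arbitrary v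
    admits the approximant as well.\<close>
  define D where "D v = (\<Sum>k<g. discrepancy_coeff f \<sigma> k * ((-1) ^ k * (\<Sum>i\<le>k. ecoeff (- \<sigma>) k i * v i)))" for v :: "nat \<Rightarrow> complex"
  have D_diff: "norm (D v - D v') \<le> e * (\<Sum>k<g. norm (discrepancy_coeff f \<sigma> k) * (\<Sum>i\<le>k. norm (ecoeff (- \<sigma>) k i)))"
    if "\<And>i. i \<le> g \<Longrightarrow> norm (v i - v' i) \<le> e" for v v' e
  proof -
    have "D v - D v' = (\<Sum>k<g. discrepancy_coeff f \<sigma> k * ((-1) ^ k * (\<Sum>i\<le>k. ecoeff (- \<sigma>) k i * (v i - v' i))))"
      by (simp add: D_def sum_subtractf right_diff_distrib)
    also have "norm \<dots> \<le> (\<Sum>k<g. norm (discrepancy_coeff f \<sigma> k) * (\<Sum>i\<le>k. norm (ecoeff (- \<sigma>) k i) * e))"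
    proof (rule order_trans[OF norm_sum sum_mono])
      fix k assume k: "k \<in> {..<g}"
      have "norm (\<Sum>i\<le>k. ecoeff (- \<sigma>) k i * (v i - v' i)) \<le> (\<Sum>i\<le>k. norm (ecoeff (- \<sigma>) k i) * e)"
        by (rule order_trans[OF norm_sum sum_mono]) (use k that in \<open>auto simp: norm_mult intro!: mult_left_mono\<close>)
      then show "norm (discrepancy_coeff f \<sigma> k * ((-1) ^ k * (\<Sum>i\<le>k. ecoeff (- \<sigma>) k i * (v i - v' i))))
         \<le> norm (discrepancy_coeff f \<sigma> k) * (\<Sum>i\<le>k. norm (ecoeff (- \<sigma>) k i) * e)"
        by (simp add: norm_mult norm_power mult_left_mono)
    qed
    finally show ?thesis by (simp add: sum_distrib_left sum_distrib_right mult_ac)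
  qed
  \<comment> \<open>Positive for the approximation lemma, at least b + 1 so that the integral
    against H loses no constant, and beyond \<sigma>1 - Re \<sigma> so that the Dirac sum converges
    absolutely at \<sigma> + c.\<close>
  define c where "c = max 1 (max (b + 1) (\<sigma>1 - Re \<sigma> + 1))"
  have c: "0 < c" "b + 1 \<le> c" "\<sigma>1 < Re \<sigma> + c" by (auto simp: c_def)
  define A1 where "A1 = (\<Sum>k<g. norm (discrepancy_coeff f \<sigma> k) * (\<Sum>i\<le>k. norm (ecoeff (- \<sigma>) k i)))"
  define A2 where "A2 = (\<Sum>\<^sub>\<infinity>k\<in>index_seqs I. norm (log_deriv_term a l (\<sigma> + of_real c) k))"
  have sc: "(\<lambda>k. norm (log_deriv_term a l (\<sigma> + of_real c) k)) summable_on index_seqs I"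
    by (rule dir(2)) (use c in simp)
  have main: "T \<sigma> \<phi> = rhs \<phi>" if \<phi>: "\<phi> \<in> test_funs" for \<phi>
  proof -
    define \<eta> where "\<eta> = (\<lambda>t. exp (\<sigma> * of_real t) * \<phi> t)"
    have \<eta>: "\<eta> \<in> test_funs" unfolding \<eta>_def by (rule test_funs_exp_mult[OF \<phi>])
    then have sm: "smooth \<eta>" by (simp add: test_funs_def)
    have \<phi>\<eta>: "\<phi> = (\<lambda>t. exp (- \<sigma> * of_real t) * \<eta> t)"
      by (rule ext) (simp add: \<eta>_def mult_exp_exp mult.assoc[symmetric])
    have T\<phi>: "T \<sigma> \<phi> = (-1) ^ Suc m * (\<integral>t. H t * nderiv (Suc m) \<eta> t \<partial>lborel)"
      by (simp only: T_def \<eta>_def)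
    have "(dist_deriv ^^ k) (dirac 0) \<phi> = (-1) ^ k * (\<Sum>i\<le>k. ecoeff (- \<sigma>) k i * nderiv i \<eta> 0)" for k
      unfolding dist_deriv_pow dirac_def by (subst \<phi>\<eta>) (simp only: smooth_exp_mult(2)[OF sm], simp)
    moreover have "of_real (frequency l k) * log_coeff a k * dirac (frequency l k) \<phi> = log_deriv_term a l \<sigma> k * \<eta> (frequency l k)" for k
      unfolding dirac_def by (subst \<phi>\<eta>) (simp add: log_deriv_term_def mult_ac)
    ultimately have rhs: "rhs \<phi> = D (\<lambda>i. nderiv i \<eta> 0) + (\<Sum>\<^sub>\<infinity>k\<in>index_seqs I. log_deriv_term a l \<sigma> k * \<eta> (frequency l k))"
      by (simp only: rhs_def D_def g_def)
    \<comment> \<open>The constants C, A1 and A2 stem from the integral against H, the discrepancy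
      part and the Dirac sum; none depends on e.\<close>
    have approx: "norm (T \<sigma> \<phi> - rhs \<phi>) \<le> e * (C + A1 + A2)" if e: "0 < e" for e
    proof -
      \<comment> \<open>One approximant must serve the derivative of order \<open>Suc m\<close> in T
        and those of order below g in the discrepancy part.\<close>
      obtain \<alpha> :: "nat \<Rightarrow> complex" and M where \<alpha>: "\<And>j t. j \<le> max (Suc m) g \<Longrightarrow> 0 \<le> t \<Longrightarrow>
        norm (nderiv j \<eta> t - (\<Sum>k\<le>M. \<alpha> k * (- of_real (c + 1 + real k)) ^ j * exp (- of_real (c + 1 + real k) * of_real t)))
          \<le> e * exp (- c * t)"
        by (rule test_funs_exp_approx[OF \<eta> c(1) e, of "max (Suc m) g"]) (rule that)
      define y where "y k = c + 1 + real k" for k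
      have y: "b < y k" "\<sigma>1 < Re \<sigma> + y k" "0 < y k - b" for k using c by (auto simp: y_def)
      define E where "E j t = (\<Sum>k\<le>M. \<alpha> k * (- of_real (y k)) ^ j * exp (- of_real (y k) * of_real t))" for j and t :: real
      have E: "norm (nderiv j \<eta> t - E j t) \<le> e * exp (- c * t)" if "j \<le> max (Suc m) g" "0 \<le> t" for j t
        using \<alpha>[OF that] by (simp only: E_def y_def)
      have contE: "continuous_on A (E j)" for A j unfolding E_def by (intro continuous_intros)
      have i1: "integrable lborel (\<lambda>t. H t * exp (- of_real (y k) * of_real t))" for k
        by (rule integral_bound(1)[OF _ y(3), where B = 1])
           (auto intro!: borel_measurable_continuous_onI continuous_intros simp: norm_exp_eq_Re)
      have HE: "H t * E (Suc m) t = (\<Sum>k\<le>M. \<alpha> k * (- of_real (y k)) ^ Suc m * (H t * exp (- of_real (y k) * of_real t)))" for t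
        by (simp add: E_def sum_distrib_left mult_ac)
      have i2: "integrable lborel (\<lambda>t. H t * E (Suc m) t)"
        unfolding HE by (intro Bochner_Integration.integrable_sum integrable_mult_right i1)
      have "(\<integral>t. H t * E (Suc m) t \<partial>lborel) = (\<Sum>k\<le>M. \<alpha> k * (- of_real (y k)) ^ Suc m * (\<integral>t. H t * exp (- of_real (y k) * of_real t) \<partial>lborel))"
        unfolding HE by (subst Bochner_Integration.integral_sum) (simp_all only: integrable_mult_right i1 integral_mult_right_zero)
      then have "(-1) ^ Suc m * (\<integral>t. H t * E (Suc m) t \<partial>lborel) =
          (-1) ^ Suc m * (\<Sum>k\<le>M. \<alpha> k * (- of_real (y k)) ^ Suc m * (\<integral>t. H t * exp (- of_real (y k) * of_real t) \<partial>lborel))"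
        by (simp only:)
      also have "\<dots> = (\<Sum>k\<le>M. \<alpha> k * (of_real (y k) ^ Suc m * (\<integral>t. H t * exp (- of_real (y k) * of_real t) \<partial>lborel)))"
        unfolding sum_distrib_left
      proof (intro sum.cong refl)
        fix k
        \<comment> \<open>The sign of the distributional derivatives cancels that of differentiating
          exp(-y t).\<close>
        have "(-1) ^ Suc m * (- of_real (y k)) ^ Suc m = (of_real (y k) ^ Suc m :: complex)"
          unfolding power_mult_distrib[symmetric] by simp
        moreover have "x * (v * w * i) = v * ((x * w) * i)" for x v w i :: complex by (simp only: mult_ac)
        ultimately show "(-1) ^ Suc m * (\<alpha> k * (- of_real (y k)) ^ Suc m * (\<integral>t. H t * exp (- of_real (y k) * of_real t) \<partial>lborel)) =
          \<alpha> k * (of_real (y k) ^ Suc m * (\<integral>t. H t * exp (- of_real (y k) * of_real t) \<partial>lborel))"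
          by (simp only:)
      qed
      also have "\<dots> = (\<Sum>k\<le>M. \<alpha> k * (poly p (\<sigma> + of_real (y k)) + U (\<sigma> + of_real (y k))))"
        by (simp only: key[OF y(1,2)])
      finally have TE: "(-1) ^ Suc m * (\<integral>t. H t * E (Suc m) t \<partial>lborel) =
         (\<Sum>k\<le>M. \<alpha> k * poly p (\<sigma> + of_real (y k))) + (\<Sum>k\<le>M. \<alpha> k * U (\<sigma> + of_real (y k)))"
        by (simp only: distrib_left sum.distrib)
      have meas\<eta>: "(\<lambda>t. nderiv (Suc m) \<eta> t - E (Suc m) t) \<in> borel_measurable borel"
        by (intro borel_measurable_continuous_onI continuous_intros smooth_continuous[OF sm] contE)
      have i3: "integrable lborel (\<lambda>t. H t * (nderiv (Suc m) \<eta> t - E (Suc m) t))"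
        "norm (\<integral>t. H t * (nderiv (Suc m) \<eta> t - E (Suc m) t) \<partial>lborel) \<le> C * e / (c - b)"
      proof -
        have cb: "0 < c - b" using c by simp
        have le: "norm (nderiv (Suc m) \<eta> t - E (Suc m) t) \<le> e * exp (- (b + (c - b)) * t)" if "0 \<le> t" for t
          using E[of "Suc m" t] that by simp
        show "integrable lborel (\<lambda>t. H t * (nderiv (Suc m) \<eta> t - E (Suc m) t))"
          by (rule integral_bound(1)[OF meas\<eta> cb le])
        show "norm (\<integral>t. H t * (nderiv (Suc m) \<eta> t - E (Suc m) t) \<partial>lborel) \<le> C * e / (c - b)"
          by (rule integral_bound(2)[OF meas\<eta> cb le])
      qed
      have "C * e / (c - b) \<le> C * e / 1" using c C(1) e by (intro divide_left_mono) auto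
      moreover have "(\<integral>t. H t * (nderiv (Suc m) \<eta> t - E (Suc m) t) \<partial>lborel) =
         (\<integral>t. H t * nderiv (Suc m) \<eta> t \<partial>lborel) - (\<integral>t. H t * E (Suc m) t \<partial>lborel)"
      proof -
        have "integrable lborel (\<lambda>t. H t * (nderiv (Suc m) \<eta> t - E (Suc m) t) + H t * E (Suc m) t)"
          by (rule Bochner_Integration.integrable_add[OF i3(1) i2])
        then have "integrable lborel (\<lambda>t. H t * nderiv (Suc m) \<eta> t)" by (simp add: algebra_simps)
        then show ?thesis unfolding right_diff_distrib by (rule Bochner_Integration.integral_diff[OF _ i2])
      qed
      ultimately have 1: "norm (T \<sigma> \<phi> - (-1) ^ Suc m * (\<integral>t. H t * E (Suc m) t \<partial>lborel)) \<le> e * C"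
        using i3(2) unfolding T\<phi> right_diff_distrib[symmetric] by (simp add: norm_mult norm_power mult.commute)
      have 2: "norm (D (\<lambda>i. nderiv i \<eta> 0) - D (\<lambda>i. E i 0)) \<le> e * A1"
        unfolding A1_def by (rule D_diff) (use E[of _ 0] in simp)
      \<comment> \<open>On the approximant the discrepancy part yields the values of p at \<sigma> +
        y, the same as in the transform of the kernel.\<close>
      have DE: "D (\<lambda>i. E i 0) = (\<Sum>k\<le>M. \<alpha> k * poly p (\<sigma> + of_real (y k)))"
      proof -
        have "(\<Sum>i\<le>k. ecoeff (- \<sigma>) k i * E i 0) = (\<Sum>j\<le>M. \<alpha> j * (- (\<sigma> + of_real (y j))) ^ k)" for k
        proof -
          have "(\<Sum>i\<le>k. ecoeff (- \<sigma>) k i * E i 0) = (\<Sum>i\<le>k. \<Sum>j\<le>M. \<alpha> j * (ecoeff (- \<sigma>) k i * (- of_real (y j)) ^ i))"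
            by (simp add: E_def sum_distrib_left mult_ac)
          also have "\<dots> = (\<Sum>j\<le>M. \<alpha> j * (\<Sum>i\<le>k. ecoeff (- \<sigma>) k i * (- of_real (y j)) ^ i))"
            by (subst sum.swap) (simp add: sum_distrib_left)
          finally show ?thesis by (simp add: ecoeff_sum_powers)
        qed
        then have "D (\<lambda>i. E i 0) = (\<Sum>k<g. \<Sum>j\<le>M. discrepancy_coeff f \<sigma> k * ((-1) ^ k * (\<alpha> j * (- (\<sigma> + of_real (y j))) ^ k)))"
          by (simp only: D_def sum_distrib_left)
        also have "\<dots> = (\<Sum>j\<le>M. \<Sum>k<g. \<alpha> j * (discrepancy_coeff f \<sigma> k * (\<sigma> + of_real (y j)) ^ k))"
        proof (subst sum.swap, intro sum.cong refl)
          fix j k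
          have "(-1) ^ k * (- (\<sigma> + of_real (y j))) ^ k = (\<sigma> + of_real (y j)) ^ k"
            unfolding power_mult_distrib[symmetric] by (simp add: add.commute)
          moreover have "u * (v * (w * z)) = w * (u * (v * z))" for u v w z :: complex by (simp only: mult_ac)
          ultimately show "discrepancy_coeff f \<sigma> k * ((-1) ^ k * (\<alpha> j * (- (\<sigma> + of_real (y j))) ^ k)) =
             \<alpha> j * (discrepancy_coeff f \<sigma> k * (\<sigma> + of_real (y j)) ^ k)"
            by (simp only:)
        qed
        finally show ?thesis by (simp only: poly_p g_def sum_distrib_left)
      qed
      let ?t = "log_deriv_term a l \<sigma>"
      have hs: "(log_deriv_term a l (\<sigma> + of_real (y j)) has_sum U (\<sigma> + of_real (y j))) (index_seqs I)" for j
        unfolding U_def by (rule has_sum_infsum, rule abs_summable_summable, rule dir(2)) (use y(2)[of j] in simp)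
      have "((\<lambda>k. \<Sum>j\<le>M. \<alpha> j * log_deriv_term a l (\<sigma> + of_real (y j)) k) has_sum (\<Sum>j\<le>M. \<alpha> j * U (\<sigma> + of_real (y j)))) (index_seqs I)"
        by (rule has_sum_finite_combination) (rule hs)
      moreover have "(\<Sum>j\<le>M. \<alpha> j * log_deriv_term a l (\<sigma> + of_real (y j)) k) = ?t k * E 0 (frequency l k)" for k
        by (simp add: E_def log_deriv_term_add sum_distrib_left mult_ac)
      ultimately have hE: "((\<lambda>k. ?t k * E 0 (frequency l k)) has_sum (\<Sum>j\<le>M. \<alpha> j * U (\<sigma> + of_real (y j)))) (index_seqs I)"
        by simp
      \<comment> \<open>The weight exp(-c t) of the error, taken at the frequency, moves the term
        from \<sigma> to \<sigma> + c, where the series is absolutely summable.\<close>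
      have bd: "norm (?t k * (\<eta> (frequency l k) - E 0 (frequency l k))) \<le> e * norm (log_deriv_term a l (\<sigma> + of_real c) k)"
        if "k \<in> index_seqs I" for k
      proof -
        have "norm (?t k * (\<eta> (frequency l k) - E 0 (frequency l k))) \<le> norm (?t k) * (e * exp (- c * frequency l k))"
          unfolding norm_mult using E[of 0, OF _ freq[OF that]] by (intro mult_left_mono) auto
        also have "\<dots> = e * norm (log_deriv_term a l (\<sigma> + of_real c) k)"
          by (simp add: log_deriv_term_add norm_mult norm_exp_eq_Re mult_ac)
        finally show ?thesis .
      qed
      have sd: "(\<lambda>k. norm (?t k * (\<eta> (frequency l k) - E 0 (frequency l k)))) summable_on index_seqs I"
        by (rule summable_on_comparison_test[OF summable_on_cmult_right[OF sc] bd]) auto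
      then have hd: "((\<lambda>k. ?t k * (\<eta> (frequency l k) - E 0 (frequency l k))) has_sum
         (\<Sum>\<^sub>\<infinity>k\<in>index_seqs I. ?t k * (\<eta> (frequency l k) - E 0 (frequency l k)))) (index_seqs I)"
        by (rule has_sum_infsum[OF abs_summable_summable])
      have nd: "norm (\<Sum>\<^sub>\<infinity>k\<in>index_seqs I. ?t k * (\<eta> (frequency l k) - E 0 (frequency l k))) \<le> e * A2"
      proof -
        have "norm (\<Sum>\<^sub>\<infinity>k\<in>index_seqs I. ?t k * (\<eta> (frequency l k) - E 0 (frequency l k))) \<le>
            (\<Sum>\<^sub>\<infinity>k\<in>index_seqs I. norm (?t k * (\<eta> (frequency l k) - E 0 (frequency l k))))"
          by (rule norm_infsum_bound[OF sd])
        also have "\<dots> \<le> (\<Sum>\<^sub>\<infinity>k\<in>index_seqs I. e * norm (log_deriv_term a l (\<sigma> + of_real c) k))"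
          by (rule infsum_mono[OF sd summable_on_cmult_right[OF sc] bd])
        also have "\<dots> = e * A2" unfolding A2_def by (rule infsum_cmult_right) (use sc in simp)
        finally show ?thesis .
      qed
      have "((\<lambda>k. ?t k * \<eta> (frequency l k)) has_sum
         (\<Sum>\<^sub>\<infinity>k\<in>index_seqs I. ?t k * (\<eta> (frequency l k) - E 0 (frequency l k))) + (\<Sum>j\<le>M. \<alpha> j * U (\<sigma> + of_real (y j)))) (index_seqs I)"
        using has_sum_add[OF hd hE] by (simp add: right_diff_distrib)
      from infsumI[OF this] have "(\<Sum>\<^sub>\<infinity>k\<in>index_seqs I. ?t k * \<eta> (frequency l k)) - (\<Sum>j\<le>M. \<alpha> j * U (\<sigma> + of_real (y j))) =
         (\<Sum>\<^sub>\<infinity>k\<in>index_seqs I. ?t k * (\<eta> (frequency l k) - E 0 (frequency l k)))"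
        by (simp only: add_diff_cancel_right')
      then have 3: "norm ((\<Sum>\<^sub>\<infinity>k\<in>index_seqs I. ?t k * \<eta> (frequency l k)) - (\<Sum>j\<le>M. \<alpha> j * U (\<sigma> + of_real (y j)))) \<le> e * A2"
        using nd by simp
      have comb: "norm (x - (u + v)) \<le> r1 + r2 + r3"
        if "norm (x - (u' + v')) \<le> r1" "norm (u - u') \<le> r2" "norm (v - v') \<le> r3" for x u v u' v' :: complex and r1 r2 r3
      proof -
        have "x - (u + v) = ((x - (u' + v')) - (u - u')) - (v - v')" by simp
        then have "norm (x - (u + v)) = norm (((x - (u' + v')) - (u - u')) - (v - v'))" by (rule arg_cong)
        also have "\<dots> \<le> norm (x - (u' + v')) + norm (u - u') + norm (v - v')"
          using norm_triangle_ineq4[of "(x - (u' + v')) - (u - u')" "v - v'"] norm_triangle_ineq4[of "x - (u' + v')" "u - u'"]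
          by linarith
        finally show ?thesis using that by linarith
      qed
      \<comment> \<open>Both sides agree exactly on the approximant, so only the three approximation
        errors remain.\<close>
      have "norm (T \<sigma> \<phi> - rhs \<phi>) \<le> e * C + e * A1 + e * A2"
        unfolding rhs by (rule comb[OF 1[unfolded TE] 2[unfolded DE] 3])
      then show ?thesis by (simp add: algebra_simps)
    qed
    have "norm (T \<sigma> \<phi> - rhs \<phi>) \<le> 0"
    proof (rule field_le_epsilon)
      fix r :: real assume r: "0 < r"
      have A: "0 \<le> C + A1 + A2"
        using C(1) unfolding A1_def A2_def by (auto intro!: add_nonneg_nonneg sum_nonneg mult_nonneg_nonneg infsum_nonneg)
      \<comment> \<open>The summand 1 keeps the denominator positive.\<close>
      have "norm (T \<sigma> \<phi> - rhs \<phi>) \<le> r / (C + A1 + A2 + 1) * (C + A1 + A2)"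
        by (rule approx) (use r A in simp)
      also have "\<dots> \<le> r" using r A by (simp add: field_simps)
      finally show "norm (T \<sigma> \<phi> - rhs \<phi>) \<le> 0 + r" by simp
    qed
    then show ?thesis by simp
  qed
  have eq: "dist_eq (T \<sigma>) rhs" unfolding dist_eq_def using main by (intro ballI)
  show ?thesis
    unfolding NC
  proof (intro conjI)
    show "laplace_transformable (T \<sigma>)" by (rule T_laplace_transformable)
    show "laplace_transformable rhs" by (rule laplace_transformable_cong[OF eq T_laplace_transformable])
    show "dist_eq (T \<sigma>) rhs" by (rule eq)
  qed
qed

end
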